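(* The theory $\mathsf{RCA}_0$ proves that $\mathsf{RT}^3_2$ implies $\forall \mathcal{X}\,(\mathsf{WO}(\mathcal{X})\to \mathsf{WO}(\boldsymbol{\omega}^{\mathcal{X}}))$, where $\mathcal{X}$ ranges over linear orders. Moreover, the principle $\forall\mathcal{X}\,(\mathsf{WO}(\mathcal{X})\to \mathsf{WO}(\boldsymbol{\omega}^{\mathcal{X}}))$, regarded as a problem in contrapositive form, is Weihrauch reducible to $\mathsf{RT}^3_2$.
   Context: $\mathsf{RCA}_0$ is the usual base system of Reverse Mathematics in the language of second-order arithmetic. $\mathsf{RT}^3_2$ is Ramsey's Theorem for triples and two colours: for every colouring $C:[\mathbb{N}]^3\to\{0,1\}$ of the 3-element subsets of $\mathbb{N}$ there is an infinite set $H\subseteq\mathbb{N}$ such that $C$ is constant on $[H]^3$. As a problem, its instances are such colourings $C$ and the solutions to $C$ are the infinite monochromatic sets $H$. $\mathsf{WO}(\mathcal{X})$ is the $\Pi^1_1$ statement that the linear order $\mathcal{X}$ is a well-ordering (no infinite strictly descending sequence). For a linear order $\mathcal{X}$, $\boldsymbol{\omega}^{\mathcal{X}}$ is the set of finite strings $\langle x_0,x_1,\dots,x_k\rangle$ of elements of $\mathcal{X}$ with $x_0\geq_{\mathcal{X}} x_1\geq_{\mathcal{X}}\dots\geq_{\mathcal{X}} x_k$, ordered lexicographically (a proper initial segment of a string is smaller than the string). The intended meaning of $\langle x_0,\dots,x_k\rangle$ is $\omega^{x_0}+\dots+\omega^{x_k}$. The problem associated with the well-ordering principle $\forall\mathcal{X}\,(\mathsf{WO}(\mathcal{X})\to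 \mathsf{WO}(\boldsymbol{\omega}^{\mathcal{X}}))$ is its contrapositive: an instance is a linear order $\mathcal{X}$ together with an infinite strictly descending sequence in $\boldsymbol{\omega}^{\mathcal{X}}$; a solution is an infinite strictly descending sequence in $\mathcal{X}$. A problem $\mathsf{Q}$ is Weihrauch reducible to a problem $\mathsf{P}$ (written $\mathsf{Q}\leq_{\mathrm{W}}\mathsf{P}$) if there are Turing functionals $\Phi,\Psi$ such that for every instance $X$ of $\mathsf{Q}$, $\Phi(X)$ is an instance of $\mathsf{P}$, and whenever $\hat{Y}$ is a solution to $\mathsf{P}$ for $\Phi(X)$, $\Psi(X\oplus\hat{Y})$ is a solution to $\mathsf{Q}$ for $X$. *)

theory Defs
  imports "HOL-Library.Ramsey" "HOL-Library.Nat_Bijection" "HOL-Library.FuncSet"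
begin

section \<open>The language of second-order arithmetic\<close>

text \<open>
  Formulas are in de Bruijn form, with separate index spaces for number variables
  (\<open>All\<close> binds) and set variables (\<open>AllS\<close> binds).  Set variables are the only set terms, and
  equality is primitive for numbers only.
\<close>

datatype tm = Var nat | Zero | One | Add tm tm | Mul tm tm

datatype fm =
    Eq tm tm
  | Less tm tm
  | Mem tm nat
  | Fls
  | Imp fm fm
  | All fm
  | AllS fm

abbreviation Neg :: "fm \<Rightarrow> fm" where "Neg A \<equiv> Imp A Fls"
abbreviation And :: "fm \<Rightarrow> fm \<Rightarrow> fm" where "And A B \<equiv> Neg (Imp A (Neg B))"
abbreviation Or :: "fm \<Rightarrow> fm \<Rightarrow> fm" where "Or A B \<equiv> Imp (Neg A) B"
abbreviation Iff :: "fm \<Rightarrow> fm \<Rightarrow> fm" where "Iff A B \<equiv> And (Imp A B) (Imp B A)"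
abbreviation Ex :: "fm \<Rightarrow> fm" where "Ex A \<equiv> Neg (All (Neg A))"
abbreviation ExS :: "fm \<Rightarrow> fm" where "ExS A \<equiv> Neg (AllS (Neg A))"

primrec subst_tm :: "(nat \<Rightarrow> tm) \<Rightarrow> tm \<Rightarrow> tm" where
  "subst_tm \<sigma> (Var i) = \<sigma> i"
| "subst_tm \<sigma> Zero = Zero"
| "subst_tm \<sigma> One = One"
| "subst_tm \<sigma> (Add s t) = Add (subst_tm \<sigma> s) (subst_tm \<sigma> t)"
| "subst_tm \<sigma> (Mul s t) = Mul (subst_tm \<sigma> s) (subst_tm \<sigma> t)"

definition lift_tm :: "tm \<Rightarrow> tm" where
  "lift_tm = subst_tm (\<lambda>i. Var (Suc i))"

text \<open>Simultaneous substitution of terms for number variables and of variables for set variables.\<close>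

primrec subst :: "(nat \<Rightarrow> tm) \<Rightarrow> (nat \<Rightarrow> nat) \<Rightarrow> fm \<Rightarrow> fm" where
  "subst \<sigma> \<rho> (Eq s t) = Eq (subst_tm \<sigma> s) (subst_tm \<sigma> t)"
| "subst \<sigma> \<rho> (Less s t) = Less (subst_tm \<sigma> s) (subst_tm \<sigma> t)"
| "subst \<sigma> \<rho> (Mem t X) = Mem (subst_tm \<sigma> t) (\<rho> X)"
| "subst \<sigma> \<rho> Fls = Fls"
| "subst \<sigma> \<rho> (Imp A B) = Imp (subst \<sigma> \<rho> A) (subst \<sigma> \<rho> B)"
| "subst \<sigma> \<rho> (All A) = All (subst (case_nat (Var 0) (\<lambda>i. lift_tm (\<sigma> i))) \<rho> A)"
| "subst \<sigma> \<rho> (AllS A) = AllS (subst \<sigma> (case_nat 0 (\<lambda>i. Suc (\<rho> i))) A)"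

definition lift :: "fm \<Rightarrow> fm" where
  "lift = subst (\<lambda>i. Var (Suc i)) (\<lambda>i. i)"

definition liftS :: "fm \<Rightarrow> fm" where
  "liftS = subst Var Suc"

definition inst :: "tm \<Rightarrow> fm \<Rightarrow> fm" where
  "inst t = subst (case_nat t Var) (\<lambda>i. i)"

definition instS :: "nat \<Rightarrow> fm \<Rightarrow> fm" where
  "instS X = subst Var (case_nat X (\<lambda>i. i))"


section \<open>Classical natural deduction\<close>

text \<open>
  \<open>T ; G \<turnstile> A\<close>: the formula \<open>A\<close> is derivable from the axioms \<open>T\<close> and the hypotheses \<open>G\<close>.
  Free variables of axioms are read universally (the eigenvariable conditions concern
  \<open>G\<close> only), so \<open>T\<close> amounts to the universal closures of its members.
\<close>

inductive derivable :: "fm set \<Rightarrow> fm set \<Rightarrow> fm \<Rightarrow> bool" (\<open>_ ; _ \<turnstile> _\<close> [50, 50, 50] 50)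
  for T :: "fm set" where
  Axiom: "A \<in> T \<Longrightarrow> T ; G \<turnstile> A"
| Hyp: "A \<in> G \<Longrightarrow> T ; G \<turnstile> A"
| ImpI: "T ; insert A G \<turnstile> B \<Longrightarrow> T ; G \<turnstile> Imp A B"
| ImpE: "T ; G \<turnstile> Imp A B \<Longrightarrow> T ; G \<turnstile> A \<Longrightarrow> T ; G \<turnstile> B"
| Contra: "T ; insert (Neg A) G \<turnstile> Fls \<Longrightarrow> T ; G \<turnstile> A"
| AllI: "T ; lift ` G \<turnstile> A \<Longrightarrow> T ; G \<turnstile> All A"
| AllE: "T ; G \<turnstile> All A \<Longrightarrow> T ; G \<turnstile> inst t A"
| AllSI: "T ; liftS ` G \<turnstile> A \<Longrightarrow> T ; G \<turnstile> AllS A"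
| AllSE: "T ; G \<turnstile> AllS A \<Longrightarrow> T ; G \<turnstile> instS X A"
| EqI: "T ; G \<turnstile> Eq t t"
| EqE: "T ; G \<turnstile> Eq s t \<Longrightarrow> T ; G \<turnstile> inst s A \<Longrightarrow> T ; G \<turnstile> inst t A"

definition proves :: "fm set \<Rightarrow> fm \<Rightarrow> bool" where
  "proves T A \<longleftrightarrow> T ; {} \<turnstile> A"


section \<open>The axioms of \<open>RCA\<^sub>0\<close>\<close>

definition basic_axioms :: "fm set" where
  "basic_axioms = {
     Neg (Eq (Add (Var 0) One) Zero),
     Imp (Eq (Add (Var 0) One) (Add (Var 1) One)) (Eq (Var 0) (Var 1)),
     Eq (Add (Var 0) Zero) (Var 0),
     Eq (Add (Var 0) (Add (Var 1) One)) (Add (Add (Var 0) (Var 1)) One),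
     Eq (Mul (Var 0) Zero) Zero,
     Eq (Mul (Var 0) (Add (Var 1) One)) (Add (Mul (Var 0) (Var 1)) (Var 0)),
     Neg (Less (Var 0) Zero),
     Iff (Less (Var 0) (Add (Var 1) One)) (Or (Less (Var 0) (Var 1)) (Eq (Var 0) (Var 1)))}"

text \<open>
  Formulas with bounded number quantifiers only.  A bounded existential quantifier is
  \<open>Neg (All (Imp (Less (Var 0) (lift_tm t)) (Neg A)))\<close>; lifting \<open>t\<close> ensures that the bound
  does not contain the quantified variable.
\<close>

inductive Sigma00 :: "fm \<Rightarrow> bool" where
  "Sigma00 (Eq s t)"
| "Sigma00 (Less s t)"
| "Sigma00 (Mem t X)"
| "Sigma00 Fls"
| "Sigma00 A \<Longrightarrow> Sigma00 B \<Longrightarrow> Sigma00 (Imp A B)"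
| "Sigma00 A \<Longrightarrow> Sigma00 (All (Imp (Less (Var 0) (lift_tm t)) A))"

definition Sigma01 :: "fm \<Rightarrow> bool" where
  "Sigma01 A \<longleftrightarrow> (\<exists>B. Sigma00 B \<and> A = Ex B)"

definition Pi01 :: "fm \<Rightarrow> bool" where
  "Pi01 A \<longleftrightarrow> (\<exists>B. Sigma00 B \<and> A = All B)"

text \<open>
  In both schemes the distinguished number variable of \<open>A\<close> has index 0 and all other free
  variables are parameters; the lifting keeps the set \<open>X\<close> to be formed from occurring in \<open>A\<close>.
\<close>

definition induction_axiom :: "fm \<Rightarrow> fm" where
  "induction_axiom A =
     Imp (And (inst Zero A)
              (All (Imp A (subst (case_nat (Add (Var 0) One) (\<lambda>i. Var (Suc i))) (\<lambda>i. i) A))))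
         (All A)"

definition comprehension_axiom :: "fm \<Rightarrow> fm \<Rightarrow> fm" where
  "comprehension_axiom A B =
     Imp (All (Iff A B)) (ExS (All (Iff (Mem (Var 0) 0) (liftS A))))"

definition RCA0 :: "fm set" where
  "RCA0 = basic_axioms
     \<union> {induction_axiom A | A. Sigma01 A}
     \<union> {comprehension_axiom A B | A B. Sigma01 A \<and> Pi01 B}"


section \<open>Writing formulas with named bound variables\<close>

text \<open>
  A term or formula in scope is a function of the number of enclosing number binders \<open>k\<close>
  (and set binders \<open>l\<close>).  A bound variable introduced below \<open>k\<close> binders has index \<open>k' - Suc k\<close>
  when it is used below \<open>k'\<close> binders.  A closed formula \<open>A\<close> denotes the sentence \<open>A 0 0\<close>.
\<close>

type_synonym nterm = "nat \<Rightarrow> tm"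
type_synonym sterm = "nat \<Rightarrow> nat"
type_synonym form = "nat \<Rightarrow> nat \<Rightarrow> fm"

definition all_num :: "(nterm \<Rightarrow> form) \<Rightarrow> form" (binder \<open>\<^bold>\<forall>\<close> 10) where
  "all_num F = (\<lambda>k l. All (F (\<lambda>k'. Var (k' - Suc k)) (Suc k) l))"

definition all_set :: "(sterm \<Rightarrow> form) \<Rightarrow> form" (binder \<open>\<^bold>\<forall>\<^sub>S\<close> 10) where
  "all_set F = (\<lambda>k l. AllS (F (\<lambda>l'. l' - Suc l) k (Suc l)))"

definition eq :: "nterm \<Rightarrow> nterm \<Rightarrow> form" (infix \<open>\<^bold>=\<close> 50) where
  "(s \<^bold>= t) = (\<lambda>k l. Eq (s k) (t k))"

definition less :: "nterm \<Rightarrow> nterm \<Rightarrow> form" (infix \<open>\<^bold><\<close> 50) where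
  "(s \<^bold>< t) = (\<lambda>k l. Less (s k) (t k))"

definition mem :: "nterm \<Rightarrow> sterm \<Rightarrow> form" (infix \<open>\<^bold>\<in>\<close> 50) where
  "(t \<^bold>\<in> X) = (\<lambda>k l. Mem (t k) (X l))"

definition neg :: "form \<Rightarrow> form" (\<open>\<^bold>\<not> _\<close> [40] 40) where
  "(\<^bold>\<not> A) = (\<lambda>k l. Neg (A k l))"

definition conj :: "form \<Rightarrow> form \<Rightarrow> form" (infixr \<open>\<^bold>\<and>\<close> 35) where
  "(A \<^bold>\<and> B) = (\<lambda>k l. And (A k l) (B k l))"

definition disj :: "form \<Rightarrow> form \<Rightarrow> form" (infixr \<open>\<^bold>\<or>\<close> 30) where
  "(A \<^bold>\<or> B) = (\<lambda>k l. Or (A k l) (B k l))"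

definition imp :: "form \<Rightarrow> form \<Rightarrow> form" (infixr \<open>\<^bold>\<longrightarrow>\<close> 25) where
  "(A \<^bold>\<longrightarrow> B) = (\<lambda>k l. Imp (A k l) (B k l))"

definition iff :: "form \<Rightarrow> form \<Rightarrow> form" (infixr \<open>\<^bold>\<longleftrightarrow>\<close> 25) where
  "(A \<^bold>\<longleftrightarrow> B) = (\<lambda>k l. Iff (A k l) (B k l))"

definition ex_num :: "(nterm \<Rightarrow> form) \<Rightarrow> form" (binder \<open>\<^bold>\<exists>\<close> 10) where
  "ex_num F = (\<^bold>\<not> (\<^bold>\<forall>x. \<^bold>\<not> F x))"

definition ex_set :: "(sterm \<Rightarrow> form) \<Rightarrow> form" (binder \<open>\<^bold>\<exists>\<^sub>S\<close> 10) where
  "ex_set F = (\<^bold>\<not> (\<^bold>\<forall>\<^sub>SX. \<^bold>\<not> F X))"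

definition ex1_num :: "(nterm \<Rightarrow> form) \<Rightarrow> form" (binder \<open>\<^bold>\<exists>!\<close> 10) where
  "ex1_num F = (\<^bold>\<exists>x. F x \<^bold>\<and> (\<^bold>\<forall>y. F y \<^bold>\<longrightarrow> y \<^bold>= x))"

definition ball_num :: "nterm \<Rightarrow> (nterm \<Rightarrow> form) \<Rightarrow> form" where
  "ball_num t F = (\<^bold>\<forall>x. x \<^bold>< t \<^bold>\<longrightarrow> F x)"

definition bex_num :: "nterm \<Rightarrow> (nterm \<Rightarrow> form) \<Rightarrow> form" where
  "bex_num t F = (\<^bold>\<not> ball_num t (\<lambda>x. \<^bold>\<not> F x))"

syntax
  "_ball_num" :: "pttrn \<Rightarrow> nterm \<Rightarrow> form \<Rightarrow> form" (\<open>(3\<^bold>\<forall>_\<^bold><_./ _)\<close> [0, 51, 10] 10)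
  "_bex_num" :: "pttrn \<Rightarrow> nterm \<Rightarrow> form \<Rightarrow> form" (\<open>(3\<^bold>\<exists>_\<^bold><_./ _)\<close> [0, 51, 10] 10)
translations
  "\<^bold>\<forall>x\<^bold><t. A" \<rightleftharpoons> "CONST ball_num t (\<lambda>x. A)"
  "\<^bold>\<exists>x\<^bold><t. A" \<rightleftharpoons> "CONST bex_num t (\<lambda>x. A)"

definition zero :: nterm (\<open>\<^bold>0\<close>) where "\<^bold>0 = (\<lambda>k. Zero)"
definition one :: nterm (\<open>\<^bold>1\<close>) where "\<^bold>1 = (\<lambda>k. One)"

definition add :: "nterm \<Rightarrow> nterm \<Rightarrow> nterm" (infixl \<open>\<^bold>+\<close> 65) where
  "s \<^bold>+ t = (\<lambda>k. Add (s k) (t k))"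

definition mul :: "nterm \<Rightarrow> nterm \<Rightarrow> nterm" (infixl \<open>\<^bold>*\<close> 70) where
  "s \<^bold>* t = (\<lambda>k. Mul (s k) (t k))"


section \<open>Coding in second-order arithmetic\<close>

text \<open>The codes are those of Simpson, \<^emph>\<open>Subsystems of Second Order Arithmetic\<close>, Section II.2.\<close>

definition pair :: "nterm \<Rightarrow> nterm \<Rightarrow> nterm" (\<open>\<^bold>\<langle>_,/ _\<^bold>\<rangle>\<close>) where
  "\<^bold>\<langle>s, t\<^bold>\<rangle> = (s \<^bold>+ t) \<^bold>* (s \<^bold>+ t) \<^bold>+ s"

text \<open>
  The number \<open>\<langle>k, \<langle>m, n\<rangle>\<rangle>\<close> codes the finite set of all \<open>i < k\<close> such that
  \<open>m * (i + 1) + 1\<close> divides \<open>n\<close>.  Every finite set has such a code, and the least one is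
  \<^emph>\<open>the\<close> code of the set.
\<close>

definition elem :: "nterm \<Rightarrow> nterm \<Rightarrow> form" (infix \<open>\<^bold>\<epsilon>\<close> 50) where
  "(i \<^bold>\<epsilon> a) = (\<^bold>\<exists>k\<^bold><a \<^bold>+ \<^bold>1. \<^bold>\<exists>m\<^bold><a \<^bold>+ \<^bold>1. \<^bold>\<exists>n\<^bold><a \<^bold>+ \<^bold>1.
     a \<^bold>= \<^bold>\<langle>k, \<^bold>\<langle>m, n\<^bold>\<rangle>\<^bold>\<rangle> \<^bold>\<and> i \<^bold>< k \<^bold>\<and> (\<^bold>\<exists>q\<^bold><n \<^bold>+ \<^bold>1. n \<^bold>= (m \<^bold>* (i \<^bold>+ \<^bold>1) \<^bold>+ \<^bold>1) \<^bold>* q))"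

text \<open>
  Numbers not of the form \<open>\<langle>k, \<langle>m, n\<rangle>\<rangle>\<close> have no elements and are excluded here, since
  0 codes the empty set; elements of \<open>a\<close> and of \<open>b < a\<close> are below \<open>a\<close>.
\<close>

definition finset_code :: "nterm \<Rightarrow> form" where
  "finset_code a = (\<^bold>\<forall>b\<^bold><a. \<^bold>\<exists>i\<^bold><a. \<^bold>\<not> (i \<^bold>\<epsilon> a \<^bold>\<longleftrightarrow> i \<^bold>\<epsilon> b))"

text \<open>A finite sequence of length \<open>n\<close> is a finite function with domain \<open>{i. i < n}\<close>.\<close>

definition seq :: "nterm \<Rightarrow> nterm \<Rightarrow> form" where
  "seq s n = (finset_code s
     \<^bold>\<and> (\<^bold>\<forall>p. p \<^bold>\<epsilon> s \<^bold>\<longrightarrow> (\<^bold>\<exists>i x. i \<^bold>< n \<^bold>\<and> p \<^bold>= \<^bold>\<langle>i, x\<^bold>\<rangle>))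
     \<^bold>\<and> (\<^bold>\<forall>i\<^bold><n. \<^bold>\<exists>!x. \<^bold>\<langle>i, x\<^bold>\<rangle> \<^bold>\<epsilon> s))"

definition total_fun :: "sterm \<Rightarrow> form" where
  "total_fun F =
     ((\<^bold>\<forall>p. p \<^bold>\<in> F \<^bold>\<longrightarrow> (\<^bold>\<exists>n x. p \<^bold>= \<^bold>\<langle>n, x\<^bold>\<rangle>)) \<^bold>\<and> (\<^bold>\<forall>n. \<^bold>\<exists>!x. \<^bold>\<langle>n, x\<^bold>\<rangle> \<^bold>\<in> F))"


section \<open>The principles as sentences\<close>

definition infinite_set :: "sterm \<Rightarrow> form" where
  "infinite_set H = (\<^bold>\<forall>m. \<^bold>\<exists>n. m \<^bold>< n \<^bold>\<and> n \<^bold>\<in> H)"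

text \<open>
  A three-element set is represented by its elements in increasing order, and the colouring
  by the graph of a function into \<open>{0, 1}\<close>.
\<close>

definition colouring3 :: "sterm \<Rightarrow> form" where
  "colouring3 C =
     ((\<^bold>\<forall>p. p \<^bold>\<in> C \<^bold>\<longrightarrow> (\<^bold>\<exists>i j k c. i \<^bold>< j \<^bold>\<and> j \<^bold>< k \<^bold>\<and> c \<^bold>< \<^bold>1 \<^bold>+ \<^bold>1 \<^bold>\<and> p \<^bold>= \<^bold>\<langle>\<^bold>\<langle>\<^bold>\<langle>i, j\<^bold>\<rangle>, k\<^bold>\<rangle>, c\<^bold>\<rangle>))
      \<^bold>\<and> (\<^bold>\<forall>i j k. i \<^bold>< j \<^bold>\<and> j \<^bold>< k \<^bold>\<longrightarrow> (\<^bold>\<exists>!c. \<^bold>\<langle>\<^bold>\<langle>\<^bold>\<langle>i, j\<^bold>\<rangle>, k\<^bold>\<rangle>, c\<^bold>\<rangle> \<^bold>\<in> C)))"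

definition monochromatic3 :: "sterm \<Rightarrow> sterm \<Rightarrow> form" where
  "monochromatic3 C H =
     (\<^bold>\<exists>c. \<^bold>\<forall>i j k. i \<^bold>\<in> H \<^bold>\<and> j \<^bold>\<in> H \<^bold>\<and> k \<^bold>\<in> H \<^bold>\<and> i \<^bold>< j \<^bold>\<and> j \<^bold>< k \<^bold>\<longrightarrow> \<^bold>\<langle>\<^bold>\<langle>\<^bold>\<langle>i, j\<^bold>\<rangle>, k\<^bold>\<rangle>, c\<^bold>\<rangle> \<^bold>\<in> C)"

definition RT32 :: form where
  "RT32 = (\<^bold>\<forall>\<^sub>SC. colouring3 C \<^bold>\<longrightarrow> (\<^bold>\<exists>\<^sub>SH. infinite_set H \<^bold>\<and> monochromatic3 C H))"

text \<open>
  A linear order is a set of pairs \<open>X\<close>, with \<open>x\<close> below or equal to \<open>y\<close> if \<open>\<langle>x, y\<rangle> \<in> X\<close>.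
  It is reflexive, so \<open>x\<close> belongs to the order if and only if \<open>\<langle>x, x\<rangle> \<in> X\<close>.
\<close>

definition linear_order :: "sterm \<Rightarrow> form" where
  "linear_order X =
     ((\<^bold>\<forall>p. p \<^bold>\<in> X \<^bold>\<longrightarrow> (\<^bold>\<exists>x y. p \<^bold>= \<^bold>\<langle>x, y\<^bold>\<rangle>))
      \<^bold>\<and> (\<^bold>\<forall>x y. \<^bold>\<langle>x, y\<^bold>\<rangle> \<^bold>\<in> X \<^bold>\<longrightarrow> \<^bold>\<langle>x, x\<^bold>\<rangle> \<^bold>\<in> X \<^bold>\<and> \<^bold>\<langle>y, y\<^bold>\<rangle> \<^bold>\<in> X)
      \<^bold>\<and> (\<^bold>\<forall>x y z. \<^bold>\<langle>x, y\<^bold>\<rangle> \<^bold>\<in> X \<^bold>\<and> \<^bold>\<langle>y, z\<^bold>\<rangle> \<^bold>\<in> X \<^bold>\<longrightarrow> \<^bold>\<langle>x, z\<^bold>\<rangle> \<^bold>\<in> X)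
      \<^bold>\<and> (\<^bold>\<forall>x y. \<^bold>\<langle>x, y\<^bold>\<rangle> \<^bold>\<in> X \<^bold>\<and> \<^bold>\<langle>y, x\<^bold>\<rangle> \<^bold>\<in> X \<^bold>\<longrightarrow> x \<^bold>= y)
      \<^bold>\<and> (\<^bold>\<forall>x y. \<^bold>\<langle>x, x\<^bold>\<rangle> \<^bold>\<in> X \<^bold>\<and> \<^bold>\<langle>y, y\<^bold>\<rangle> \<^bold>\<in> X \<^bold>\<longrightarrow> \<^bold>\<langle>x, y\<^bold>\<rangle> \<^bold>\<in> X \<^bold>\<or> \<^bold>\<langle>y, x\<^bold>\<rangle> \<^bold>\<in> X))"

definition strict :: "sterm \<Rightarrow> nterm \<Rightarrow> nterm \<Rightarrow> form" where
  "strict X x y = (\<^bold>\<langle>x, y\<^bold>\<rangle> \<^bold>\<in> X \<^bold>\<and> \<^bold>\<not> (x \<^bold>= y))"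

definition omega_pow :: "sterm \<Rightarrow> nterm \<Rightarrow> form" where
  "omega_pow X s = (\<^bold>\<exists>n. seq s n
     \<^bold>\<and> (\<^bold>\<forall>i x. \<^bold>\<langle>i, x\<^bold>\<rangle> \<^bold>\<epsilon> s \<^bold>\<longrightarrow> \<^bold>\<langle>x, x\<^bold>\<rangle> \<^bold>\<in> X)
     \<^bold>\<and> (\<^bold>\<forall>i x y. \<^bold>\<langle>i, x\<^bold>\<rangle> \<^bold>\<epsilon> s \<^bold>\<and> \<^bold>\<langle>i \<^bold>+ \<^bold>1, y\<^bold>\<rangle> \<^bold>\<epsilon> s \<^bold>\<longrightarrow> \<^bold>\<langle>y, x\<^bold>\<rangle> \<^bold>\<in> X))"

definition lex_less :: "sterm \<Rightarrow> nterm \<Rightarrow> nterm \<Rightarrow> form" where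
  "lex_less X s t = (\<^bold>\<exists>m n. seq s m \<^bold>\<and> seq t n
     \<^bold>\<and> (m \<^bold>< n \<^bold>\<and> (\<^bold>\<forall>i\<^bold><m. \<^bold>\<forall>x. \<^bold>\<langle>i, x\<^bold>\<rangle> \<^bold>\<epsilon> s \<^bold>\<longleftrightarrow> \<^bold>\<langle>i, x\<^bold>\<rangle> \<^bold>\<epsilon> t)
        \<^bold>\<or> (\<^bold>\<exists>j. j \<^bold>< m \<^bold>\<and> j \<^bold>< n
             \<^bold>\<and> (\<^bold>\<forall>i\<^bold><j. \<^bold>\<forall>x. \<^bold>\<langle>i, x\<^bold>\<rangle> \<^bold>\<epsilon> s \<^bold>\<longleftrightarrow> \<^bold>\<langle>i, x\<^bold>\<rangle> \<^bold>\<epsilon> t)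
             \<^bold>\<and> (\<^bold>\<exists>x y. \<^bold>\<langle>j, x\<^bold>\<rangle> \<^bold>\<epsilon> s \<^bold>\<and> \<^bold>\<langle>j, y\<^bold>\<rangle> \<^bold>\<epsilon> t \<^bold>\<and> strict X x y))))"

definition omega_pow_less :: "sterm \<Rightarrow> nterm \<Rightarrow> nterm \<Rightarrow> form" where
  "omega_pow_less X s t = (omega_pow X s \<^bold>\<and> omega_pow X t \<^bold>\<and> lex_less X s t)"

definition WO :: "(nterm \<Rightarrow> nterm \<Rightarrow> form) \<Rightarrow> form" where
  "WO lt = (\<^bold>\<not> (\<^bold>\<exists>\<^sub>SF. total_fun F
     \<^bold>\<and> (\<^bold>\<forall>n x y. \<^bold>\<langle>n, x\<^bold>\<rangle> \<^bold>\<in> F \<^bold>\<and> \<^bold>\<langle>n \<^bold>+ \<^bold>1, y\<^bold>\<rangle> \<^bold>\<in> F \<^bold>\<longrightarrow> lt y x)))"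

definition WOP_omega :: form where
  "WOP_omega = (\<^bold>\<forall>\<^sub>SX. linear_order X \<^bold>\<longrightarrow> (WO (strict X) \<^bold>\<longrightarrow> WO (omega_pow_less X)))"


section \<open>Turing functionals and Weihrauch reducibility\<close>

text \<open>
  Turing functionals are presented as Kleene's \<open>\<mu>\<close>-recursive functionals: programs for partial
  recursive functions that may query an oracle.
\<close>

datatype prog =
    Const0
  | Succ
  | Proj nat
  | Oracle
  | Comp prog "prog list"
  | PrimRec prog prog
  | Mu prog

inductive evaluates :: "nat set \<Rightarrow> prog \<Rightarrow> nat list \<Rightarrow> nat \<Rightarrow> bool" for X :: "nat set" where
  "evaluates X Const0 xs 0"
| "evaluates X Succ [x] (Suc x)"
| "i < length xs \<Longrightarrow> evaluates X (Proj i) xs (xs ! i)"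
| "evaluates X Oracle [x] (of_bool (x \<in> X))"
| "list_all2 (\<lambda>g y. evaluates X g xs y) gs ys \<Longrightarrow> evaluates X f ys z \<Longrightarrow> evaluates X (Comp f gs) xs z"
| "evaluates X f xs y \<Longrightarrow> evaluates X (PrimRec f g) (0 # xs) y"
| "evaluates X (PrimRec f g) (n # xs) r \<Longrightarrow> evaluates X g (n # r # xs) y
     \<Longrightarrow> evaluates X (PrimRec f g) (Suc n # xs) y"
| "evaluates X f (n # xs) 0 \<Longrightarrow> (\<forall>m<n. \<exists>y>0. evaluates X f (m # xs) y) \<Longrightarrow> evaluates X (Mu f) xs n"

text \<open>\<open>computes \<Phi> X Y\<close>: the functional \<open>\<Phi>\<close> maps \<open>X\<close> to \<open>Y\<close>.\<close>

definition computes :: "prog \<Rightarrow> nat set \<Rightarrow> nat set \<Rightarrow> bool" where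
  "computes \<Phi> X Y \<longleftrightarrow> (\<forall>n. evaluates X \<Phi> [n] (of_bool (n \<in> Y)))"

definition join :: "nat set \<Rightarrow> nat set \<Rightarrow> nat set" (infixl \<open>\<oplus>\<close> 65) where
  "X \<oplus> Y = (\<lambda>n. 2 * n) ` X \<union> (\<lambda>n. 2 * n + 1) ` Y"

datatype problem = Problem (instances: "nat set set") (solutions: "nat set \<Rightarrow> nat set set")

definition weihrauch_reducible :: "problem \<Rightarrow> problem \<Rightarrow> bool" (infix \<open>\<le>\<^sub>W\<close> 50) where
  "Q \<le>\<^sub>W P \<longleftrightarrow> (\<exists>\<Phi> \<Psi>. \<forall>X\<in>instances Q. \<exists>Y. computes \<Phi> X Y \<and> Y \<in> instances P \<and>
     (\<forall>Y'\<in>solutions P Y. \<exists>Z. computes \<Psi> (X \<oplus> Y') Z \<and> Z \<in> solutions Q X))"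


section \<open>The principles as problems\<close>

definition graph_code :: "(nat \<Rightarrow> nat) \<Rightarrow> nat set" where
  "graph_code f = {prod_encode (n, f n) | n. True}"

definition colouring_code :: "(nat set \<Rightarrow> nat) \<Rightarrow> nat set" where
  "colouring_code c = {prod_encode (set_encode A, c A) | A. A \<in> [UNIV]\<^bsup>3\<^esup>}"

definition RT32_problem :: problem where
  "RT32_problem = Problem
     {colouring_code c | c. c \<in> [UNIV]\<^bsup>3\<^esup> \<rightarrow> {0, 1}}
     (\<lambda>C. {H. infinite H \<and> (\<exists>c. c \<in> [UNIV]\<^bsup>3\<^esup> \<rightarrow> {0, 1} \<and> C = colouring_code c \<and>
                               (\<exists>b. \<forall>A\<in>[H]\<^bsup>3\<^esup>. c A = b))})"

text \<open>Linear orders are reflexive relations on a set of natural numbers, their field.\<close>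

definition omega_power :: "nat rel \<Rightarrow> nat list set" where
  "omega_power r = {xs. set xs \<subseteq> Field r \<and> sorted_wrt (\<lambda>x y. (y, x) \<in> r) xs}"

definition descending_in_omega_power :: "nat rel \<Rightarrow> (nat \<Rightarrow> nat list) \<Rightarrow> bool" where
  "descending_in_omega_power r s \<longleftrightarrow>
     (\<forall>n. s n \<in> omega_power r) \<and> (\<forall>n. (s (Suc n), s n) \<in> lexord (r - Id))"

definition descending_in :: "nat rel \<Rightarrow> (nat \<Rightarrow> nat) \<Rightarrow> bool" where
  "descending_in r x \<longleftrightarrow> (\<forall>n. (x (Suc n), x n) \<in> r - Id)"

definition WOP_instance_code :: "nat rel \<Rightarrow> (nat \<Rightarrow> nat list) \<Rightarrow> nat set" where
  "WOP_instance_code r s = prod_encode ` r \<oplus> graph_code (\<lambda>n. list_encode (s n))"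

definition WOP_omega_problem :: problem where
  "WOP_omega_problem = Problem
     {WOP_instance_code r s | r s. Linear_order r \<and> descending_in_omega_power r s}
     (\<lambda>I. {graph_code x | x. \<exists>r s. Linear_order r \<and> descending_in_omega_power r s \<and>
                                  I = WOP_instance_code r s \<and> descending_in r x})"

end

theory Submission
  imports Defs "HOL-Library.Countable"
begin

text \<open>
  Let \<open>s\<^sub>0 > s\<^sub>1 > \<dots>\<close> be descending in \<open>\<omega>\<^sup>X\<close>.  For \<open>i < j\<close> let \<open>d(i, j)\<close> be the first position where
  \<open>s\<^sub>i\<close> and \<open>s\<^sub>j\<close> differ and \<open>x(i, j)\<close> the entry of \<open>s\<^sub>i\<close> at that position.  Colour \<open>i < j < k\<close> by
  whether \<open>d(i, j) \<le> d(j, k)\<close>.  If this fails on a homogeneous set, then \<open>d\<close> descends forever in the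
  natural numbers.  If it holds on \<open>H = {h\<^sub>0 < h\<^sub>1 < \<dots>}\<close>, then
  \<open>x(j, k) = s\<^sub>j(d(j, k)) \<le> s\<^sub>j(d(i, j)) < s\<^sub>i(d(i, j)) = x(i, j)\<close> because the strings are nonincreasing, so
  \<open>x(h\<^sub>0, h\<^sub>1) > x(h\<^sub>1, h\<^sub>2) > \<dots>\<close> is a descending sequence in \<open>X\<close>.

  Provability is obtained from this argument by the completeness theorem: it is carried out in an
  arbitrary model of \<open>RCA\<^sub>0\<close>, with \<open>\<Sigma>\<^sup>0\<^sub>1\<close> induction, \<open>\<Delta>\<^sup>0\<^sub>1\<close> comprehension, and the coding of
  finite sets by divisors, which is needed to enumerate \<open>H\<close>.
\<close>

section \<open>Substitution\<close>

text \<open>In a model the numbers may be nonstandard and the sets few, so every induction must be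
  on a Sigma01 predicate and every set formed must be Delta01. That positions cannot drop forever
  becomes the least number principle for Sigma01 predicates, applied to the positions
  \<open>d(i, j)\<close> with \<open>i < j\<close> in \<open>H\<close>. The colouring is Delta01
  because \<open>d\<close> is total and single-valued on pairs \<open>i < j\<close>, so the
  complement of its graph is Sigma01 too. The descending sequence comes from iterating the successor
  function of \<open>H\<close>; iteration rests on coded finite sets of pairs, which is where
  divisibility enters. To discharge the complexity conditions by introduction rules, predicates are
  kept as HOL functions of an environment and are turned into formulas by \<open>D0_formula\<close>.
  The reduction repeats the argument over the standard numbers. The obstacle there is that an
  unbounded search halts only for suitable oracles, so computability is always relative to a domain
  \<open>D\<close> of oracles.\<close>

lemma subst_tm_Var [simp]: "subst_tm Var t = t"
  by (induction t) auto

lemma subst_tm_subst_tm: "subst_tm \<sigma> (subst_tm \<tau> t) = subst_tm (\<lambda>i. subst_tm \<sigma> (\<tau> i)) t"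
  by (induction t) auto

abbreviation up :: "(nat \<Rightarrow> tm) \<Rightarrow> nat \<Rightarrow> tm" where
  "up \<sigma> \<equiv> case_nat (Var 0) (\<lambda>i. lift_tm (\<sigma> i))"

abbreviation upS :: "(nat \<Rightarrow> nat) \<Rightarrow> nat \<Rightarrow> nat" where
  "upS \<rho> \<equiv> case_nat 0 (\<lambda>i. Suc (\<rho> i))"

lemma up_Var [simp]: "up Var = Var"
  by (rule ext) (simp add: lift_tm_def split: nat.split)

lemma upS_id [simp]: "upS (\<lambda>i. i) = (\<lambda>i. i)"
  by (rule ext) (simp split: nat.split)

lemma up_comp: "(\<lambda>i. subst_tm (up \<sigma>) (up \<tau> i)) = up (\<lambda>i. subst_tm \<sigma> (\<tau> i))"
  by (rule ext) (simp add: lift_tm_def subst_tm_subst_tm split: nat.split)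

lemma upS_comp: "(\<lambda>i. upS \<rho> (upS \<pi> i)) = upS (\<lambda>i. \<rho> (\<pi> i))"
  by (rule ext) (simp split: nat.split)

lemma subst_Var [simp]: "subst Var (\<lambda>i. i) A = A"
  by (induction A) auto

lemma subst_subst:
  "subst \<sigma> \<rho> (subst \<tau> \<pi> A) = subst (\<lambda>i. subst_tm \<sigma> (\<tau> i)) (\<lambda>i. \<rho> (\<pi> i)) A"
  by (induction A arbitrary: \<sigma> \<rho> \<tau> \<pi>) (auto simp: subst_tm_subst_tm up_comp upS_comp)

lemma subst_cong:
  "(\<And>i. \<sigma> i = \<sigma>' i) \<Longrightarrow> (\<And>i. \<rho> i = \<rho>' i) \<Longrightarrow> subst \<sigma> \<rho> A = subst \<sigma>' \<rho>' A"
  by presburger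

lemma subst_lift: "subst (up \<sigma>) \<rho> (lift A) = lift (subst \<sigma> \<rho> A)"
  by (simp add: lift_def subst_subst lift_tm_def)

lemma subst_liftS: "subst \<sigma> (upS \<rho>) (liftS A) = liftS (subst \<sigma> \<rho> A)"
  by (simp add: liftS_def subst_subst)

lemma subst_inst: "subst \<sigma> \<rho> (inst t A) = inst (subst_tm \<sigma> t) (subst (up \<sigma>) \<rho> A)"
  unfolding inst_def subst_subst
  by (rule subst_cong) (auto simp: lift_tm_def subst_tm_subst_tm split: nat.split)

lemma subst_instS: "subst \<sigma> \<rho> (instS X A) = instS (\<rho> X) (subst \<sigma> (upS \<rho>) A)"
  unfolding instS_def subst_subst by (rule subst_cong) (auto split: nat.split)

text \<open>Says that all variables of \<open>t\<close> have index below \<open>k\<close>, expressed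
  through the effect of substitutions. This is the form in which freshness is used later.\<close>

definition supported_tm :: "nat \<Rightarrow> tm \<Rightarrow> bool" where
  "supported_tm k t \<longleftrightarrow> (\<forall>\<sigma> \<sigma>'. (\<forall>i<k. \<sigma> i = \<sigma>' i) \<longrightarrow> subst_tm \<sigma> t = subst_tm \<sigma>' t)"

lemma supported_tm_mono: "supported_tm k t \<Longrightarrow> k \<le> k' \<Longrightarrow> supported_tm k' t"
  unfolding supported_tm_def by (meson order.strict_trans2)

lemma ex_supported_tm: "\<exists>k. supported_tm k t"
proof (induction t)
  case (Var i) show ?case by (rule exI[of _ "Suc i"]) (auto simp: supported_tm_def)
next
  case (Add s t)
  then obtain k k' where "supported_tm k s" "supported_tm k' t" by blast
  then have "supported_tm (max k k') s" "supported_tm (max k k') t" by (auto elim: supported_tm_mono)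
  then have "supported_tm (max k k') (Add s t)" unfolding supported_tm_def subst_tm.simps by metis
  then show ?case ..
next
  case (Mul s t)
  then obtain k k' where "supported_tm k s" "supported_tm k' t" by blast
  then have "supported_tm (max k k') s" "supported_tm (max k k') t" by (auto elim: supported_tm_mono)
  then have "supported_tm (max k k') (Mul s t)" unfolding supported_tm_def subst_tm.simps by metis
  then show ?case ..
qed (auto simp: supported_tm_def)

definition supported :: "nat \<Rightarrow> fm \<Rightarrow> bool" where
  "supported k A \<longleftrightarrow> (\<forall>\<sigma> \<sigma>' \<rho> \<rho>'. (\<forall>i<k. \<sigma> i = \<sigma>' i \<and> \<rho> i = \<rho>' i) \<longrightarrow> subst \<sigma> \<rho> A = subst \<sigma>' \<rho>' A)"

lemma supportedD:
  "supported k A \<Longrightarrow> (\<And>i. i < k \<Longrightarrow> \<sigma> i = \<sigma>' i) \<Longrightarrow> (\<And>i. i < k \<Longrightarrow> \<rho> i = \<rho>' i) \<Longrightarrow> subst \<sigma> \<rho> A = subst \<sigma>' \<rho>' A"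
  unfolding supported_def by blast

lemma supported_mono: "supported k A \<Longrightarrow> k \<le> k' \<Longrightarrow> supported k' A"
  unfolding supported_def by (meson order.strict_trans2)

lemma ex_supported: "\<exists>k. supported k A"
proof (induction A)
  case (Eq s t)
  obtain k k' where "supported_tm k s" "supported_tm k' t" using ex_supported_tm by blast
  then have "supported_tm (max k k') s" "supported_tm (max k k') t" by (auto elim: supported_tm_mono)
  then have "supported (max k k') (Eq s t)" unfolding supported_def supported_tm_def subst.simps by metis
  then show ?case ..
next
  case (Less s t)
  obtain k k' where "supported_tm k s" "supported_tm k' t" using ex_supported_tm by blast
  then have "supported_tm (max k k') s" "supported_tm (max k k') t" by (auto elim: supported_tm_mono)
  then have "supported (max k k') (Less s t)" unfolding supported_def supported_tm_def subst.simps by metis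
  then show ?case ..
next
  case (Mem t X)
  obtain k where "supported_tm k t" using ex_supported_tm by blast
  then have "supported_tm (max k (Suc X)) t" by (auto elim: supported_tm_mono)
  then have "supported (max k (Suc X)) (Mem t X)"
    unfolding supported_def supported_tm_def subst.simps by (metis lessI max.strict_coboundedI2)
  then show ?case ..
next
  case Fls then show ?case by (simp add: supported_def)
next
  case (Imp A B)
  then obtain k k' where "supported k A" "supported k' B" by blast
  then have "supported (max k k') A" "supported (max k k') B" by (auto elim: supported_mono)
  then show ?case unfolding supported_def by (metis subst.simps(5))
next
  case (All A)
  then obtain k where k: "supported k A" by blast
  have "supported k (All A)" unfolding supported_def
    by (auto intro!: supportedD[OF k] split: nat.split)
  then show ?case ..
next
  case (AllS A)
  then obtain k where k: "supported k A" by blast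
  have "supported k (AllS A)" unfolding supported_def
    by (auto intro!: supportedD[OF k] split: nat.split)
  then show ?case ..
qed

lemma ex_supported_finite:
  assumes "finite G" shows "\<exists>k. \<forall>A\<in>G. supported k A"
  using assms
proof induction
  case (insert A G)
  then obtain k k' where "supported k A" "\<forall>A\<in>G. supported k' A" using ex_supported by blast
  then have "\<forall>B\<in>insert A G. supported (max k k') B" using supported_mono[of k A "max k k'"] supported_mono[of k' _ "max k k'"] by auto
  then show ?case ..
qed simp


section \<open>Admissible rules\<close>

lemma weaken: "T ; G \<turnstile> A \<Longrightarrow> G \<subseteq> G' \<Longrightarrow> T ; G' \<turnstile> A"
proof (induction arbitrary: G' rule: derivable.induct)
  case (ImpI A G B)
  show ?case by (rule derivable.ImpI, rule ImpI.IH) (use ImpI.prems in auto)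
next
  case (Contra A G)
  show ?case by (rule derivable.Contra, rule Contra.IH) (use Contra.prems in auto)
next
  case (AllI G A)
  show ?case by (rule derivable.AllI, rule AllI.IH) (use AllI.prems in auto)
next
  case (AllSI G A)
  show ?case by (rule derivable.AllSI, rule AllSI.IH) (use AllSI.prems in auto)
next
  case (ImpE G A B)
  then show ?case by (metis derivable.ImpE)
next
  case (EqE G s t A)
  then show ?case by (metis derivable.EqE)
qed (auto intro: derivable.Axiom derivable.Hyp derivable.EqI derivable.AllE derivable.AllSE)

lemma cut: "T ; insert A G \<turnstile> B \<Longrightarrow> T ; G \<turnstile> A \<Longrightarrow> T ; G \<turnstile> B"
  by (blast intro: ImpI ImpE)

lemma ex_falso: "T ; G \<turnstile> Fls \<Longrightarrow> T ; G \<turnstile> A"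
  by (rule Contra) (rule weaken, auto)

text \<open>
  Simultaneous substitution into an axiom is obtained by instantiating the variables
  \<open>0, \<dots>, k - 1\<close> one after the other; the terms to come are lifted to compensate for the shift.
\<close>

lemma axiom_subst:
  assumes "A \<in> T" shows "T ; G \<turnstile> subst \<sigma> \<rho> A"
proof -
  have 1: "T ; G \<turnstile> subst (\<lambda>i. if i < k then \<sigma> i else Var (i - k)) (\<lambda>i. i) A" for k \<sigma> G
  proof (induction k arbitrary: \<sigma> G)
    case 0
    with assms show ?case by (simp add: Axiom)
  next
    case (Suc k)
    have "T ; G \<turnstile> inst (\<sigma> k) (subst (\<lambda>i. if i < k then lift_tm (\<sigma> i) else Var (i - k)) (\<lambda>i. i) A)"
      by (intro AllE AllI Suc)
    moreover have "(\<lambda>i. subst_tm (case_nat (\<sigma> k) Var) (if i < k then lift_tm (\<sigma> i) else Var (i - k)))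
        = (\<lambda>i. if i < Suc k then \<sigma> i else Var (i - Suc k))"
      by (rule ext) (auto simp: lift_tm_def subst_tm_subst_tm less_Suc_eq not_less split: nat.split)
    ultimately show ?case by (simp add: inst_def subst_subst)
  qed
  have 2: "T ; G \<turnstile> subst \<sigma> (\<lambda>i. if i < k then \<rho> i else i - k) A" if k': "supported k' A" for k k' \<rho> G
  proof (induction k arbitrary: \<rho> G)
    case 0
    \<comment> \<open>All free variables of \<open>A\<close> lie below \<open>k'\<close>, so
      truncating the substitution at \<open>k'\<close> does not change the result.\<close>
    have "subst \<sigma> (\<lambda>i. i) A = subst (\<lambda>i. if i < k' then \<sigma> i else Var (i - k')) (\<lambda>i. i) A"
      by (rule supportedD[OF k']) auto
    with 1 show ?case by simp
  next
    case (Suc k)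
    have "T ; G \<turnstile> instS (\<rho> k) (subst \<sigma> (\<lambda>i. if i < k then Suc (\<rho> i) else i - k) A)"
      by (intro AllSE AllSI Suc)
    moreover have "(\<lambda>i. case_nat (\<rho> k) (\<lambda>i. i) (if i < k then Suc (\<rho> i) else i - k))
        = (\<lambda>i. if i < Suc k then \<rho> i else i - Suc k)"
      by (rule ext) (auto simp: less_Suc_eq not_less split: nat.split)
    ultimately show ?case by (simp add: instS_def subst_subst)
  qed
  obtain k where k: "supported k A" using ex_supported by blast
  have "subst \<sigma> \<rho> A = subst \<sigma> (\<lambda>i. if i < k then \<rho> i else i - k) A"
    by (rule supportedD[OF k]) auto
  with 2[OF k] show ?thesis by simp
qed

text \<open>The case that is not structural is \<open>Axiom\<close>: \<open>T\<close> need not be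
  closed under substitution, and \<open>axiom_subst\<close> makes up for it.\<close>

lemma derivable_subst: "T ; G \<turnstile> A \<Longrightarrow> T ; subst \<sigma> \<rho> ` G \<turnstile> subst \<sigma> \<rho> A"
proof (induction arbitrary: \<sigma> \<rho> rule: derivable.induct)
  case (Axiom A G) then show ?case by (rule axiom_subst)
next
  case (Hyp A G) then show ?case by (blast intro: derivable.Hyp)
next
  case (ImpI A G B) then show ?case by (simp add: derivable.ImpI)
next
  case (ImpE G A B) then show ?case by (metis derivable.ImpE subst.simps(5))
next
  case (Contra A G) show ?case by (rule derivable.Contra) (use Contra.IH in simp)
next
  case (AllI G A)
  have "T ; lift ` subst \<sigma> \<rho> ` G \<turnstile> subst (up \<sigma>) \<rho> A"
    using AllI.IH[of "up \<sigma>" \<rho>] by (simp add: image_image subst_lift)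
  then show ?case by (simp add: derivable.AllI)
next
  case (AllE G A t)
  then show ?case by (simp add: subst_inst) (metis derivable.AllE subst.simps(6))
next
  case (AllSI G A)
  have "T ; liftS ` subst \<sigma> \<rho> ` G \<turnstile> subst \<sigma> (upS \<rho>) A"
    using AllSI.IH[of \<sigma> "upS \<rho>"] by (simp add: image_image subst_liftS)
  then show ?case by (simp add: derivable.AllSI)
next
  case (AllSE G A X)
  then show ?case by (simp add: subst_instS) (metis derivable.AllSE subst.simps(7))
next
  case (EqI G t) then show ?case by (simp add: derivable.EqI)
next
  case (EqE G s t A)
  then show ?case by (simp add: subst_inst) (metis derivable.EqE)
qed

text \<open>Generalization over a fresh variable \<open>k\<close>, in place of the de Bruijn rule
  \<open>AllI\<close>. Renaming \<open>k\<close> to 0 and shifting all other variables up turns the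
  instance back into \<open>B\<close> and each hypothesis into its lift, which is the premise of
  \<open>AllI\<close>.\<close>

lemma generalize:
  assumes "T ; G \<turnstile> inst (Var k) B" and k: "\<forall>A\<in>insert B G. supported k A"
  shows "T ; G \<turnstile> All B"
proof -
  let ?\<sigma> = "\<lambda>i. if i = k then Var 0 else Var (Suc i)"
  have "subst ?\<sigma> (\<lambda>i. i) A = lift A" if "A \<in> G" for A
    unfolding lift_def using k that by (intro supportedD[of k]) auto
  then have "subst ?\<sigma> (\<lambda>i. i) ` G = lift ` G" by (rule image_cong[OF refl])
  moreover have "subst ?\<sigma> (\<lambda>i. i) (inst (Var k) B) = subst Var (\<lambda>i. i) B"
    unfolding inst_def subst_subst using k by (intro supportedD[of k]) (auto split: nat.split)
  ultimately show ?thesis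
    using derivable_subst[OF assms(1), of ?\<sigma> "\<lambda>i. i"] by (auto intro: AllI)
qed

lemma generalizeS:
  assumes "T ; G \<turnstile> instS k B" and k: "\<forall>A\<in>insert B G. supported k A"
  shows "T ; G \<turnstile> AllS B"
proof -
  let ?\<rho> = "\<lambda>i. if i = k then 0 else Suc i"
  have "subst Var ?\<rho> A = liftS A" if "A \<in> G" for A
    unfolding liftS_def using k that by (intro supportedD[of k]) auto
  then have "subst Var ?\<rho> ` G = liftS ` G" by (rule image_cong[OF refl])
  moreover have "subst Var ?\<rho> (instS k B) = subst Var (\<lambda>i. i) B"
    unfolding instS_def subst_subst using k by (intro supportedD[of k]) (auto split: nat.split)
  ultimately show ?thesis
    using derivable_subst[OF assms(1), of Var ?\<rho>] by (auto intro: AllSI)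
qed


section \<open>Henkin theories\<close>

instance tm :: countable by countable_datatype
instance fm :: countable by countable_datatype

text \<open>Deductively closed, consistent, complete, and with a counterexample for every universal
  formula that fails. Closure is asked for finite sets of hypotheses, so no compactness of
  derivability has to be shown.\<close>

definition henkin :: "fm set \<Rightarrow> fm set \<Rightarrow> bool" where
  "henkin T \<Gamma> \<longleftrightarrow>
     (\<forall>G A. finite G \<longrightarrow> G \<subseteq> \<Gamma> \<longrightarrow> T ; G \<turnstile> A \<longrightarrow> A \<in> \<Gamma>) \<and> Fls \<notin> \<Gamma> \<and> (\<forall>A. A \<in> \<Gamma> \<or> Neg A \<in> \<Gamma>) \<and>
     (\<forall>A. All A \<notin> \<Gamma> \<longrightarrow> (\<exists>t. inst t A \<notin> \<Gamma>)) \<and> (\<forall>A. AllS A \<notin> \<Gamma> \<longrightarrow> (\<exists>X. instS X A \<notin> \<Gamma>))"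

text \<open>Lindenbaum construction along an enumeration of all formulas. Every stage is finite, so
  some variable is still fresh and can serve as the Henkin witness; the language needs no new
  constants.\<close>

lemma henkin_extension:
  assumes "finite G" "\<not> T ; G \<turnstile> Fls"
  shows "\<exists>\<Gamma>. G \<subseteq> \<Gamma> \<and> henkin T \<Gamma>"
proof -
  define good where "good A G G' \<longleftrightarrow> G \<subseteq> G' \<and> finite G' \<and> \<not> T ; G' \<turnstile> Fls \<and>
     (A \<in> G' \<or> Neg A \<in> G' \<and> (\<forall>B. A = All B \<longrightarrow> (\<exists>t. Neg (inst t B) \<in> G'))
                        \<and> (\<forall>B. A = AllS B \<longrightarrow> (\<exists>X. Neg (instS X B) \<in> G')))" for A G G'
  have step: "\<exists>G'. good A G G'" if G: "finite G" "\<not> T ; G \<turnstile> Fls" for A G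
  proof (cases "T ; insert A G \<turnstile> Fls")
    case False
    with G show ?thesis by (intro exI[of _ "insert A G"]) (auto simp: good_def)
  next
    case True
    let ?G = "insert (Neg A) G"
    have neg: "\<not> T ; ?G \<turnstile> Fls" using True G(2) by (blast intro: ImpI cut)
    consider B where "A = All B" | B where "A = AllS B" | "(\<forall>B. A \<noteq> All B)" "(\<forall>B. A \<noteq> AllS B)" by blast
    then show ?thesis
    proof cases
      case (1 B)
      obtain k where k: "\<forall>C\<in>insert B ?G. supported k C"
        using ex_supported_finite[of "insert B ?G"] G by auto
      \<comment> \<open>Were the counterexample inconsistent with the stage,
        \<open>inst (Var k) B\<close> would be derivable, hence \<open>All B\<close> by freshness of
        \<open>k\<close>, against \<open>Neg A\<close>.\<close>
      have "\<not> T ; insert (Neg (inst (Var k) B)) ?G \<turnstile> Fls"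
        using generalize[OF Contra k] neg \<open>A = All B\<close> by (blast intro: ImpE Hyp)
      with 1 G show ?thesis
        by (intro exI[of _ "insert (Neg (inst (Var k) B)) ?G"]) (auto simp: good_def)
    next
      case (2 B)
      obtain k where k: "\<forall>C\<in>insert B ?G. supported k C"
        using ex_supported_finite[of "insert B ?G"] G by auto
      have "\<not> T ; insert (Neg (instS k B)) ?G \<turnstile> Fls"
        using generalizeS[OF Contra k] neg \<open>A = AllS B\<close> by (blast intro: ImpE Hyp)
      with 2 G show ?thesis
        by (intro exI[of _ "insert (Neg (instS k B)) ?G"]) (auto simp: good_def)
    next
      case 3
      with neg G show ?thesis by (intro exI[of _ ?G]) (auto simp: good_def)
    qed
  qed
  define g where "g = rec_nat G (\<lambda>n G. SOME G'. good (from_nat n) G G')"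
  \<comment> \<open>The choice made in \<open>g\<close> has a witness only at finite consistent
    stages, so this invariant must precede \<open>good\<close>.\<close>
  have fin: "finite (g n) \<and> \<not> T ; g n \<turnstile> Fls" for n
  proof (induction n)
    case (Suc n)
    then have "good (from_nat n) (g n) (g (Suc n))"
      unfolding g_def by simp (rule someI_ex, rule step, auto)
    then show ?case by (simp add: good_def)
  qed (use assms in \<open>simp add: g_def\<close>)
  have good: "good (from_nat n) (g n) (g (Suc n))" for n
    using fin[of n] unfolding g_def by simp (rule someI_ex, rule step, auto)
  have mono: "m \<le> n \<Longrightarrow> g m \<subseteq> g n" for m n
    by (rule lift_Suc_mono_le[of g]) (use good in \<open>auto simp: good_def\<close>)
  define \<Gamma> where "\<Gamma> = (\<Union>n. g n)"
  have bound: "\<exists>n. H \<subseteq> g n" if "finite H" "H \<subseteq> \<Gamma>" for H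
    using that
  proof induction
    case (insert A H)
    then obtain m n where "H \<subseteq> g n" "A \<in> g m" by (auto simp: \<Gamma>_def)
    then have "insert A H \<subseteq> g (max m n)" using mono[of m "max m n"] mono[of n "max m n"] by auto
    then show ?case ..
  qed simp
  have con: "\<not> T ; H \<turnstile> Fls" if "finite H" "H \<subseteq> \<Gamma>" for H
    using bound[OF that] fin weaken by blast
  have excl: False if "A \<in> \<Gamma>" "Neg A \<in> \<Gamma>" for A
    using con[of "{A, Neg A}"] that by (auto intro: ImpE Hyp)
  have dec: "A \<in> \<Gamma> \<or> Neg A \<in> \<Gamma> \<and> (\<forall>B. A = All B \<longrightarrow> (\<exists>t. Neg (inst t B) \<in> \<Gamma>))
      \<and> (\<forall>B. A = AllS B \<longrightarrow> (\<exists>X. Neg (instS X B) \<in> \<Gamma>))" for A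
    using good[of "to_nat A"] unfolding good_def \<Gamma>_def by simp blast
  have "g 0 = G" by (simp add: g_def)
  then have "G \<subseteq> \<Gamma>" unfolding \<Gamma>_def by blast
  moreover have "A \<in> \<Gamma>" if "finite H" "H \<subseteq> \<Gamma>" "T ; H \<turnstile> A" for H A
  proof (rule ccontr)
    assume "A \<notin> \<Gamma>"
    then have "Neg A \<in> \<Gamma>" using dec by blast
    with that con[of "insert (Neg A) H"] show False by (auto intro: ImpE Hyp weaken)
  qed
  moreover have "Fls \<notin> \<Gamma>" using con[of "{Fls}"] by (auto intro: Hyp)
  moreover have "\<exists>t. inst t A \<notin> \<Gamma>" if "All A \<notin> \<Gamma>" for A
    using that dec[of "All A"] excl by blast
  moreover have "\<exists>X. instS X A \<notin> \<Gamma>" if "AllS A \<notin> \<Gamma>" for A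
    using that dec[of "AllS A"] excl by blast
  ultimately have "henkin T \<Gamma>" unfolding henkin_def using dec by (intro conjI) blast+
  with \<open>G \<subseteq> \<Gamma>\<close> show ?thesis by blast
qed

section \<open>Semantics\<close>

text \<open>A model is a type, not a record, so that the algebraic and order classes, with their
  simplification rules, can be established for its number part.\<close>

class second_order_structure = plus + times + zero + one + ord +
  fixes Sets :: "'a set set"

primrec tm_val :: "(nat \<Rightarrow> 'a::second_order_structure) \<Rightarrow> tm \<Rightarrow> 'a" where
  "tm_val e (Var i) = e i"
| "tm_val e Zero = 0"
| "tm_val e One = 1"
| "tm_val e (Add s t) = tm_val e s + tm_val e t"
| "tm_val e (Mul s t) = tm_val e s * tm_val e t"

primrec sat :: "fm \<Rightarrow> (nat \<Rightarrow> 'a::second_order_structure) \<Rightarrow> (nat \<Rightarrow> 'a set) \<Rightarrow> bool" where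
  "sat (Eq s t) e S \<longleftrightarrow> tm_val e s = tm_val e t"
| "sat (Less s t) e S \<longleftrightarrow> tm_val e s < tm_val e t"
| "sat (Mem t X) e S \<longleftrightarrow> tm_val e t \<in> S X"
| "sat Fls e S \<longleftrightarrow> False"
| "sat (Imp A B) e S \<longleftrightarrow> (sat A e S \<longrightarrow> sat B e S)"
| "sat (All A) e S \<longleftrightarrow> (\<forall>x. sat A (case_nat x e) S)"
| "sat (AllS A) e S \<longleftrightarrow> (\<forall>X\<in>Sets. sat A e (case_nat X S))"

lemma tm_val_subst: "tm_val e (subst_tm \<sigma> t) = tm_val (\<lambda>i. tm_val e (\<sigma> i)) t"
  by (induction t) auto

lemma tm_val_up: "(\<lambda>i. tm_val (case_nat x e) (up \<sigma> i)) = case_nat x (\<lambda>i. tm_val e (\<sigma> i))"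
  by (rule ext) (simp add: lift_tm_def tm_val_subst split: nat.split)

lemma case_nat_upS: "(\<lambda>i. case_nat X S (upS \<rho> i)) = case_nat X (\<lambda>i. S (\<rho> i))"
  by (rule ext) (simp split: nat.split)

lemma sat_subst: "sat (subst \<sigma> \<rho> A) e S \<longleftrightarrow> sat A (\<lambda>i. tm_val e (\<sigma> i)) (\<lambda>i. S (\<rho> i))"
  by (induction A arbitrary: \<sigma> \<rho> e S) (auto simp: tm_val_subst tm_val_up case_nat_upS)

lemma sat_lift: "sat (lift A) (case_nat x e) S \<longleftrightarrow> sat A e S"
  by (simp add: lift_def sat_subst)

lemma sat_liftS: "sat (liftS A) e (case_nat X S) \<longleftrightarrow> sat A e S"
  by (simp add: liftS_def sat_subst)

lemma sat_inst: "sat (inst t A) e S \<longleftrightarrow> sat A (case_nat (tm_val e t) e) S"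
proof -
  have "(\<lambda>i. tm_val e (case_nat t Var i)) = case_nat (tm_val e t) e"
    by (rule ext) (simp split: nat.split)
  then show ?thesis by (simp add: inst_def sat_subst)
qed

lemma sat_instS: "sat (instS X A) e S \<longleftrightarrow> sat A e (case_nat (S X) S)"
proof -
  have "(\<lambda>i. S (case_nat X (\<lambda>i. i) i)) = case_nat (S X) S"
    by (rule ext) (simp split: nat.split)
  then show ?thesis by (simp add: instS_def sat_subst)
qed

text \<open>Used for the consistency of \<open>RCA0\<close>, by way of the standard model.\<close>

lemma soundness:
  assumes "T ; G \<turnstile> A"
    and "\<And>A e S. A \<in> T \<Longrightarrow> \<forall>i. S i \<in> Sets \<Longrightarrow> sat A (e :: nat \<Rightarrow> 'a::second_order_structure) S"
    and "\<forall>i. S i \<in> Sets" "\<And>B. B \<in> G \<Longrightarrow> sat B (e :: nat \<Rightarrow> 'a) S"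
  shows "sat A e S"
  using assms(1,3,4)
proof (induction arbitrary: e S rule: derivable.induct)
  case (Contra A G)
  show ?case using Contra.IH[OF Contra.prems(1)] Contra.prems(2) by fastforce
next
  case (AllI G A)
  have "sat A (case_nat x e) S" for x
    by (rule AllI.IH) (use AllI.prems in \<open>auto simp: sat_lift\<close>)
  then show ?case by simp
next
  case (AllSI G A)
  have "sat A e (case_nat X S)" if "X \<in> Sets" for X
    using that AllSI by (intro AllSI.IH) (auto simp: sat_liftS split: nat.splits)
  then show ?case by simp
next
  case (AllSE G A X)
  then show ?case by (auto simp: sat_instS)
qed (auto simp: sat_inst assms(2))

instantiation nat :: second_order_structure
begin
definition Sets_nat :: "nat set set" where "Sets_nat = UNIV"
instance ..
end

text \<open>With all subsets of the numbers as sets, induction and comprehension hold for every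
  formula, so complexity is not inspected.\<close>

lemma RCA0_nat:
  assumes "A \<in> RCA0" shows "sat A (e :: nat \<Rightarrow> nat) S"
proof -
  consider "A \<in> basic_axioms" | B where "A = induction_axiom B" | B C where "A = comprehension_axiom B C"
    using assms unfolding RCA0_def by blast
  then show ?thesis
  proof cases
    case 1
    then show ?thesis by (auto simp: basic_axioms_def)
  next
    case 2
    have *: "(\<lambda>i. tm_val (case_nat x e) (case_nat (Add (Var 0) One) (\<lambda>i. Var (Suc i)) i)) = case_nat (Suc x) e" for x
      by (rule ext) (simp split: nat.split)
    have "sat (induction_axiom B) e S \<longleftrightarrow> sat B (case_nat 0 e) S \<and>
        (\<forall>x. sat B (case_nat x e) S \<longrightarrow> sat B (case_nat (Suc x) e) S) \<longrightarrow> (\<forall>x. sat B (case_nat x e) S)"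
      by (simp add: induction_axiom_def sat_inst sat_subst *)
    moreover have "(sat B (case_nat 0 e) S \<and> (\<forall>x. sat B (case_nat x e) S \<longrightarrow> sat B (case_nat (Suc x) e) S))
        \<longrightarrow> (\<forall>x. sat B (case_nat x e) S)"
      by (intro impI allI) (rule nat.induct, blast+)
    ultimately show ?thesis using 2 by blast
  next
    case 3
    have "\<exists>X. \<forall>x. (x \<in> X \<longrightarrow> sat B (case_nat x e) S) \<and> (sat B (case_nat x e) S \<longrightarrow> x \<in> X)"
      by (rule exI[of _ "{x. sat B (case_nat x e) S}"]) simp
    then have "sat (ExS (All (Iff (Mem (Var 0) 0) (liftS B)))) e S"
      by (simp add: sat_liftS Sets_nat_def)
    with 3 show ?thesis by (simp add: comprehension_axiom_def)
  qed
qed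

lemma RCA0_consistent: "\<not> RCA0 ; {} \<turnstile> Fls"
  using soundness[of RCA0 "{}" Fls "\<lambda>_. {}" "\<lambda>_. 0::nat"] RCA0_nat by (auto simp: Sets_nat_def)


section \<open>The Henkin model\<close>

text \<open>
  HOL has no types depending on assumptions, so the countermodel that would exist if \<open>RCA\<^sub>0\<close> did
  not prove the implication is chosen globally; should the implication be provable, the choice
  falls on some Henkin theory extending \<open>RCA\<^sub>0\<close>, which exists as \<open>RCA\<^sub>0\<close> is consistent.
\<close>

definition target :: fm where
  "target = (RT32 \<^bold>\<longrightarrow> WOP_omega) 0 0"

definition theory_of_model :: "fm set" (\<open>\<Theta>\<close>) where
  "\<Theta> = (SOME \<Gamma>. henkin RCA0 \<Gamma> \<and> (\<not> proves RCA0 target \<longrightarrow> target \<notin> \<Gamma>))"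

lemma henkin_\<Theta>: "henkin RCA0 \<Theta>" and target_notin_\<Theta>: "\<not> proves RCA0 target \<Longrightarrow> target \<notin> \<Theta>"
proof -
  have "\<exists>\<Gamma>. henkin RCA0 \<Gamma> \<and> (\<not> proves RCA0 target \<longrightarrow> target \<notin> \<Gamma>)"
  proof (cases "proves RCA0 target")
    case True
    then show ?thesis using henkin_extension[OF _ RCA0_consistent] by auto
  next
    case False
    then have "\<not> RCA0 ; {Neg target} \<turnstile> Fls" by (auto simp: proves_def intro: Contra)
    then obtain \<Gamma> where \<Gamma>: "{Neg target} \<subseteq> \<Gamma>" "henkin RCA0 \<Gamma>" using henkin_extension by blast
    have "target \<notin> \<Gamma>"
    proof
      assume "target \<in> \<Gamma>"
      with \<Gamma>(1) have "finite {target, Neg target}" "{target, Neg target} \<subseteq> \<Gamma>" by auto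
      moreover have "RCA0 ; {target, Neg target} \<turnstile> Fls" by (blast intro: ImpE Hyp)
      ultimately show False using \<Gamma>(2) unfolding henkin_def by blast
    qed
    with \<Gamma> show ?thesis by blast
  qed
  from someI_ex[OF this] show "henkin RCA0 \<Theta>" "\<not> proves RCA0 target \<Longrightarrow> target \<notin> \<Theta>"
    unfolding theory_of_model_def by auto
qed

lemma \<Theta>_closed: "finite G \<Longrightarrow> G \<subseteq> \<Theta> \<Longrightarrow> RCA0 ; G \<turnstile> A \<Longrightarrow> A \<in> \<Theta>"
  using henkin_\<Theta> unfolding henkin_def by blast

lemma \<Theta>_Fls: "Fls \<notin> \<Theta>"
  using henkin_\<Theta> unfolding henkin_def by blast

lemma \<Theta>_Imp: "Imp A B \<in> \<Theta> \<longleftrightarrow> (A \<in> \<Theta> \<longrightarrow> B \<in> \<Theta>)"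
proof
  assume "Imp A B \<in> \<Theta>"
  then show "A \<in> \<Theta> \<longrightarrow> B \<in> \<Theta>" by (auto intro: \<Theta>_closed[of "{Imp A B, A}"] ImpE Hyp)
next
  assume *: "A \<in> \<Theta> \<longrightarrow> B \<in> \<Theta>"
  consider "B \<in> \<Theta>" | "Neg A \<in> \<Theta>" using * henkin_\<Theta> unfolding henkin_def by blast
  then show "Imp A B \<in> \<Theta>"
  proof cases
    case 1 then show ?thesis by (intro \<Theta>_closed[of "{B}"]) (auto intro: ImpI Hyp)
  next
    case 2
    have "RCA0 ; {A, Neg A} \<turnstile> Fls" by (blast intro: ImpE Hyp)
    with 2 show ?thesis by (intro \<Theta>_closed[of "{Neg A}"]) (auto intro: ImpI ex_falso)
  qed
qed

lemma \<Theta>_All: "All A \<in> \<Theta> \<longleftrightarrow> (\<forall>t. inst t A \<in> \<Theta>)"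
proof
  assume "All A \<in> \<Theta>"
  then show "\<forall>t. inst t A \<in> \<Theta>" by (auto intro: \<Theta>_closed[of "{All A}"] AllE Hyp)
qed (use henkin_\<Theta> in \<open>unfold henkin_def, blast\<close>)

lemma \<Theta>_AllS: "AllS A \<in> \<Theta> \<longleftrightarrow> (\<forall>X. instS X A \<in> \<Theta>)"
proof
  assume "AllS A \<in> \<Theta>"
  then show "\<forall>X. instS X A \<in> \<Theta>" by (auto intro: \<Theta>_closed[of "{AllS A}"] AllSE Hyp)
qed (use henkin_\<Theta> in \<open>unfold henkin_def, blast\<close>)

lemma \<Theta>_refl: "Eq t t \<in> \<Theta>"
  by (rule \<Theta>_closed[of "{}"]) (auto intro: EqI)

lemma \<Theta>_replace: "Eq s t \<in> \<Theta> \<Longrightarrow> inst s A \<in> \<Theta> \<Longrightarrow> inst t A \<in> \<Theta>"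
  by (rule \<Theta>_closed[of "{Eq s t, inst s A}"]) (auto intro: EqE Hyp)

lemma subst_case_nat_lift_tm [simp]: "subst_tm (case_nat t Var) (lift_tm s) = s"
  by (simp add: lift_tm_def subst_tm_subst_tm)

lemma \<Theta>_sym: "Eq s t \<in> \<Theta> \<Longrightarrow> Eq t s \<in> \<Theta>"
  using \<Theta>_replace[of s t "Eq (Var 0) (lift_tm s)"] \<Theta>_refl by (simp add: inst_def)

lemma \<Theta>_trans: "Eq s t \<in> \<Theta> \<Longrightarrow> Eq t u \<in> \<Theta> \<Longrightarrow> Eq s u \<in> \<Theta>"
  using \<Theta>_replace[of t u "Eq (lift_tm s) (Var 0)"] by (simp add: inst_def)

lemma \<Theta>_Add: "Eq s s' \<in> \<Theta> \<Longrightarrow> Eq t t' \<in> \<Theta> \<Longrightarrow> Eq (Add s t) (Add s' t') \<in> \<Theta>"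
  using \<Theta>_replace[of s s' "Eq (Add (lift_tm s) (lift_tm t)) (Add (Var 0) (lift_tm t))"]
    \<Theta>_replace[of t t' "Eq (Add (lift_tm s) (lift_tm t)) (Add (lift_tm s') (Var 0))"] \<Theta>_refl
  by (simp add: inst_def)

lemma \<Theta>_Mul: "Eq s s' \<in> \<Theta> \<Longrightarrow> Eq t t' \<in> \<Theta> \<Longrightarrow> Eq (Mul s t) (Mul s' t') \<in> \<Theta>"
  using \<Theta>_replace[of s s' "Eq (Mul (lift_tm s) (lift_tm t)) (Mul (Var 0) (lift_tm t))"]
    \<Theta>_replace[of t t' "Eq (Mul (lift_tm s) (lift_tm t)) (Mul (lift_tm s') (Var 0))"] \<Theta>_refl
  by (simp add: inst_def)

lemma \<Theta>_Less: "Eq s s' \<in> \<Theta> \<Longrightarrow> Eq t t' \<in> \<Theta> \<Longrightarrow> Less s t \<in> \<Theta> \<Longrightarrow> Less s' t' \<in> \<Theta>"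
  using \<Theta>_replace[of s s' "Less (Var 0) (lift_tm t)"] \<Theta>_replace[of t t' "Less (lift_tm s') (Var 0)"]
  by (simp add: inst_def)

lemma \<Theta>_Mem: "Eq s s' \<in> \<Theta> \<Longrightarrow> Mem s X \<in> \<Theta> \<Longrightarrow> Mem s' X \<in> \<Theta>"
  using \<Theta>_replace[of s s' "Mem (Var 0) X"] by (simp add: inst_def)

\<comment> \<open>Dividing by equality in \<open>\<Theta>\<close> makes \<open>Eq\<close> true
  equality, as \<open>sat\<close> demands. The sets of the model are the extensions of the set
  variables, which are the only set terms.\<close>
quotient_type henkin_model = tm / "\<lambda>s t. Eq s t \<in> \<Theta>"
  by (rule equivpI) (auto intro!: reflpI sympI transpI intro: \<Theta>_refl \<Theta>_sym \<Theta>_trans)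

instantiation henkin_model :: second_order_structure
begin

lift_definition zero_henkin_model :: henkin_model is Zero .
lift_definition one_henkin_model :: henkin_model is One .
lift_definition plus_henkin_model :: "henkin_model \<Rightarrow> henkin_model \<Rightarrow> henkin_model" is Add
  by (rule \<Theta>_Add)
lift_definition times_henkin_model :: "henkin_model \<Rightarrow> henkin_model \<Rightarrow> henkin_model" is Mul
  by (rule \<Theta>_Mul)
lift_definition less_henkin_model :: "henkin_model \<Rightarrow> henkin_model \<Rightarrow> bool" is "\<lambda>s t. Less s t \<in> \<Theta>"
  by (blast intro: \<Theta>_Less \<Theta>_sym)
definition less_eq_henkin_model :: "henkin_model \<Rightarrow> henkin_model \<Rightarrow> bool" where
  "x \<le> y \<longleftrightarrow> x < y \<or> x = y" for x y :: henkin_model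
definition Sets_henkin_model :: "henkin_model set set" where
  "Sets = range (\<lambda>X. {abs_henkin_model t | t. Mem t X \<in> \<Theta>})"

instance ..

end

lemma tm_val_henkin_model: "tm_val (\<lambda>i. abs_henkin_model (\<sigma> i)) t = abs_henkin_model (subst_tm \<sigma> t)"
  by (induction t) (auto simp: zero_henkin_model_def one_henkin_model_def plus_henkin_model.abs_eq times_henkin_model.abs_eq)

lemma abs_henkin_model_eq: "abs_henkin_model s = abs_henkin_model t \<longleftrightarrow> Eq s t \<in> \<Theta>"
  by (rule henkin_model.abs_eq_iff)

lemma case_nat_abs_henkin_model:
  "case_nat (abs_henkin_model t) (\<lambda>i. abs_henkin_model (\<sigma> i)) = (\<lambda>i. abs_henkin_model (case_nat t \<sigma> i))"
  by (rule ext) (simp split: nat.split)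

lemma all_henkin_model: "(\<forall>x. P x) \<longleftrightarrow> (\<forall>t. P (abs_henkin_model t))"
  by (intro iffI allI) (blast, rule henkin_model.abs_induct, blast)

lemma ball_Sets_henkin_model: "(\<forall>X\<in>Sets. P X) \<longleftrightarrow> (\<forall>n. P {abs_henkin_model t | t. Mem t n \<in> \<Theta>})"
  by (simp add: Sets_henkin_model_def)

text \<open>An environment of the model amounts to a substitution, as each element is the class of a
  term and each set is named by a variable. Arbitrary substitutions are what the quantifier cases
  need: extending the environment is instantiating the quantifier.\<close>

lemma truth_lemma:
  "sat A (\<lambda>i. abs_henkin_model (\<sigma> i)) (\<lambda>i. {abs_henkin_model t | t. Mem t (\<rho> i) \<in> \<Theta>}) \<longleftrightarrow> subst \<sigma> \<rho> A \<in> \<Theta>"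
proof (induction A arbitrary: \<sigma> \<rho>)
  case (Mem t X)
  then show ?case using \<Theta>_Mem \<Theta>_sym \<Theta>_refl by (simp add: tm_val_henkin_model abs_henkin_model_eq) blast
next
  case (All A)
  have "sat (All A) (\<lambda>i. abs_henkin_model (\<sigma> i)) (\<lambda>i. {abs_henkin_model t | t. Mem t (\<rho> i) \<in> \<Theta>})
    \<longleftrightarrow> (\<forall>t. sat A (\<lambda>i. abs_henkin_model (case_nat t \<sigma> i)) (\<lambda>i. {abs_henkin_model t | t. Mem t (\<rho> i) \<in> \<Theta>}))"
    unfolding sat.simps all_henkin_model case_nat_abs_henkin_model ..
  also have "\<dots> \<longleftrightarrow> (\<forall>t. subst (case_nat t \<sigma>) \<rho> A \<in> \<Theta>)"
    by (rule iff_allI) (rule All)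
  also have "\<dots> \<longleftrightarrow> (\<forall>t. inst t (subst (up \<sigma>) \<rho> A) \<in> \<Theta>)"
  proof -
    have "inst t (subst (up \<sigma>) \<rho> A) = subst (case_nat t \<sigma>) \<rho> A" for t
      unfolding inst_def subst_subst by (rule subst_cong) (auto split: nat.split)
    then show ?thesis by simp
  qed
  finally show ?case by (simp add: \<Theta>_All)
next
  case (AllS A)
  let ?S = "\<lambda>X. {abs_henkin_model t | t. Mem t X \<in> \<Theta>}"
  have *: "case_nat (?S X) (\<lambda>i. ?S (\<rho> i)) = (\<lambda>i. ?S (case_nat X \<rho> i))" for X
    by (rule ext) (simp split: nat.split)
  have "sat (AllS A) (\<lambda>i. abs_henkin_model (\<sigma> i)) (\<lambda>i. ?S (\<rho> i)) \<longleftrightarrow> (\<forall>X. subst \<sigma> (case_nat X \<rho>) A \<in> \<Theta>)"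
    unfolding sat.simps ball_Sets_henkin_model * by (rule iff_allI) (rule AllS)
  also have "\<dots> \<longleftrightarrow> (\<forall>X. instS X (subst \<sigma> (upS \<rho>) A) \<in> \<Theta>)"
  proof -
    have "instS X (subst \<sigma> (upS \<rho>) A) = subst \<sigma> (case_nat X \<rho>) A" for X
      unfolding instS_def subst_subst by (rule subst_cong) (auto split: nat.split)
    then show ?thesis by simp
  qed
  finally show ?case by (simp add: \<Theta>_AllS)
qed (auto simp: tm_val_henkin_model abs_henkin_model_eq less_henkin_model.abs_eq \<Theta>_Fls \<Theta>_Imp)

text \<open>\<open>Sets_nonempty\<close> provides a value for the set variables that do not matter,
  since \<open>sat_RCA0\<close> speaks of environments all of whose sets lie in
  \<open>Sets\<close>.\<close>

class rca0_structure = second_order_structure +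
  assumes Sets_nonempty: "\<exists>X. X \<in> Sets"
    and sat_RCA0: "A \<in> RCA0 \<Longrightarrow> \<forall>i. S i \<in> Sets \<Longrightarrow> sat A e S"

instance henkin_model :: rca0_structure
proof
  show "\<exists>X :: henkin_model set. X \<in> Sets" unfolding Sets_henkin_model_def by blast
next
  fix A and S :: "nat \<Rightarrow> henkin_model set" and e :: "nat \<Rightarrow> henkin_model"
  assume A: "A \<in> RCA0" and S: "\<forall>i. S i \<in> Sets"
  have "\<exists>X. S i = {abs_henkin_model t | t. Mem t X \<in> \<Theta>}" for i
    using S[rule_format, of i] unfolding Sets_henkin_model_def by blast
  from choice[OF allI[OF this]] obtain \<rho> where "\<forall>i. S i = {abs_henkin_model t | t. Mem t (\<rho> i) \<in> \<Theta>}" ..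
  then have \<rho>: "S = (\<lambda>i. {abs_henkin_model t | t. Mem t (\<rho> i) \<in> \<Theta>})" by (intro ext) (rule spec)
  have "\<exists>t. e i = abs_henkin_model t" for i by (rule henkin_model.abs_induct) blast
  from choice[OF allI[OF this]] obtain \<sigma> where "\<forall>i. e i = abs_henkin_model (\<sigma> i)" ..
  then have \<sigma>: "e = (\<lambda>i. abs_henkin_model (\<sigma> i))" by (intro ext) (rule spec)
  have "subst \<sigma> \<rho> A \<in> \<Theta>" by (rule \<Theta>_closed[of "{}"]) (auto intro: axiom_subst A)
  then show "sat A e S" unfolding \<rho> \<sigma> truth_lemma .
qed

lemma provable_if_sat_henkin_model:
  assumes "\<And>S (e :: nat \<Rightarrow> henkin_model). \<forall>i. S i \<in> Sets \<Longrightarrow> sat target e S"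
  shows "proves RCA0 target"
proof -
  have "sat target (\<lambda>i. abs_henkin_model (Var i)) (\<lambda>i. {abs_henkin_model t | t. Mem t i \<in> \<Theta>})"
    by (rule assms) (auto simp: Sets_henkin_model_def)
  then show ?thesis using truth_lemma[of target Var "\<lambda>i. i"] target_notin_\<Theta> by auto
qed

section \<open>Definable predicates\<close>

inductive Tm :: "((nat \<Rightarrow> 'a::second_order_structure) \<Rightarrow> 'a) \<Rightarrow> bool" where
  Tm_var: "Tm (\<lambda>e. e i)"
| Tm_const: "Tm (\<lambda>e. c)"
| Tm_add: "Tm f \<Longrightarrow> Tm g \<Longrightarrow> Tm (\<lambda>e. f e + g e)"
| Tm_mul: "Tm f \<Longrightarrow> Tm g \<Longrightarrow> Tm (\<lambda>e. f e * g e)"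

text \<open>
  Predicates of environments that are \<open>\<Sigma>\<^sup>0\<^sub>0\<close> with number and set parameters.  A bound variable
  becomes index 0 of the environment, so the rules can be applied by higher-order matching.
\<close>

inductive D0 :: "((nat \<Rightarrow> 'a::second_order_structure) \<Rightarrow> bool) \<Rightarrow> bool" where
  D0_eq: "Tm f \<Longrightarrow> Tm g \<Longrightarrow> D0 (\<lambda>e. f e = g e)"
| D0_less: "Tm f \<Longrightarrow> Tm g \<Longrightarrow> D0 (\<lambda>e. f e < g e)"
| D0_mem: "Tm f \<Longrightarrow> X \<in> Sets \<Longrightarrow> D0 (\<lambda>e. f e \<in> X)"
| D0_False: "D0 (\<lambda>e. False)"
| D0_imp: "D0 P \<Longrightarrow> D0 Q \<Longrightarrow> D0 (\<lambda>e. P e \<longrightarrow> Q e)"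
| D0_ball: "Tm t \<Longrightarrow> D0 (\<lambda>e. P (\<lambda>i. e (Suc i)) (e 0)) \<Longrightarrow> D0 (\<lambda>e. \<forall>x. x < t e \<longrightarrow> P e x)"

lemma D0_not: "D0 P \<Longrightarrow> D0 (\<lambda>e. \<not> P e)"
  using D0_imp[of P "\<lambda>e. False"] by (simp add: D0_False)

lemma D0_disj: "D0 P \<Longrightarrow> D0 Q \<Longrightarrow> D0 (\<lambda>e. P e \<or> Q e)"
  using D0_imp[of "\<lambda>e. \<not> P e" Q] by (simp add: D0_not disj_imp)

lemma D0_conj: "D0 P \<Longrightarrow> D0 Q \<Longrightarrow> D0 (\<lambda>e. P e \<and> Q e)"
  using D0_not[OF D0_imp[of P "\<lambda>e. \<not> Q e"]] by (simp add: D0_not)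

lemma D0_iff: "D0 P \<Longrightarrow> D0 Q \<Longrightarrow> D0 (\<lambda>e. P e \<longleftrightarrow> Q e)"
  unfolding iff_conv_conj_imp by (intro D0_conj D0_imp)

lemma D0_True: "D0 (\<lambda>e. True)"
  using D0_not[OF D0_False] by simp

lemma D0_bex: "Tm t \<Longrightarrow> D0 (\<lambda>e. P (\<lambda>i. e (Suc i)) (e 0)) \<Longrightarrow> D0 (\<lambda>e. \<exists>x. x < t e \<and> P e x)"
  using D0_not[OF D0_ball[of t "\<lambda>e x. \<not> P e x"]] by (simp add: D0_not)

lemmas D0_intros = Tm.intros D0_eq D0_less D0_mem D0_False D0_ball D0_not D0_disj D0_conj D0_iff D0_imp D0_True D0_bex

text \<open>One environment has to hold both the variables and infinitely many places for
  parameters. Interleaving once more merges the parameter lists of two formulas.\<close>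

definition mix :: "(nat \<Rightarrow> 'b) \<Rightarrow> (nat \<Rightarrow> 'b) \<Rightarrow> nat \<Rightarrow> 'b" where
  "mix e p i = (if even i then e (i div 2) else p (i div 2))"

lemma mix_simps [simp]: "mix e p (2 * i) = e i" "mix e p (Suc (2 * i)) = p i"
  by (simp_all add: mix_def)

lemma subst_tm_up_lift_tm: "subst_tm (up \<sigma>) (lift_tm t) = lift_tm (subst_tm \<sigma> t)"
  by (simp add: lift_tm_def subst_tm_subst_tm)

lemma Sigma00_subst: "Sigma00 A \<Longrightarrow> Sigma00 (subst \<sigma> \<rho> A)"
  by (induction arbitrary: \<sigma> \<rho> rule: Sigma00.induct) (auto simp: subst_tm_up_lift_tm intro: Sigma00.intros)

text \<open>Parameters are stored at the odd indices.\<close>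

lemma Tm_formula: "Tm f \<Longrightarrow> \<exists>t p. \<forall>e. f e = tm_val (mix e p) t"
proof (induction rule: Tm.induct)
  case (Tm_var i)
  show ?case by (rule exI[of _ "Var (2 * i)"]) simp
next
  case (Tm_const c)
  show ?case by (rule exI[of _ "Var 1"], rule exI[of _ "\<lambda>_. c"]) (simp add: mix_def)
next
  case (Tm_add f g)
  then obtain t p t' p' where *: "\<And>e. f e = tm_val (mix e p) t" "\<And>e. g e = tm_val (mix e p') t'" by blast
  have "f e + g e = tm_val (mix e (mix p p'))
     (Add (subst_tm (mix (\<lambda>i. Var (2 * i)) (\<lambda>i. Var (Suc (2 * (2 * i))))) t)
          (subst_tm (mix (\<lambda>i. Var (2 * i)) (\<lambda>i. Var (Suc (2 * (Suc (2 * i)))))) t'))" for e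
    unfolding * tm_val.simps tm_val_subst by (intro arg_cong2[where f="(+)"] arg_cong2[where f=tm_val] ext refl) (auto simp: mix_def elim!: oddE)
  then show ?case by blast
next
  case (Tm_mul f g)
  then obtain t p t' p' where *: "\<And>e. f e = tm_val (mix e p) t" "\<And>e. g e = tm_val (mix e p') t'" by blast
  have "f e * g e = tm_val (mix e (mix p p'))
     (Mul (subst_tm (mix (\<lambda>i. Var (2 * i)) (\<lambda>i. Var (Suc (2 * (2 * i))))) t)
          (subst_tm (mix (\<lambda>i. Var (2 * i)) (\<lambda>i. Var (Suc (2 * (Suc (2 * i)))))) t'))" for e
    unfolding * tm_val.simps tm_val_subst by (intro arg_cong2[where f="(*)"] arg_cong2[where f=tm_val] ext refl) (auto simp: mix_def elim!: oddE)
  then show ?case by blast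
qed

definition represents :: "fm \<Rightarrow> (nat \<Rightarrow> 'a::second_order_structure) \<Rightarrow> (nat \<Rightarrow> 'a set) \<Rightarrow> ((nat \<Rightarrow> 'a) \<Rightarrow> bool) \<Rightarrow> bool" where
  "represents A p S P \<longleftrightarrow> Sigma00 A \<and> (\<forall>i. S i \<in> Sets) \<and> (\<forall>e. P e = sat A (mix e p) S)"

text \<open>The renamed formula reads its parameters from the even places of the merged list, that
  is, from the indices \<open>4 * i + 1\<close> of the whole environment.\<close>

lemma represents_mix1: 
  assumes "represents A p S P" "\<forall>i. S' i \<in> Sets" 
  shows "\<exists>A. represents A (mix p p') (mix S S') P"
proof -
  let ?A = "subst (mix (\<lambda>i. Var (2 * i)) (\<lambda>i. Var (Suc (2 * (2 * i))))) (\<lambda>i. 2 * i) A"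
  have "sat A (mix e p) S = sat ?A (mix e (mix p p')) (mix S S')" for e
    unfolding sat_subst by (intro arg_cong3[where f=sat] ext refl) (auto simp: mix_def elim!: oddE)
  then show ?thesis using assms by (intro exI[of _ ?A]) (simp add: represents_def Sigma00_subst, simp add: mix_def)
qed

lemma represents_mix2: 
  assumes "represents A p' S' P" "\<forall>i. S i \<in> Sets"
  shows "\<exists>A. represents A (mix p p') (mix S S') P"
proof -
  let ?A = "subst (mix (\<lambda>i. Var (2 * i)) (\<lambda>i. Var (Suc (2 * (Suc (2 * i)))))) (\<lambda>i. Suc (2 * i)) A"
  have "sat A (mix e p') S' = sat ?A (mix e (mix p p')) (mix S S')" for e
    unfolding sat_subst by (intro arg_cong3[where f=sat] ext refl) (auto simp: mix_def elim!: oddE)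
  then show ?thesis using assms by (intro exI[of _ ?A]) (simp add: represents_def Sigma00_subst, simp add: mix_def)
qed

lemma represents_common:
  assumes "represents A p S P" "represents B p' S' Q"
  shows "\<exists>A' B' q R. represents A' q R P \<and> represents B' q R Q"
proof -
  have "\<forall>i. S i \<in> Sets" "\<forall>i. S' i \<in> Sets" using assms by (auto simp: represents_def)
  then obtain A' B' where "represents A' (mix p p') (mix S S') P" "represents B' (mix p p') (mix S S') Q"
    using assms represents_mix1 represents_mix2 by blast
  then show ?thesis by blast
qed

lemma Tm_common:
  assumes "Tm f" "Tm g"
  shows "\<exists>p s t. (\<forall>e. f e = tm_val (mix e p) s) \<and> (\<forall>e. g e = tm_val (mix e p) t)"
proof -
  obtain t p t' p' where *: "\<And>e. f e = tm_val (mix e p) t" "\<And>e. g e = tm_val (mix e p') t'"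
    using assms Tm_formula by meson
  have "f e = tm_val (mix e (mix p p')) (subst_tm (mix (\<lambda>i. Var (2 * i)) (\<lambda>i. Var (Suc (2 * (2 * i))))) t)" for e
    unfolding * tm_val_subst by (intro arg_cong2[where f=tm_val] ext refl) (auto simp: mix_def elim!: oddE)
  moreover have "g e = tm_val (mix e (mix p p')) (subst_tm (mix (\<lambda>i. Var (2 * i)) (\<lambda>i. Var (Suc (2 * (Suc (2 * i)))))) t')" for e
    unfolding * tm_val_subst by (intro arg_cong2[where f=tm_val] ext refl) (auto simp: mix_def elim!: oddE)
  ultimately show ?thesis by blast
qed

text \<open>Renaming that moves the bound variable from the front to the first even index.\<close>

definition front :: "nat \<Rightarrow> nat" where
  "front i = (if i = 0 then 0 else if even i then i - 1 else Suc i)"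

lemma mix_case_nat: "mix (case_nat x e) p = (\<lambda>i. case_nat x (mix e p) (front i))"
proof
  fix i show "mix (case_nat x e) p i = case_nat x (mix e p) (front i)"
    by (cases i; cases "even i") (auto simp: mix_def front_def elim!: evenE oddE)
qed

lemma tm_val_lift_tm: "tm_val (case_nat x e) (lift_tm t) = tm_val e t"
  by (simp add: lift_tm_def tm_val_subst)

text \<open>The bridge from predicates on environments to the syntactic axiom schemes.\<close>

lemma D0_formula: "D0 (P :: (nat \<Rightarrow> 'a::rca0_structure) \<Rightarrow> bool) \<Longrightarrow> \<exists>A p S. represents A p S P"
proof (induction rule: D0.induct)
  case (D0_eq f g)
  obtain X :: "'a set" where X: "X \<in> Sets" using Sets_nonempty by blast
  obtain p s t where "\<forall>e. f e = tm_val (mix e p) s" "\<forall>e. g e = tm_val (mix e p) t"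
    using Tm_common[OF D0_eq] by blast
  then have "represents (Eq s t) p (\<lambda>_. X) (\<lambda>e. f e = g e)"
    using X by (simp add: represents_def Sigma00.intros)
  then show ?case by blast
next
  case (D0_less f g)
  obtain X :: "'a set" where X: "X \<in> Sets" using Sets_nonempty by blast
  obtain p s t where "\<forall>e. f e = tm_val (mix e p) s" "\<forall>e. g e = tm_val (mix e p) t"
    using Tm_common[OF D0_less] by blast
  then have "represents (Less s t) p (\<lambda>_. X) (\<lambda>e. f e < g e)"
    using X by (simp add: represents_def Sigma00.intros)
  then show ?case by blast
next
  case (D0_mem f X)
  obtain t p where "\<And>e. f e = tm_val (mix e p) t"
    using Tm_formula[OF D0_mem(1)] by blast
  then have "represents (Mem t 0) p (\<lambda>_. X) (\<lambda>e. f e \<in> X)"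
    using D0_mem by (simp add: represents_def Sigma00.intros)
  then show ?case by blast
next
  case D0_False
  obtain X :: "'a set" where X: "X \<in> Sets" using Sets_nonempty by blast
  then have "represents Fls (\<lambda>_. undefined) (\<lambda>_. X) (\<lambda>e. False)"
    by (simp add: represents_def Sigma00.intros)
  then show ?case by blast
next
  case (D0_imp P Q)
  then obtain A p S A' p' S' where "represents A p S P" "represents A' p' S' Q" by blast
  then obtain A B p S where "represents A p S P" "represents B p S Q" using represents_common by meson
  then have "represents (Imp A B) p S (\<lambda>e. P e \<longrightarrow> Q e)"
    by (simp add: represents_def Sigma00.intros)
  then show ?case by blast
next
  case (D0_ball t P)
  obtain s p where s: "\<And>e. t e = tm_val (mix e p) s" using Tm_formula[OF D0_ball(1)] by blast
  obtain A q S where A: "represents A q S (\<lambda>e. P (\<lambda>i. e (Suc i)) (e 0))" using D0_ball by blast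
  then have S: "\<forall>i. S i \<in> Sets" by (simp add: represents_def)
  obtain A where A: "represents A (mix p q) (mix S S) (\<lambda>e. P (\<lambda>i. e (Suc i)) (e 0))"
    using represents_mix2[OF A S] by blast
  let ?s = "subst_tm (mix (\<lambda>i. Var (2 * i)) (\<lambda>i. Var (Suc (2 * (2 * i))))) s"
  \<comment> \<open>The syntactic quantifier puts its variable in front of variables and parameters
    alike, whereas \<open>D0\<close> shifts the variables only; \<open>front\<close> reconciles the
    two.\<close>
  let ?A = "subst (\<lambda>i. Var (front i)) (\<lambda>i. i) A"
  let ?q = "mix p q"
  have "t e = tm_val (mix e ?q) ?s" for e
    unfolding s tm_val_subst by (intro arg_cong2[where f=tm_val] ext refl) (auto simp: mix_def elim!: oddE)
  moreover have "P e x = sat ?A (case_nat x (mix e ?q)) (mix S S)" for e x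
  proof -
    have "P e x = sat A (mix (case_nat x e) ?q) (mix S S)"
      using A[unfolded represents_def, THEN conjunct2, THEN conjunct2, rule_format, of "case_nat x e"] by simp
    then show ?thesis by (simp add: sat_subst mix_case_nat)
  qed
  ultimately have "represents (All (Imp (Less (Var 0) (lift_tm ?s)) ?A)) ?q (mix S S) (\<lambda>e. \<forall>x. x < t e \<longrightarrow> P e x)"
    using A unfolding represents_def
    by (auto simp: Sigma00_subst tm_val_lift_tm intro!: Sigma00.intros)
  then show ?case by blast
qed

section \<open>Sigma01 induction and Delta01 comprehension for predicates\<close>

definition S1 :: "((nat \<Rightarrow> 'a::second_order_structure) \<Rightarrow> bool) \<Rightarrow> bool" where
  "S1 P \<longleftrightarrow> (\<exists>Q. D0 (\<lambda>e. Q (\<lambda>i. e (Suc i)) (e 0)) \<and> P = (\<lambda>e. \<exists>y. Q e y))"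

lemma S1_formula:
  fixes P :: "'a::rca0_structure \<Rightarrow> bool"
  assumes "S1 (\<lambda>e. P (e 0))"
  shows "\<exists>A S q. Sigma00 A \<and> (\<forall>i. S i \<in> Sets) \<and> (\<forall>x. P x \<longleftrightarrow> (\<exists>y. sat A (case_nat y (case_nat x q)) S))"
proof -
  obtain Q where Q: "D0 (\<lambda>e. Q (\<lambda>i. e (Suc i)) (e 0))" "(\<lambda>e. P (e 0)) = (\<lambda>e. \<exists>y. Q e y)"
    using assms unfolding S1_def by blast
  obtain A p S where A: "represents A p S (\<lambda>e. Q (\<lambda>i. e (Suc i)) (e 0))" using D0_formula[OF Q(1)] by blast
  let ?A = "subst (\<lambda>i. Var (case_nat 0 (\<lambda>i. Suc (front i)) (front i))) (\<lambda>i. i) A"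
  \<comment> \<open>The predicate depends on \<open>e 0\<close> only, so the remaining variables can
    be set to 0.\<close>
  let ?q = "mix (\<lambda>_. 0) p"
  have "Q (case_nat x (\<lambda>_. 0)) y = sat ?A (case_nat y (case_nat x ?q)) S" for x y
  proof -
    have "Q (case_nat x (\<lambda>_. 0)) y = sat A (mix (case_nat y (case_nat x (\<lambda>_. 0))) p) S"
      using A[unfolded represents_def, THEN conjunct2, THEN conjunct2, rule_format, of "case_nat y (case_nat x (\<lambda>_. 0))"] by simp
    also have "mix (case_nat y (case_nat x (\<lambda>_. 0))) p
      = (\<lambda>i. case_nat y (case_nat x ?q) (case_nat 0 (\<lambda>i. Suc (front i)) (front i)))"
      unfolding mix_case_nat by (rule ext) (simp split: nat.split)
    finally show ?thesis by (simp add: sat_subst)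
  qed
  moreover have "P x \<longleftrightarrow> (\<exists>y. Q (case_nat x (\<lambda>_. 0)) y)" for x
    using fun_cong[OF Q(2), of "case_nat x (\<lambda>_. 0)"] by simp
  ultimately show ?thesis using A by (intro exI[of _ ?A] exI[of _ S] exI[of _ ?q]) (simp add: represents_def Sigma00_subst)
qed

lemma Sigma1_induct:
  fixes P :: "'a::rca0_structure \<Rightarrow> bool"
  assumes "S1 (\<lambda>e. P (e 0))" "P 0" "\<And>x. P x \<Longrightarrow> P (x + 1)"
  shows "P x"
proof -
  obtain A S q where A: "Sigma00 A" "\<forall>i. S i \<in> Sets" "\<forall>x. P x \<longleftrightarrow> (\<exists>y. sat A (case_nat y (case_nat x q)) S)"
    using S1_formula[OF assms(1)] by blast
  have "induction_axiom (Ex A) \<in> RCA0" using A by (auto simp: RCA0_def Sigma01_def)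
  then have "sat (induction_axiom (Ex A)) q S" using A(2) by (rule sat_RCA0)
  moreover have P: "sat (Ex A) (case_nat x q) S \<longleftrightarrow> P x" for x by (simp add: A(3))
  have "(\<lambda>i. tm_val (case_nat x q) (case_nat (Add (Var 0) One) (\<lambda>i. Var (Suc i)) i)) = case_nat (x + 1) q" for x
    by (rule ext) (simp split: nat.split)
  then have "sat (subst (case_nat (Add (Var 0) One) (\<lambda>i. Var (Suc i))) (\<lambda>i. i) (Ex A)) (case_nat x q) S \<longleftrightarrow> P (x + 1)" for x
    unfolding sat_subst P[symmetric] by simp
  moreover have "sat (inst Zero (Ex A)) q S \<longleftrightarrow> P 0" unfolding sat_inst P[symmetric] by simp
  ultimately show ?thesis using assms(2,3) P
    unfolding induction_axiom_def sat.simps(5) sat.simps(6) sat.simps(4) by blast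
qed

lemma sat_comprehension:
  "sat (ExS (All (Iff (Mem (Var 0) 0) (liftS A)))) e S \<longleftrightarrow> (\<exists>X\<in>Sets. \<forall>x. x \<in> X \<longleftrightarrow> sat A (case_nat x e) S)"
  by (simp add: sat_liftS iff_conv_conj_imp)

lemma Delta1_comprehension:
  fixes P :: "'a::rca0_structure \<Rightarrow> bool"
  assumes "S1 (\<lambda>e. P (e 0))" "S1 (\<lambda>e. \<not> P (e 0))"
  shows "{x. P x} \<in> Sets"
proof -
  obtain A S q where A: "Sigma00 A" "\<forall>i. S i \<in> Sets" "\<forall>x. P x \<longleftrightarrow> (\<exists>y. sat A (case_nat y (case_nat x q)) S)"
    using S1_formula[OF assms(1)] by blast
  obtain B R r where B: "Sigma00 B" "\<forall>i. R i \<in> Sets" "\<forall>x. \<not> P x \<longleftrightarrow> (\<exists>y. sat B (case_nat y (case_nat x r)) R)"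
    using S1_formula[OF assms(2)] by blast
  \<comment> \<open>The axiom needs both formulas over one environment. Indices 0 and 1 stay with
    the witness and the distinguished variable; the parameters of \<open>A\<close> go to the even
    places after them and those of \<open>B\<close> to the odd ones.\<close>
  let ?A = "subst (case_nat (Var 0) (case_nat (Var 1) (\<lambda>i. Var (2 + 2 * i)))) (\<lambda>i. 2 * i) A"
  let ?B = "subst (case_nat (Var 0) (case_nat (Var 1) (\<lambda>i. Var (2 + Suc (2 * i))))) (\<lambda>i. Suc (2 * i)) B"
  let ?q = "mix q r" and ?S = "mix S R"
  have S: "\<forall>i. ?S i \<in> Sets" using A B by (simp add: mix_def)
  have 1: "P x \<longleftrightarrow> sat (Ex ?A) (case_nat x ?q) ?S" for x
  proof -
    have "sat A (case_nat y (case_nat x q)) S = sat ?A (case_nat y (case_nat x ?q)) ?S" for y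
      unfolding sat_subst by (intro arg_cong3[where f=sat] ext refl) (auto split: nat.split)
    then show ?thesis by (simp add: A)
  qed
  have 2: "P x \<longleftrightarrow> sat (All (Neg ?B)) (case_nat x ?q) ?S" for x
  proof -
    have "sat B (case_nat y (case_nat x r)) R = sat ?B (case_nat y (case_nat x ?q)) ?S" for y
      unfolding sat_subst by (intro arg_cong3[where f=sat] ext refl) (auto split: nat.split)
    then show ?thesis using B(3)[THEN spec, of x] by auto
  qed
  have "comprehension_axiom (Ex ?A) (All (Neg ?B)) \<in> RCA0"
    using A B unfolding RCA0_def Sigma01_def Pi01_def by (blast intro: Sigma00_subst Sigma00.intros)
  then have *: "sat (comprehension_axiom (Ex ?A) (All (Neg ?B))) ?q ?S" using S by (rule sat_RCA0)
  have "sat (All (Iff (Ex ?A) (All (Neg ?B)))) ?q ?S"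
    using 1 2 unfolding sat.simps(4) sat.simps(5) sat.simps(6)[of "Iff _ _"] by blast
  then have "sat (ExS (All (Iff (Mem (Var 0) 0) (liftS (Ex ?A))))) ?q ?S"
    using * unfolding comprehension_axiom_def sat.simps(5) by blast
  then obtain X where X: "X \<in> Sets" "\<forall>x. x \<in> X \<longleftrightarrow> P x"
    unfolding sat_comprehension 1[symmetric] by blast
  then have "X = {x. P x}" by blast
  with X show ?thesis by simp
qed

section \<open>Arithmetic in models of \<open>RCA\<^sub>0\<close>\<close>

lemma Tm_subst: "Tm f \<Longrightarrow> (\<And>i. Tm (\<sigma> i)) \<Longrightarrow> Tm (\<lambda>e. f (\<lambda>i. \<sigma> i e))"
  by (induction rule: Tm.induct) (simp_all add: Tm.intros)

lemma D0_subst: "D0 P \<Longrightarrow> (\<And>i. Tm (\<sigma> i)) \<Longrightarrow> D0 (\<lambda>e. P (\<lambda>i. \<sigma> i e))"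
proof (induction arbitrary: \<sigma> rule: D0.induct)
  case (D0_ball t P)
  let ?\<sigma> = "case_nat (\<lambda>e. e 0) (\<lambda>i e. \<sigma> i (\<lambda>i. e (Suc i)))"
  have "Tm (?\<sigma> i)" for i
  proof (cases i)
    case (Suc j)
    have "Tm (\<lambda>e. \<sigma> j (\<lambda>i. (\<lambda>e. e (Suc i)) e))" by (rule Tm_subst[OF D0_ball.prems]) (rule Tm_var)
    with Suc show ?thesis by simp
  qed (simp add: Tm_var)
  then have "D0 (\<lambda>e. P (\<lambda>i. ?\<sigma> (Suc i) e) (?\<sigma> 0 e))" by (rule D0_ball.IH)
  then show ?case by (intro D0.D0_ball Tm_subst[OF D0_ball.hyps(1)] D0_ball.prems) simp
next
  case (D0_eq f g)
  show ?case by (intro D0.D0_eq Tm_subst[OF D0_eq.hyps(1)] Tm_subst[OF D0_eq.hyps(2)] D0_eq.prems)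
next
  case (D0_less f g)
  show ?case by (intro D0.D0_less Tm_subst[OF D0_less.hyps(1)] Tm_subst[OF D0_less.hyps(2)] D0_less.prems)
next
  case (D0_mem f X)
  show ?case by (intro D0.D0_mem Tm_subst[OF D0_mem.hyps(1)] D0_mem.hyps(2) D0_mem.prems)
next
  case (D0_imp P Q)
  show ?case by (intro D0.D0_imp D0_imp.IH D0_imp.prems)
qed (rule D0.D0_False)

lemma D0_rename: "D0 P \<Longrightarrow> D0 (\<lambda>e. P (\<lambda>i. e (r i)))"
  using D0_subst[of P "\<lambda>i e. e (r i)"] Tm_var by blast

lemma S1_ex: "D0 (\<lambda>e. Q (\<lambda>i. e (Suc i)) (e 0)) \<Longrightarrow> S1 (\<lambda>e. \<exists>y. Q e y)"
  unfolding S1_def by blast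

lemma S1_D0: "D0 P \<Longrightarrow> S1 P"
  using S1_ex[of "\<lambda>e y. P e"] D0_rename[of P Suc] by simp

lemmas D0_induct [case_names D0 zero succ] = Sigma1_induct[OF S1_D0]

lemma sat_basic_axiom: "A \<in> basic_axioms \<Longrightarrow> sat A (e :: nat \<Rightarrow> 'a::rca0_structure) (\<lambda>_. SOME X. X \<in> Sets)"
  by (rule sat_RCA0) (simp add: RCA0_def, rule allI, rule someI_ex[OF Sets_nonempty])

context
  fixes x y z :: "'a::rca0_structure"
begin

text \<open>The facts named \<open>raw\<close> are proved while \<open>+\<close>, \<open>*\<close>
  and \<open><\<close> are bare symbols subject to the axioms only; they establish the algebraic
  class further below.\<close>

lemma raw_succ_neq_zero: "x + 1 \<noteq> 0"
  using sat_basic_axiom[of "Neg (Eq (Add (Var 0) One) Zero)" "\<lambda>_. x"] by (simp add: basic_axioms_def)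

lemma raw_succ_inj: "x + 1 = y + 1 \<Longrightarrow> x = y"
  using sat_basic_axiom[of "Imp (Eq (Add (Var 0) One) (Add (Var 1) One)) (Eq (Var 0) (Var 1))" "case_nat x (\<lambda>_. y)"]
  by (simp add: basic_axioms_def)

lemma raw_add_zero: "x + 0 = x"
  using sat_basic_axiom[of "Eq (Add (Var 0) Zero) (Var 0)" "\<lambda>_. x"] by (simp add: basic_axioms_def)

lemma raw_add_succ: "x + (y + 1) = (x + y) + 1"
  using sat_basic_axiom[of "Eq (Add (Var 0) (Add (Var 1) One)) (Add (Add (Var 0) (Var 1)) One)" "case_nat x (\<lambda>_. y)"]
  by (simp add: basic_axioms_def)

lemma raw_mult_zero: "x * 0 = 0"
  using sat_basic_axiom[of "Eq (Mul (Var 0) Zero) Zero" "\<lambda>_. x"] by (simp add: basic_axioms_def)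

lemma raw_mult_succ: "x * (y + 1) = x * y + x"
  using sat_basic_axiom[of "Eq (Mul (Var 0) (Add (Var 1) One)) (Add (Mul (Var 0) (Var 1)) (Var 0))" "case_nat x (\<lambda>_. y)"]
  by (simp add: basic_axioms_def)

lemma raw_not_less_zero: "\<not> x < 0"
  using sat_basic_axiom[of "Neg (Less (Var 0) Zero)" "\<lambda>_. x"] by (simp add: basic_axioms_def)

lemma raw_less_succ: "x < y + 1 \<longleftrightarrow> x < y \<or> x = y"
  using sat_basic_axiom[of "Iff (Less (Var 0) (Add (Var 1) One)) (Or (Less (Var 0) (Var 1)) (Eq (Var 0) (Var 1)))"
      "case_nat x (\<lambda>_. y)"]
  by (auto simp: basic_axioms_def)

end

lemma raw_less_trans: "x < y \<longrightarrow> y < z \<longrightarrow> x < (z :: 'a::rca0_structure)"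
  by (induction z rule: D0_induct) (intro D0_intros, auto simp: raw_not_less_zero raw_less_succ)

lemma raw_less_irrefl: "\<not> x < (x :: 'a::rca0_structure)"
proof (induction x rule: D0_induct)
  case (succ x)
  then show ?case by (metis raw_less_succ raw_less_trans)
qed (intro D0_intros, simp add: raw_not_less_zero)

lemma raw_zero_less: "0 = x \<or> 0 < (x :: 'a::rca0_structure)"
  by (induction x rule: D0_induct) (intro D0_intros, auto simp: raw_less_succ)

lemma raw_succ_le: "x < y \<longrightarrow> x + 1 < y \<or> x + 1 = (y :: 'a::rca0_structure)"
  by (induction y rule: D0_induct) (intro D0_intros, auto simp: raw_not_less_zero raw_less_succ)

lemma raw_linear: "x < y \<or> x = y \<or> y < (x :: 'a::rca0_structure)"
proof (induction x rule: D0_induct)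
  case zero
  then show ?case using raw_zero_less by blast
next
  case (succ x)
  then show ?case using raw_succ_le raw_less_succ by blast
qed (intro D0_intros)

lemma raw_zero_add: "0 + x = (x :: 'a::rca0_structure)"
  by (induction x rule: D0_induct) (intro D0_intros, auto simp: raw_add_zero raw_add_succ)

lemma raw_succ_add: "(x + 1) + y = (x + y) + (1 :: 'a::rca0_structure)"
  by (induction y rule: D0_induct) (intro D0_intros, auto simp: raw_add_zero raw_add_succ)

lemma raw_add_commute: "x + y = y + (x :: 'a::rca0_structure)"
  by (induction y rule: D0_induct) (intro D0_intros, auto simp: raw_add_zero raw_add_succ raw_zero_add raw_succ_add)

lemma raw_add_assoc: "x + y + z = x + (y + z :: 'a::rca0_structure)"
  by (induction z rule: D0_induct) (intro D0_intros, auto simp: raw_add_zero raw_add_succ)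

lemma raw_zero_mult: "0 * x = (0 :: 'a::rca0_structure)"
  by (induction x rule: D0_induct) (intro D0_intros, auto simp: raw_mult_zero raw_mult_succ raw_add_zero)

lemma raw_succ_mult: "(x + 1) * y = x * y + (y :: 'a::rca0_structure)"
proof (induction y rule: D0_induct)
  case (succ y)
  then show ?case by (simp add: raw_mult_succ) (metis raw_add_assoc raw_add_commute)
qed (intro D0_intros, simp add: raw_mult_zero raw_add_zero)

lemma raw_mult_commute: "x * y = y * (x :: 'a::rca0_structure)"
  by (induction y rule: D0_induct) (intro D0_intros, auto simp: raw_mult_zero raw_mult_succ raw_zero_mult raw_succ_mult)

lemma raw_distrib: "(x + y) * z = x * z + y * (z :: 'a::rca0_structure)"
proof (induction z rule: D0_induct)
  case (succ z)
  then show ?case by (simp add: raw_mult_succ) (metis raw_add_assoc raw_add_commute)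
qed (intro D0_intros, simp add: raw_mult_zero raw_add_zero)

lemma raw_mult_assoc: "x * y * z = x * (y * z :: 'a::rca0_structure)"
proof (induction z rule: D0_induct)
  case (succ z)
  then show ?case by (simp add: raw_mult_succ) (metis raw_distrib raw_mult_commute)
qed (intro D0_intros, simp add: raw_mult_zero raw_add_zero)

lemma raw_one_mult: "1 * x = (x :: 'a::rca0_structure)"
  by (metis raw_mult_commute raw_mult_succ raw_mult_zero raw_zero_add)

lemma raw_add_mono: "x < y \<Longrightarrow> z + x < z + (y :: 'a::rca0_structure)"
proof -
  assume "x < y"
  have "x + z < y + z"
  proof (induction z rule: D0_induct)
    case zero
    with \<open>x < y\<close> show ?case by (simp add: raw_add_zero)
  next
    case (succ z)
    then show ?case by (metis raw_add_succ raw_less_succ raw_succ_le)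
  qed (intro D0_intros)
  then show ?thesis by (simp add: raw_add_commute)
qed

lemma raw_less_imp_add: "x < y \<Longrightarrow> \<exists>z. y = x + (z :: 'a::rca0_structure)"
proof -
  \<comment> \<open>The hypothesis is moved inside the existential quantifier, which makes the
    induction predicate Sigma01 as it stands.\<close>
  have "\<exists>z. x < y \<longrightarrow> y = x + z"
  proof (induction y rule: Sigma1_induct[case_names S1 zero succ])
    case S1 show ?case by (intro S1_ex D0_intros)
  next
    case zero then show ?case by (simp add: raw_not_less_zero)
  next
    case (succ y)
    then show ?case by (metis raw_add_succ raw_add_zero raw_less_succ)
  qed
  then show "x < y \<Longrightarrow> ?thesis" by blast
qed

lemma raw_mult_mono: "x < y \<Longrightarrow> 0 < z \<Longrightarrow> z * x < z * (y :: 'a::rca0_structure)"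
proof -
  assume "x < y"
  have "0 < z \<longrightarrow> z * x < z * y"
  proof (induction z rule: D0_induct)
    case (succ z)
    show ?case
    proof (cases "0 < z")
      case True
      then have "z * x + x < z * y + y"
        using succ \<open>x < y\<close> by (metis raw_add_commute raw_add_mono raw_less_trans)
      then show ?thesis by (simp add: raw_succ_mult)
    next
      case False
      then have "z = 0" using raw_zero_less by metis
      with \<open>x < y\<close> show ?thesis by (simp add: raw_zero_add raw_one_mult)
    qed
  qed (intro D0_intros, simp add: raw_less_irrefl)
  then show "0 < z \<Longrightarrow> ?thesis" by blast
qed

text \<open>Gives the later sections the library for ordered semirings; the Henkin model is shown to
  be an instance.\<close>

class rca0 = rca0_structure + linordered_semidom

lemma less_eq_henkin_model: "x \<le> y \<longleftrightarrow> (\<exists>z. y = x + z)" for x y :: henkin_model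
proof
  assume "x \<le> y"
  then show "\<exists>z. y = x + z" by (metis less_eq_henkin_model_def raw_add_zero raw_less_imp_add)
next
  assume "\<exists>z. y = x + z"
  then show "x \<le> y" by (metis less_eq_henkin_model_def raw_add_mono raw_add_zero raw_zero_less)
qed

lemma raw_add_left_cancel: "x + y = x + z \<longleftrightarrow> y = (z :: 'a::rca0_structure)"
  by (metis raw_add_mono raw_less_irrefl raw_linear)

instantiation henkin_model :: rca0
begin

text \<open>Truncated subtraction, which is no symbol of the language but belongs to
  \<open>linordered_semidom\<close>.\<close>

definition minus_henkin_model :: "henkin_model \<Rightarrow> henkin_model \<Rightarrow> henkin_model" where
  "x - y = (if y \<le> x then THE z. x = y + z else 0)" for x y :: henkin_model

instance
proof
  have add_diff: "(x + y) - x = y" for x y :: henkin_model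
    unfolding minus_henkin_model_def using less_eq_henkin_model by (auto simp: raw_add_left_cancel)
  have zero: "x - y = 0" if "x \<le> y" for x y :: henkin_model
  proof (cases "x = y")
    case True
    then show ?thesis using add_diff[of x 0] by (simp add: raw_add_zero)
  next
    case False
    with that have "\<not> y \<le> x" by (metis less_eq_henkin_model_def raw_less_irrefl raw_less_trans)
    then show ?thesis by (simp add: minus_henkin_model_def)
  qed
  have linear: "x \<le> y \<or> y \<le> x" for x y :: henkin_model
    by (metis raw_linear less_eq_henkin_model_def)
  fix a b c :: henkin_model
  show "a + b + c = a + (b + c)" by (rule raw_add_assoc)
  show "a + b = b + a" by (rule raw_add_commute)
  show "0 + a = a" by (rule raw_zero_add)
  show "a + b - a = b" by (rule add_diff)
  show "a - b - c = a - (b + c)"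
  proof (cases "b + c \<le> a")
    case True
    then obtain z where "a = b + c + z" by (metis less_eq_henkin_model)
    then show ?thesis by (metis raw_add_assoc add_diff)
  next
    case False
    have "a - b \<le> c"
    proof (cases "b \<le> a")
      case True
      then obtain w where w: "a = b + w" by (metis less_eq_henkin_model)
      have "\<not> c \<le> w" using False by (auto simp: less_eq_henkin_model w raw_add_assoc raw_add_left_cancel)
      then show ?thesis using linear w add_diff by metis
    next
      case False
      then show ?thesis using zero linear less_eq_henkin_model raw_zero_add by metis
    qed
    then show ?thesis using False zero linear by metis
  qed
  show "a * b * c = a * (b * c)" by (rule raw_mult_assoc)
  show "a * b = b * a" by (rule raw_mult_commute)
  show "1 * a = a" by (rule raw_one_mult)
  show "(a + b) * c = a * c + b * c" by (rule raw_distrib)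
  show "0 * a = 0" by (rule raw_zero_mult)
  show "a * 0 = 0" by (rule raw_mult_zero)
  show "(0 :: henkin_model) \<noteq> 1" by (metis raw_succ_neq_zero raw_zero_add)
  show *: "a \<noteq> 0 \<Longrightarrow> b \<noteq> 0 \<Longrightarrow> a * b \<noteq> 0"
    by (metis raw_less_irrefl raw_mult_mono raw_mult_zero raw_zero_less)
  have distrib: "d * (e + f) = d * e + d * f" for d e f :: henkin_model
    by (metis raw_distrib raw_mult_commute)
  then show "a * (b + c) = a * b + a * c" .
  show "a * (b - c) = a * b - a * c"
  proof (cases "c \<le> b")
    case True
    then obtain z where "b = c + z" by (metis less_eq_henkin_model)
    then show ?thesis by (simp add: add_diff distrib)
  next
    case False
    then have "b \<le> c" using linear by blast
    moreover from this obtain z where "c = b + z" by (metis less_eq_henkin_model)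
    then have "a * b \<le> a * c" by (auto simp: less_eq_henkin_model distrib)
    ultimately show ?thesis by (simp add: zero raw_mult_zero)
  qed
  show "a < b \<longleftrightarrow> a \<le> b \<and> \<not> b \<le> a"
    by (metis less_eq_henkin_model_def raw_less_irrefl raw_less_trans)
  show "a \<le> a" by (simp add: less_eq_henkin_model_def)
  show "a \<le> b \<Longrightarrow> b \<le> c \<Longrightarrow> a \<le> c" by (metis less_eq_henkin_model_def raw_less_trans)
  show "a \<le> b \<Longrightarrow> b \<le> a \<Longrightarrow> a = b" by (metis less_eq_henkin_model_def raw_less_irrefl raw_less_trans)
  show "a \<le> b \<or> b \<le> a" by (rule linear)
  show "a \<le> b \<Longrightarrow> c + a \<le> c + b" by (auto simp: less_eq_henkin_model raw_add_assoc)
  show "a < b \<Longrightarrow> 0 < c \<Longrightarrow> c * a < c * b" by (rule raw_mult_mono)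
  show "(0 :: henkin_model) < 1" by (metis raw_less_succ raw_zero_add)
  show "b \<le> a \<Longrightarrow> a - b + b = a" by (metis add_diff less_eq_henkin_model raw_add_commute)
qed

end

section \<open>Closure properties of Sigma01 predicates and the least number principle\<close>

lemma S1_subst: "S1 P \<Longrightarrow> (\<And>i. Tm (\<sigma> i)) \<Longrightarrow> S1 (\<lambda>e. P (\<lambda>i. \<sigma> i e))"
proof -
  assume "S1 P" and \<sigma>: "\<And>i. Tm (\<sigma> i)"
  then obtain Q where Q: "D0 (\<lambda>e. Q (\<lambda>i. e (Suc i)) (e 0))" "P = (\<lambda>e. \<exists>y. Q e y)"
    unfolding S1_def by blast
  let ?\<sigma> = "case_nat (\<lambda>e. e 0) (\<lambda>i e. \<sigma> i (\<lambda>i. e (Suc i)))"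
  have "Tm (?\<sigma> i)" for i
  proof (cases i)
    case (Suc j)
    have "Tm (\<lambda>e. \<sigma> j (\<lambda>i. (\<lambda>e. e (Suc i)) e))" by (rule Tm_subst[OF \<sigma>]) (rule Tm_var)
    with Suc show ?thesis by simp
  qed (simp add: Tm_var)
  from D0_subst[OF Q(1), of ?\<sigma>, OF this] show ?thesis unfolding Q(2) by (intro S1_ex) simp
qed

lemma less_add_one_iff: "x < y + 1 \<longleftrightarrow> x \<le> (y :: 'a::rca0)"
  by (metis raw_less_succ order.order_iff_strict)

lemma add_one_le_iff: "x + 1 \<le> y \<longleftrightarrow> x < (y :: 'a::rca0)"
  by (metis add_less_cancel_right less_add_one_iff)

lemma not_less_zero: "\<not> x < (0 :: 'a::rca0)"
  by (rule raw_not_less_zero)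

lemma zero_le: "0 \<le> (x :: 'a::rca0)"
  by (meson not_less_zero not_le)

lemma le_add: "x \<le> x + y" "x \<le> y + (x :: 'a::rca0)"
  using zero_le[of y] by simp_all

lemma le_iff_add_rca0: "x \<le> y \<longleftrightarrow> (\<exists>z. y = x + (z :: 'a::rca0))"
  by (metis add.right_neutral le_add(1) order.order_iff_strict raw_less_imp_add)

text \<open>Contraction of quantifiers: a single number above both witnesses replaces them, which
  leaves only bounded quantifiers behind the unbounded one.\<close>

lemma S1_exI:
  fixes P :: "(nat \<Rightarrow> 'a::rca0) \<Rightarrow> 'a \<Rightarrow> bool"
  assumes "S1 (\<lambda>e. P (\<lambda>i. e (Suc i)) (e 0))"
  shows "S1 (\<lambda>e. \<exists>x. P e x)"
proof -
  obtain Q where Q: "D0 (\<lambda>e. Q (\<lambda>i. e (Suc i)) (e 0))" "(\<lambda>e. P (\<lambda>i. e (Suc i)) (e 0)) = (\<lambda>e. \<exists>y. Q e y)"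
    using assms unfolding S1_def by blast
  have P: "P e x \<longleftrightarrow> (\<exists>y. Q (case_nat x e) y)" for e x
    using fun_cong[OF Q(2), of "case_nat x e"] by simp
  have "(\<exists>x. P e x) \<longleftrightarrow> (\<exists>z x. x < z \<and> (\<exists>y. y < z \<and> Q (case_nat x e) y))" for e
  proof
    assume "\<exists>x. P e x"
    then obtain x y where "Q (case_nat x e) y" using P by blast
    moreover have "x < x + y + 1" "y < x + y + 1" by (simp_all add: less_add_one_iff zero_le)
    ultimately show "\<exists>z x. x < z \<and> (\<exists>y. y < z \<and> Q (case_nat x e) y)" by blast
  qed (use P in blast)
  moreover have "S1 (\<lambda>e. \<exists>z x. x < z \<and> (\<exists>y. y < z \<and> Q (case_nat x e) y))"
  proof (intro S1_ex D0_bex Tm_var)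
    \<comment> \<open>The environment now begins with \<open>y\<close>, \<open>x\<close>,
      \<open>z\<close>; as \<open>Q\<close> knows nothing of the bound \<open>z\<close>, index 2 is
      skipped.\<close>
    let ?r = "case_nat (0::nat) (case_nat 1 (\<lambda>i. i + 3))"
    have "D0 (\<lambda>e. Q (\<lambda>i. e (?r (Suc i))) (e (?r 0)))" by (rule D0_rename[OF Q(1)])
    moreover have "(\<lambda>i. e (?r (Suc i))) = case_nat (e (Suc 0)) (\<lambda>i. e (Suc (Suc (Suc i))))" for e :: "nat \<Rightarrow> 'a"
      by (rule ext) (simp add: numeral_3_eq_3 split: nat.split)
    ultimately show "D0 (\<lambda>e. Q (case_nat (e (Suc 0)) (\<lambda>i. e (Suc (Suc (Suc i))))) (e 0))" by simp
  qed
  ultimately show ?thesis by simp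
qed

lemma S1_conj:
  fixes P Q :: "(nat \<Rightarrow> 'a::rca0) \<Rightarrow> bool"
  assumes "S1 P" "S1 Q" shows "S1 (\<lambda>e. P e \<and> Q e)"
proof -
  obtain P' where P': "D0 (\<lambda>e. P' (\<lambda>i. e (Suc i)) (e 0))" "P = (\<lambda>e. \<exists>y. P' e y)"
    using assms(1) unfolding S1_def by blast
  obtain Q' where Q': "D0 (\<lambda>e. Q' (\<lambda>i. e (Suc i)) (e 0))" "Q = (\<lambda>e. \<exists>y. Q' e y)"
    using assms(2) unfolding S1_def by blast
  have "S1 (\<lambda>e. \<exists>y z. P' e y \<and> Q' e z)"
    using D0_rename[OF P'(1), of Suc] D0_rename[OF Q'(1), of "case_nat 0 (\<lambda>i. Suc (Suc i))"]
    by (intro S1_exI S1_ex D0_conj) simp_all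
  then show ?thesis unfolding P' Q' by simp
qed

lemma S1_disj:
  fixes P Q :: "(nat \<Rightarrow> 'a::rca0) \<Rightarrow> bool"
  assumes "S1 P" "S1 Q" shows "S1 (\<lambda>e. P e \<or> Q e)"
proof -
  obtain P' where P': "D0 (\<lambda>e. P' (\<lambda>i. e (Suc i)) (e 0))" "P = (\<lambda>e. \<exists>y. P' e y)"
    using assms(1) unfolding S1_def by blast
  obtain Q' where Q': "D0 (\<lambda>e. Q' (\<lambda>i. e (Suc i)) (e 0))" "Q = (\<lambda>e. \<exists>y. Q' e y)"
    using assms(2) unfolding S1_def by blast
  have "S1 (\<lambda>e. \<exists>y. P' e y \<or> Q' e y)"
    using P'(1) Q'(1) by (intro S1_ex D0_disj)
  then show ?thesis unfolding P' Q' by (simp add: ex_disj_distrib)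
qed

text \<open>The usual strong induction on the negation of \<open>P\<close> would be on a Pi01
  predicate. Instead, if \<open>P\<close> has no least element, then for each \<open>z\<close> one
  can descend \<open>z\<close> times from \<open>a\<close>, so that some \<open>w\<close> in
  \<open>P\<close> has \<open>w + z \<le> a\<close>. This is Sigma01 in \<open>z\<close> and fails
  for \<open>z = a + 1\<close>.\<close>

lemma Sigma1_least:
  fixes P :: "'a::rca0 \<Rightarrow> bool"
  assumes "S1 (\<lambda>e. P (e 0))" "P a"
  shows "\<exists>x. P x \<and> (\<forall>y. y < x \<longrightarrow> \<not> P y)"
proof (rule ccontr)
  assume "\<not> ?thesis"
  then have descent: "\<exists>y<x. P y" if "P x" for x using that by blast
  have "\<exists>w. w + z < a + 1 \<and> P w" for z
  proof (induction z rule: Sigma1_induct[case_names S1 zero succ])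
    case S1
    show ?case
      using assms(1) by (intro S1_exI S1_conj; (assumption | intro S1_D0 D0_intros))
  next
    case zero
    show ?case using assms(2) by (intro exI[of _ a]) (simp add: less_add_one_iff)
  next
    case (succ z)
    then obtain w where w: "w + z < a + 1" "P w" by blast
    then obtain w' where "w' < w" "P w'" using descent by blast
    moreover from this have "w' + 1 + z \<le> w + z" by (simp add: add_one_le_iff)
    then have "w' + (z + 1) \<le> w + z" by (simp add: add_ac)
    then have "w' + (z + 1) < a + 1" using w(1) by (rule le_less_trans)
    ultimately show ?case by blast
  qed
  from this[of "a + 1"] obtain w where "w + (a + 1) < a + 1" by blast
  then show False using leD[OF le_add(2)] by blast
qed

lemma D0_comprehension: "D0 (\<lambda>e. P (e 0)) \<Longrightarrow> {x :: 'a::rca0. P x} \<in> Sets"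
  by (intro Delta1_comprehension S1_D0 D0_not)


section \<open>Coding of finite sets\<close>

definition code_pair :: "'a::rca0 \<Rightarrow> 'a \<Rightarrow> 'a" where
  "code_pair x y = (x + y) * (x + y) + x"

lemma Tm_code_pair: "Tm f \<Longrightarrow> Tm g \<Longrightarrow> Tm (\<lambda>e. code_pair (f e) (g e))"
  unfolding code_pair_def by (intro Tm.intros)

lemma mult_le_self: "y \<le> x * y" if "0 < (x :: 'a::rca0)"
  using that mult_right_mono[of 1 x y] add_one_le_iff[of 0 x] zero_le[of y] by simp

lemma code_pair_ge: "x \<le> code_pair x y" "y \<le> code_pair x (y :: 'a::rca0)"
proof -
  show "x \<le> code_pair x y" by (simp add: code_pair_def zero_le)
  have "y \<le> (x + y) * (x + y)"
  proof (cases "y = 0")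
    case False
    then have "0 < x + y" using zero_le[of x] zero_le[of y] by (simp add: add_nonneg_pos order.order_iff_strict)
    then have "x + y \<le> (x + y) * (x + y)" by (rule mult_le_self)
    then show ?thesis using le_add(2)[of y x] by (rule order.trans[rotated])
  qed (simp add: zero_le)
  then show "y \<le> code_pair x y" unfolding code_pair_def by (rule order.trans) (simp add: zero_le)
qed

text \<open>The codes of the pairs with sum \<open>s\<close> lie between \<open>s * s\<close> and
  \<open>s * s + s\<close>, which is below \<open>(s + 1) * (s + 1)\<close>. Hence the code
  determines the sum, and then the first component.\<close>

lemma code_pair_inject: "code_pair x y = code_pair x' y' \<longleftrightarrow> x = x' \<and> y = (y' :: 'a::rca0)"
proof
  have less: "code_pair x y < code_pair x' y'" if "x + y < x' + y'" for x y x' y' :: 'a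
  proof -
    have "code_pair x y \<le> (x + y) * (x + y) + (x + y)" by (simp add: code_pair_def zero_le)
    also have "\<dots> < (x + y + 1) * (x + y + 1)"
    proof -
      have "(s + 1) * (s + 1) = s * s + s + s + 1" for s :: 'a by (simp add: algebra_simps)
      then show ?thesis by (simp only: less_add_one_iff le_add)
    qed
    also have "\<dots> \<le> (x' + y') * (x' + y')"
      using that by (intro mult_mono) (simp_all add: add_one_le_iff zero_le)
    also have "\<dots> \<le> code_pair x' y'" by (simp add: code_pair_def zero_le)
    finally show ?thesis .
  qed
  assume *: "code_pair x y = code_pair x' y'"
  then have "x + y = x' + y'" using less[of x y x' y'] less[of x' y' x y] by (metis less_irrefl linorder_neqE)
  with * show "x = x' \<and> y = y'" by (auto simp: code_pair_def)
qed simp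

definition elem_code :: "'a::rca0 \<Rightarrow> 'a \<Rightarrow> bool" where
  "elem_code i a \<longleftrightarrow> (\<exists>k. k < a + 1 \<and> (\<exists>m. m < a + 1 \<and> (\<exists>n. n < a + 1 \<and>
     a = code_pair k (code_pair m n) \<and> i < k \<and> (\<exists>q. q < n + 1 \<and> n = (m * (i + 1) + 1) * q))))"

lemma D0_comp2:
  assumes "D0 (\<lambda>e. P (e 0) (e 1))" "Tm f" "Tm g" shows "D0 (\<lambda>e. P (f e) (g e))"
proof -
  have "Tm (case_nat f (\<lambda>_. g) i)" for i using assms by (cases i) auto
  from D0_subst[OF assms(1), of "case_nat f (\<lambda>_. g)", OF this] show ?thesis by simp
qed

lemma D0_elem_code: "Tm f \<Longrightarrow> Tm g \<Longrightarrow> D0 (\<lambda>e. elem_code (f e) (g e))"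
  by (rule D0_comp2) (unfold elem_code_def, intro D0_intros Tm_code_pair)

lemma dvd_iff_bounded: "d dvd n \<longleftrightarrow> (\<exists>q. q < n + 1 \<and> n = d * (q :: 'a::rca0))"
proof
  assume "d dvd n"
  then obtain q where q: "n = d * q" by (elim dvdE)
  show "\<exists>q. q < n + 1 \<and> n = d * q"
  proof (cases "d = 0")
    case True
    with q show ?thesis by (intro exI[of _ 0]) simp
  next
    case False
    then have "q \<le> n" using zero_le[of d] q mult_le_self[of d q] by (simp add: order.order_iff_strict)
    with q show ?thesis by (auto simp: less_add_one_iff)
  qed
qed auto

lemma D0_dvd:
  fixes f g :: "(nat \<Rightarrow> 'a::rca0) \<Rightarrow> 'a"
  shows "Tm f \<Longrightarrow> Tm g \<Longrightarrow> D0 (\<lambda>e. f e dvd g e)"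
  by (rule D0_comp2) (unfold dvd_iff_bounded, intro D0_intros)

lemma elem_code_iff: "elem_code i (code_pair k (code_pair m n)) \<longleftrightarrow> i < k \<and> m * (i + 1) + 1 dvd n"
  (is "_ \<longleftrightarrow> ?rhs")
proof
  assume "elem_code i (code_pair k (code_pair m n))"
  then show ?rhs unfolding elem_code_def dvd_iff_bounded by (auto simp: code_pair_inject)
next
  let ?a = "code_pair k (code_pair m n)"
  have "k \<le> ?a" "code_pair m n \<le> ?a" by (rule code_pair_ge)+
  moreover from this have "m \<le> ?a" "n \<le> ?a" using code_pair_ge[of m n] code_pair_ge[of n m] order.trans by blast+
  moreover assume ?rhs
  ultimately show "elem_code i ?a" unfolding elem_code_def dvd_iff_bounded less_add_one_iff by blast
qed

lemma elem_code_less: "elem_code i a \<Longrightarrow> i < (a :: 'a::rca0)"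
  unfolding elem_code_def less_add_one_iff by (blast intro: order.strict_trans2)

text \<open>Stands in for the factorial. Recursion is not yet available, as it will itself be
  derived from the coding, but the existence of a multiple is Sigma01 and can be proved by
  induction.\<close>

lemma common_multiple: "\<exists>m. 0 < m \<and> (\<forall>d. d < k \<longrightarrow> d + 1 dvd (m :: 'a::rca0))"
proof (induction k rule: Sigma1_induct[case_names S1 zero succ])
  case S1 show ?case by (intro S1_ex D0_intros D0_dvd)
next
  case zero show ?case by (auto simp: not_less_zero intro: exI[of _ 1])
next
  case (succ k)
  then obtain m where m: "0 < m" "\<And>d. d < k \<Longrightarrow> d + 1 dvd m" by blast
  have "0 < k + 1" by (simp add: less_add_one_iff zero_le)
  with m(1) have "0 < m * (k + 1)" by (rule mult_pos_pos)
  moreover have "d + 1 dvd m * (k + 1)" if "d < k + 1" for d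
    using that m(2)[of d] by (auto simp: raw_less_succ)
  ultimately show ?case by blast
qed

text \<open>
  Bezout: for \<open>a = b + d\<close> and \<open>m = d * w\<close>, the moduli \<open>p = m * a + 1\<close> and \<open>q = m * b + 1\<close> satisfy
  \<open>a * q = b * p + d\<close>, hence \<open>p * (1 + a * b * w) = a * a * w * q + 1\<close>.
\<close>

lemma moduli_coprime:
  fixes b d w :: "'a::rca0"
  defines "p \<equiv> d * w * (b + d) + 1" and "q \<equiv> d * w * b + 1"
  shows "p dvd n * q \<Longrightarrow> p dvd n" "q dvd n * p \<Longrightarrow> q dvd n"
proof -
  have "p * (1 + (b + d) * b * w) = (b + d) * (b + d) * w * q + 1"
    by (simp add: p_def q_def algebra_simps)
  from arg_cong[OF this, of "\<lambda>x. n * x"]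
  have *: "p * (n * (1 + (b + d) * b * w)) = (b + d) * (b + d) * w * (n * q) + n" and
    **: "(n * p) * (1 + (b + d) * b * w) = q * ((b + d) * (b + d) * w * n) + n"
    by (simp_all add: algebra_simps)
  show "p dvd n" if "p dvd n * q"
    using that dvd_triv_left[of p "n * (1 + (b + d) * b * w)"] unfolding * by (simp add: dvd_add_right_iff)
  show "q dvd n" if "q dvd n * p"
    using dvd_mult2[OF that, of "1 + (b + d) * b * w"] unfolding ** by (simp add: dvd_add_right_iff)
qed

text \<open>The difference of two distinct indices below \<open>k\<close> has the form
  \<open>d + 1\<close> with \<open>d < k\<close>, hence divides \<open>m\<close>; this is the
  factorization that the Bezout identity asks for.\<close>

lemma moduli_coprime':
  fixes i j k m n :: "'a::rca0"
  assumes m: "\<And>d. d < k \<Longrightarrow> d + 1 dvd m" and "i < k" "j < k" "i \<noteq> j"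
    and dvd: "m * (i + 1) + 1 dvd n * (m * (j + 1) + 1)"
  shows "m * (i + 1) + 1 dvd n"
proof -
  have diff: "\<exists>d w. x = y + d \<and> m = d * w" if "y < x" "x < k" for x y
  proof -
    obtain d where d: "x = y + 1 + d" using \<open>y < x\<close> add_one_le_iff[of y x] le_iff_add_rca0 by blast
    have "d < k" using le_less_trans[OF le_add(2)[of d "y + 1"]] \<open>x < k\<close> unfolding d .
    then obtain w where "m = (d + 1) * w" using m by blast
    with d show ?thesis by (intro exI[of _ "d + 1"] exI[of _ w]) (simp add: add_ac)
  qed
  from \<open>i \<noteq> j\<close> consider "i < j" | "j < i" by (rule linorder_neqE)
  then show ?thesis
  proof cases
    case 1
    then obtain d w where dw: "j = i + d" "m = d * w" using diff \<open>j < k\<close> by blast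
    then have "m * (j + 1) + 1 = d * w * (i + 1 + d) + 1" by (simp add: add_ac)
    with dvd show ?thesis unfolding dw(2) using moduli_coprime(2)[of d w "i + 1" n] by simp
  next
    case 2
    then obtain d w where dw: "i = j + d" "m = d * w" using diff \<open>i < k\<close> by blast
    then have "m * (i + 1) + 1 = d * w * (j + 1 + d) + 1" by (simp add: add_ac)
    with dvd show ?thesis unfolding dw(2) using moduli_coprime(1)[of d w "j + 1" n] by simp
  qed
qed

text \<open>The number \<open>n\<close> is the product of the moduli \<open>m * (i + 1) + 1\<close>
  over the elements \<open>i\<close>; by coprimality no other modulus with \<open>i < k\<close>
  divides it. The product grows along \<open>j\<close> while \<open>k\<close> and \<open>m\<close>
  stay fixed, and its existence is a Sigma01 statement about \<open>j\<close>.\<close>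

lemma ex_finite_set_code:
  fixes k :: "'a::rca0"
  assumes "Y \<in> Sets" shows "\<exists>a. \<forall>i. elem_code i a \<longleftrightarrow> i < k \<and> i \<in> Y"
proof -
  obtain m where "0 < m" and m: "\<And>d. d < k \<Longrightarrow> d + 1 dvd m" using common_multiple[of k] by blast
  have "\<exists>n. \<forall>i. i < k \<longrightarrow> (m * (i + 1) + 1 dvd n \<longleftrightarrow> i < j \<and> i \<in> Y)" for j
  proof (induction j rule: Sigma1_induct[case_names S1 zero succ])
    case S1 show ?case using assms by (intro S1_ex D0_intros D0_dvd)
  next
    case zero
    have "\<not> m * (i + 1) + 1 dvd 1" for i
    proof
      assume "m * (i + 1) + 1 dvd 1"
      then obtain q where q: "1 = (m * (i + 1) + 1) * q" by (elim dvdE)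
      have "0 < m * (i + 1)" using \<open>0 < m\<close> by (intro mult_pos_pos) (simp_all add: less_add_one_iff zero_le)
      moreover have "q \<noteq> 0" using q by auto
      then have "m * (i + 1) + 1 \<le> 1"
        using mult_le_self[of q "m * (i + 1) + 1"] zero_le[of q] q by (simp add: mult.commute order.order_iff_strict)
      ultimately show False by simp
    qed
    then show ?case by (intro exI[of _ 1]) (simp add: not_less_zero)
  next
    case (succ j)
    then obtain n where n: "\<And>i. i < k \<Longrightarrow> m * (i + 1) + 1 dvd n \<longleftrightarrow> i < j \<and> i \<in> Y" by blast
    show ?case
    proof (cases "j < k \<and> j \<in> Y")
      case True
      have "m * (i + 1) + 1 dvd n * (m * (j + 1) + 1) \<longleftrightarrow> i < j + 1 \<and> i \<in> Y" if "i < k" for i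
      proof (cases "i = j")
        case True
        then show ?thesis using \<open>j < k \<and> j \<in> Y\<close> by (simp add: less_add_one_iff)
      next
        case False
        then have "m * (i + 1) + 1 dvd n * (m * (j + 1) + 1) \<longleftrightarrow> m * (i + 1) + 1 dvd n"
          using moduli_coprime'[of k m i j n] m that True by (blast intro: dvd_mult2)
        with n[OF that] False show ?thesis by (simp add: raw_less_succ)
      qed
      then show ?thesis by blast
    next
      case False
      with n have "m * (i + 1) + 1 dvd n \<longleftrightarrow> i < j + 1 \<and> i \<in> Y" if "i < k" for i
        using that by (auto simp: raw_less_succ)
      then show ?thesis by blast
    qed
  qed
  then obtain n where "\<And>i. i < k \<Longrightarrow> m * (i + 1) + 1 dvd n \<longleftrightarrow> i < k \<and> i \<in> Y" by blast
  then have "elem_code i (code_pair k (code_pair m n)) \<longleftrightarrow> i < k \<and> i \<in> Y" for i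
    unfolding elem_code_iff by blast
  then show ?thesis by blast
qed

section \<open>Functions with Sigma01 graph, and iteration\<close>

lemma S1_comp2:
  assumes "S1 (\<lambda>e. P (e 0) (e 1))" "Tm f" "Tm g" shows "S1 (\<lambda>e. P (f e) (g e))"
proof -
  have "Tm (case_nat f (\<lambda>_. g) i)" for i using assms by (cases i) auto
  from S1_subst[OF assms(1), of "case_nat f (\<lambda>_. g)", OF this] show ?thesis by simp
qed

text \<open>The graph of a total function is Delta01 once it is Sigma01: a number lies outside if it
  is not a pair, which is a bounded condition, or if the function takes another value at its first
  component.\<close>

lemma function_graph_in_Sets:
  fixes f :: "'a::rca0 \<Rightarrow> 'a"
  assumes "S1 (\<lambda>e. f (e 0) = e 1)"
  shows "{code_pair n (f n) | n. True} \<in> Sets"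
proof -
  have f: "Tm t \<Longrightarrow> Tm u \<Longrightarrow> S1 (\<lambda>e. f (t e) = u e)" for t u :: "(nat \<Rightarrow> 'a) \<Rightarrow> 'a"
    using assms by (rule S1_comp2)
  have "{p. \<exists>n y. f n = y \<and> p = code_pair n y} \<in> Sets"
  proof (rule Delta1_comprehension)
    show "S1 (\<lambda>e. \<exists>n y. f n = y \<and> e 0 = code_pair n y)"
      by (intro S1_exI S1_conj f; intro S1_D0 D0_intros Tm_code_pair)
    have "(\<not> (\<exists>n y. f n = y \<and> p = code_pair n y)) \<longleftrightarrow>
      (\<forall>n. n < p + 1 \<longrightarrow> (\<forall>y. y < p + 1 \<longrightarrow> p \<noteq> code_pair n y)) \<or>
      (\<exists>n y z. f n = y \<and> p = code_pair n z \<and> y \<noteq> z)" for p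
      unfolding less_add_one_iff by (metis code_pair_ge code_pair_inject)
    moreover have "S1 (\<lambda>e. (\<forall>n. n < e 0 + 1 \<longrightarrow> (\<forall>y. y < e 0 + 1 \<longrightarrow> e 0 \<noteq> code_pair n y)) \<or>
      (\<exists>n y z. f n = y \<and> e 0 = code_pair n z \<and> y \<noteq> z))"
      by (intro S1_disj S1_exI S1_conj f; intro S1_D0 D0_intros Tm_code_pair)
    ultimately show "S1 (\<lambda>e. \<not> (\<exists>n y. f n = y \<and> e 0 = code_pair n y))" by simp
  qed
  moreover have "{p. \<exists>n y. f n = y \<and> p = code_pair n y} = {code_pair n (f n) | n. True}" by auto
  ultimately show ?thesis by simp
qed

lemma iteration:
  fixes g :: "'a::rca0 \<Rightarrow> 'a"
  assumes g: "D0 (\<lambda>e. g (e 0) = e 1)"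
  shows "\<exists>h. h 0 = a \<and> (\<forall>n. h (n + 1) = g (h n)) \<and> S1 (\<lambda>e. h (e 0) = e 1)"
proof -
  define approx where "approx c \<longleftrightarrow> (\<forall>i. i < c \<longrightarrow> (\<forall>u. u < c \<longrightarrow> elem_code (code_pair i u) c \<longrightarrow>
     i = 0 \<and> u = a \<or> (\<exists>j. j < c \<and> (\<exists>v. v < c \<and> i = j + 1 \<and> elem_code (code_pair j v) c \<and> g v = u))))" for c
  define R where "R n y \<longleftrightarrow> (\<exists>c. approx c \<and> elem_code (code_pair n y) c)" for n y
  have g': "Tm t \<Longrightarrow> Tm u \<Longrightarrow> D0 (\<lambda>e. g (t e) = u e)" for t u :: "(nat \<Rightarrow> 'a) \<Rightarrow> 'a"
    using g by (rule D0_comp2)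
  have approx_D0: "D0 (\<lambda>e. approx (e 0))"
    unfolding approx_def by (intro D0_ball D0_bex D0_imp D0_disj D0_conj D0_elem_code g'; intro D0_intros Tm_code_pair D0_elem_code)
  have approx': "Tm t \<Longrightarrow> D0 (\<lambda>e. approx (t e))" for t
    using D0_comp2[of "\<lambda>x y. approx x" t t] approx_D0 by simp
  have R: "S1 (\<lambda>e. R (e 0) (e 1))"
    unfolding R_def by (intro S1_ex D0_conj approx' D0_elem_code; intro Tm.intros Tm_code_pair)
  then have R': "Tm t \<Longrightarrow> Tm u \<Longrightarrow> S1 (\<lambda>e. R (t e) (u e))" for t u
    by (rule S1_comp2)
  have below: "i < c \<and> u < c" if "elem_code (code_pair i u) c" for i u c :: 'a
    using elem_code_less[OF that] code_pair_ge[of i u] code_pair_ge[of u i] by (auto intro: le_less_trans code_pair_ge)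
  have approx_iff: "approx c \<longleftrightarrow> (\<forall>i u. elem_code (code_pair i u) c \<longrightarrow>
     i = 0 \<and> u = a \<or> (\<exists>j v. i = j + 1 \<and> elem_code (code_pair j v) c \<and> g v = u))" for c
    unfolding approx_def by (meson below)
  have unique: "u = u'" if c: "approx c" "approx c'" and u: "elem_code (code_pair n u) c" "elem_code (code_pair n u') c'"
    for c c' n u u'
  proof -
    \<comment> \<open>Both values are bounded by the codes containing them, so the induction
      predicate is Sigma00 although it must speak of all values.\<close>
    have "\<forall>u. u < c \<longrightarrow> (\<forall>u'. u' < c' \<longrightarrow> elem_code (code_pair n u) c \<longrightarrow> elem_code (code_pair n u') c' \<longrightarrow> u = u')"
    proof (induction n rule: D0_induct)
      case D0 show ?case by (intro D0_intros D0_elem_code Tm_code_pair)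
    next
      case zero
      have "u = a" if "approx c" "elem_code (code_pair 0 u) c" for c u
      proof -
        have "u = a \<or> (\<exists>j v. 0 = j + 1 \<and> elem_code (code_pair j v) c \<and> g v = u)"
          using that unfolding approx_iff by blast
        then show ?thesis using raw_succ_neq_zero by metis
      qed
      then show ?case using c by blast
    next
      case (succ n)
      have *: "\<exists>v. elem_code (code_pair n v) c \<and> g v = u" if "approx c" "elem_code (code_pair (n + 1) u) c" for c u
      proof -
        have "\<exists>j v. n + 1 = j + 1 \<and> elem_code (code_pair j v) c \<and> g v = u"
          using that raw_succ_neq_zero[of n] unfolding approx_iff by blast
        then show ?thesis using raw_succ_inj by blast
      qed
      show ?case
      proof (intro allI impI)
        fix u u' assume "elem_code (code_pair (n + 1) u) c" "elem_code (code_pair (n + 1) u') c'"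
        then obtain v v' where v: "elem_code (code_pair n v) c" "g v = u" "elem_code (code_pair n v') c'" "g v' = u'"
          using * c by blast
        then have "v = v'" using succ below by blast
        with v show "u = u'" by simp
      qed
    qed
    then show ?thesis using u below by blast
  qed
  have R_unique: "y = y'" if "R n y" "R n y'" for n y y'
    using that unique unfolding R_def by blast
  have extend: "\<exists>c'. \<forall>i. elem_code i c' \<longleftrightarrow> elem_code i c \<or> i = p" for c p :: 'a
  proof -
    have "{i. elem_code i c \<or> i = p} \<in> Sets" by (intro D0_comprehension D0_disj D0_elem_code D0_eq Tm.intros)
    \<comment> \<open>The bound \<open>c + p + 1\<close> exceeds \<open>p\<close> and every element
      of \<open>c\<close>, so nothing is cut off.\<close>
    then obtain c' where "\<And>i. elem_code i c' \<longleftrightarrow> i < c + p + 1 \<and> (elem_code i c \<or> i = p)"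
      using ex_finite_set_code[of _ "c + p + 1"] by blast
    moreover have "i < c + p + 1" if "elem_code i c \<or> i = p" for i
      using that elem_code_less[of i c] le_add(1)[of c p] le_add(2)[of p c]
      unfolding less_add_one_iff by (meson order.trans order.strict_implies_order)
    ultimately show ?thesis by blast
  qed
  have R_0: "R 0 a"
  proof -
    have "\<not> elem_code i 0" for i :: 'a using elem_code_less[of i 0] not_less_zero by blast
    with extend[of 0 "code_pair 0 a"] obtain c where "\<And>i. elem_code i c \<longleftrightarrow> i = code_pair 0 a" by blast
    then have "approx c" "elem_code (code_pair 0 a) c" by (auto simp: approx_iff code_pair_inject)
    then show ?thesis unfolding R_def by blast
  qed
  have R_step: "R (n + 1) (g y)" if "R n y" for n y
  proof -
    obtain c where c: "approx c" "elem_code (code_pair n y) c" using \<open>R n y\<close> unfolding R_def by blast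
    obtain c' where c': "\<And>i. elem_code i c' \<longleftrightarrow> elem_code i c \<or> i = code_pair (n + 1) (g y)"
      using extend[of c "code_pair (n + 1) (g y)"] by blast
    have "approx c'" unfolding approx_iff
    proof (intro allI impI)
      fix i u assume "elem_code (code_pair i u) c'"
      then consider "elem_code (code_pair i u) c" | "i = n + 1" "u = g y" by (auto simp: c' code_pair_inject)
      then show "i = 0 \<and> u = a \<or> (\<exists>j v. i = j + 1 \<and> elem_code (code_pair j v) c' \<and> g v = u)"
      proof cases
        case 1
        with c(1) show ?thesis unfolding approx_iff c' by blast
      next
        case 2
        with c(2) show ?thesis unfolding c' by blast
      qed
    qed
    then show ?thesis using c' unfolding R_def by blast
  qed
  have R_total: "\<exists>y. R n y" for n
  proof (induction n rule: Sigma1_induct[case_names S1 zero succ])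
    case S1 show ?case by (intro S1_exI R' Tm.intros)
  qed (use R_0 R_step in blast)+
  define h where "h n = (THE y. R n y)" for n
  have h: "h n = y \<longleftrightarrow> R n y" for n y
    unfolding h_def using R_total R_unique by (metis the_equality)
  have "R n (h n)" for n using h by blast
  then have "h 0 = a" "h (n + 1) = g (h n)" for n using R_0 R_step h by blast+
  moreover have "S1 (\<lambda>e. h (e 0) = e 1)" using R by (simp add: h)
  ultimately show ?thesis by blast
qed


section \<open>The descent argument\<close>

text \<open>Both ways for \<open>t'\<close> to be lexicographically below \<open>t\<close> in one:
  if \<open>t'\<close> ends at \<open>j\<close>, the last clause is vacuous; otherwise the entry of
  \<open>t'\<close> there is smaller. Lengths are never mentioned.\<close>

definition first_diff :: "'a::rca0 set \<Rightarrow> 'a \<Rightarrow> 'a \<Rightarrow> 'a \<Rightarrow> 'a \<Rightarrow> bool" where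
  "first_diff X t t' j x \<longleftrightarrow> elem_code (code_pair j x) t \<and>
     (\<forall>i. i < j \<longrightarrow> (\<forall>u. elem_code (code_pair i u) t \<longleftrightarrow> elem_code (code_pair i u) t')) \<and>
     (\<forall>y. elem_code (code_pair j y) t' \<longrightarrow> code_pair y x \<in> X \<and> y \<noteq> x)"

lemma elem_code_pair_less: "elem_code (code_pair i u) c \<Longrightarrow> i < c \<and> u < (c :: 'a::rca0)"
  using elem_code_less[of "code_pair i u" c] code_pair_ge by (auto intro: le_less_trans code_pair_ge)

lemma D0_first_diff:
  assumes "X \<in> Sets" "Tm f" "Tm f'" "Tm g" "Tm k"
  shows "D0 (\<lambda>e. first_diff X (f e) (f' e) (g e) (k e))"
proof -
  have *: "first_diff X t t' j x \<longleftrightarrow> elem_code (code_pair j x) t \<and>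
     (\<forall>i. i < j \<longrightarrow> (\<forall>u. u < t + t' \<longrightarrow> (elem_code (code_pair i u) t \<longleftrightarrow> elem_code (code_pair i u) t'))) \<and>
     (\<forall>y. y < t' \<longrightarrow> elem_code (code_pair j y) t' \<longrightarrow> code_pair y x \<in> X \<and> y \<noteq> x)" for t t' j x
  proof -
    have "u < t + t'" if "elem_code (code_pair i u) t \<or> elem_code (code_pair i u) t'" for i u
      using that elem_code_pair_less[of i u t] elem_code_pair_less[of i u t'] le_add(1)[of t t'] le_add(2)[of t' t]
      by (auto intro: less_le_trans)
    then have "(\<forall>u. u < t + t' \<longrightarrow> (elem_code (code_pair i u) t \<longleftrightarrow> elem_code (code_pair i u) t')) \<longleftrightarrow>
        (\<forall>u. elem_code (code_pair i u) t \<longleftrightarrow> elem_code (code_pair i u) t')" for i by blast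
    moreover have "(\<forall>y. y < t' \<longrightarrow> elem_code (code_pair j y) t' \<longrightarrow> code_pair y x \<in> X \<and> y \<noteq> x) \<longleftrightarrow>
        (\<forall>y. elem_code (code_pair j y) t' \<longrightarrow> code_pair y x \<in> X \<and> y \<noteq> x)"
      using elem_code_pair_less by blast
    ultimately show ?thesis unfolding first_diff_def by simp
  qed
  have 1: "D0 (\<lambda>e. first_diff X (e 0) (e 1) (e 2) (e 3))"
    unfolding * using assms(1) by (intro D0_intros D0_elem_code Tm_code_pair)
  let ?\<sigma> = "case_nat f (case_nat f' (case_nat g (\<lambda>_. k)))"
  have "Tm (?\<sigma> i)" for i using assms(2-) by (auto split: nat.split)
  from D0_subst[OF 1, of ?\<sigma>, OF this] show ?thesis by (simp add: numeral_2_eq_2 numeral_3_eq_3)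
qed


lemma first_diff_unique:
  fixes t t' :: "'a::rca0"
  assumes "\<And>i x y. elem_code (code_pair i x) t \<Longrightarrow> elem_code (code_pair i y) t \<Longrightarrow> x = y"
    and "first_diff X t t' j x" "first_diff X t t' j' x'"
  shows "j = j' \<and> x = x'"
proof -
  have False if "first_diff X t t' j x" "first_diff X t t' j' x'" "j < j'" for j x j' x'
    using that unfolding first_diff_def by blast
  then have "j = j'" using assms(2,3) by (metis linorder_neqE)
  with assms show ?thesis unfolding first_diff_def by blast
qed

text \<open>The combinatorial core, inside a model. Strings enter as finite partial functions with
  downward closed domain, and Ramsey's theorem as a hypothesis on the sets of the model. The result
  \<open>f\<close> is delivered with a Sigma01 graph, ready for comprehension.\<close>

lemma descent:
  fixes s :: "'a::rca0 \<Rightarrow> 'a" and X :: "'a set"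
  assumes s: "D0 (\<lambda>e. s (e 0) = e 1)"
    and X: "X \<in> Sets" and trans: "\<And>x y z. code_pair x y \<in> X \<Longrightarrow> code_pair y z \<in> X \<Longrightarrow> code_pair x z \<in> X"
    and antisym: "\<And>x y. code_pair x y \<in> X \<Longrightarrow> code_pair y x \<in> X \<Longrightarrow> x = y"
    and functional: "\<And>n i x y. elem_code (code_pair i x) (s n) \<Longrightarrow> elem_code (code_pair i y) (s n) \<Longrightarrow> x = y"
    and closed: "\<And>n i j x. elem_code (code_pair i x) (s n) \<Longrightarrow> j < i \<Longrightarrow> \<exists>y. elem_code (code_pair j y) (s n)"
    and field: "\<And>n i x. elem_code (code_pair i x) (s n) \<Longrightarrow> code_pair x x \<in> X"
    and noninc: "\<And>n i x y. elem_code (code_pair i x) (s n) \<Longrightarrow> elem_code (code_pair (i + 1) y) (s n) \<Longrightarrow> code_pair y x \<in> X"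
    and descending: "\<And>n. \<exists>j x. first_diff X (s n) (s (n + 1)) j x"
    and RT: "\<And>C :: 'a set. C \<in> Sets \<Longrightarrow>
       (\<And>p. p \<in> C \<Longrightarrow> \<exists>i j k c. i < j \<and> j < k \<and> c < 1 + 1 \<and> p = code_pair (code_pair (code_pair i j) k) c) \<Longrightarrow>
       (\<And>i j k. i < j \<Longrightarrow> j < k \<Longrightarrow> \<exists>!c. code_pair (code_pair (code_pair i j) k) c \<in> C) \<Longrightarrow>
       \<exists>H\<in>Sets. (\<forall>m. \<exists>n. m < n \<and> n \<in> H) \<and> (\<exists>c. \<forall>i j k. i \<in> H \<and> j \<in> H \<and> k \<in> H \<and> i < j \<and> j < k \<longrightarrow>
          code_pair (code_pair (code_pair i j) k) c \<in> C)"
  shows "\<exists>f. S1 (\<lambda>e. f (e 0) = e 1) \<and> (\<forall>n. code_pair (f (n + 1)) (f n) \<in> X \<and> f (n + 1) \<noteq> f n)"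
proof -
  have s': "Tm t \<Longrightarrow> Tm u \<Longrightarrow> S1 (\<lambda>e. s (t e) = u e)" for t u :: "(nat \<Rightarrow> 'a) \<Rightarrow> 'a"
    by (intro S1_D0 D0_comp2[OF s])
  have noninc': "code_pair y x \<in> X" if x: "elem_code (code_pair i x) (s n)" and y: "elem_code (code_pair j y) (s n)" and "i \<le> j" for i j n x y
  proof -
    \<comment> \<open>Adjacent comparisons are extended to arbitrary positions by induction on
      \<open>j\<close>. For the predicate to be \<open>D0\<close>, \<open>y\<close> is bounded by
      the code and \<open>i \<le> j\<close> is written as \<open>\<not> j < i\<close>.\<close>
    have "\<forall>y. y < s n \<longrightarrow> elem_code (code_pair j y) (s n) \<longrightarrow> \<not> j < i \<longrightarrow> code_pair y x \<in> X"
    proof (induction j rule: D0_induct)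
      case D0 show ?case using X by (intro D0_intros D0_elem_code Tm_code_pair)
    next
      case zero
      show ?case
      proof (intro allI impI)
        fix y assume "elem_code (code_pair 0 y) (s n)" "\<not> 0 < i"
        then have "y = x" using functional x zero_le[of i] by (metis order.order_iff_strict)
        then show "code_pair y x \<in> X" using field x by blast
      qed
    next
      case (succ j)
      show ?case
      proof (intro allI impI)
        fix y assume y: "elem_code (code_pair (j + 1) y) (s n)" and i: "\<not> j + 1 < i"
        show "code_pair y x \<in> X"
        proof (cases "i = j + 1")
          case True
          then show ?thesis using functional x y field by blast
        next
          case False
          then have "\<not> j < i" using i raw_succ_le[of j i] by blast
          moreover obtain z where z: "elem_code (code_pair j z) (s n)"
            using closed[OF y, of j] by (auto simp: less_add_one_iff)
          ultimately have "code_pair z x \<in> X" using succ elem_code_pair_less by blast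
          with noninc[OF z y] show ?thesis by (rule trans)
        qed
      qed
    qed
    then show ?thesis using y elem_code_pair_less \<open>i \<le> j\<close> by (meson not_le)
  qed
  \<comment> \<open>Transitivity of the lexicographic order: \<open>t\<close> and \<open>u\<close>
    first differ at the smaller of the two positions. If the positions agree, antisymmetry keeps the
    composed inequality strict.\<close>
  have step: "\<exists>j x. first_diff X t u j x" if "first_diff X t (s n) i y" "first_diff X (s n) u i' y'" for t u n i y i' y'
  proof (rule linorder_cases[of i i'])
    assume "i < i'"
    then have "elem_code (code_pair k v) (s n) \<longleftrightarrow> elem_code (code_pair k v) u" if "k < i \<or> k = i" for k v
      using that \<open>first_diff X (s n) u i' y'\<close> unfolding first_diff_def by (meson order.strict_trans)
    then have "first_diff X t u i y" using \<open>first_diff X t (s n) i y\<close> unfolding first_diff_def by blast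
    then show ?thesis by blast
  next
    assume "i' < i"
    then have "elem_code (code_pair k v) t \<longleftrightarrow> elem_code (code_pair k v) (s n)" if "k < i' \<or> k = i'" for k v
      using that \<open>first_diff X t (s n) i y\<close> unfolding first_diff_def by (meson order.strict_trans)
    then have "first_diff X t u i' y'" using \<open>first_diff X (s n) u i' y'\<close> unfolding first_diff_def by blast
    then show ?thesis by blast
  next
    assume i: "i = i'"
    have "code_pair z y \<in> X \<and> z \<noteq> y" if "elem_code (code_pair i z) u" for z
    proof -
      have "code_pair z y' \<in> X" "code_pair y' y \<in> X" "y' \<noteq> y"
        using that \<open>first_diff X t (s n) i y\<close> \<open>first_diff X (s n) u i' y'\<close> unfolding i first_diff_def by blast+
      then show ?thesis using trans antisym by blast
    qed
    then have "first_diff X t u i y" using that unfolding i first_diff_def by blast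
    then show ?thesis by blast
  qed
  have diff: "\<exists>j x. first_diff X (s m) (s n) j x" if "m < n" for m n
  proof -
    \<comment> \<open>The function \<open>s\<close> is no term, so its value at the induction
      variable is introduced through the graph of \<open>s\<close>, which keeps the predicate
      Sigma01.\<close>
    have "\<exists>t j x. s n = t \<and> (\<not> m < n \<or> first_diff X (s m) t j x)"
    proof (induction n rule: Sigma1_induct[case_names S1 zero succ])
      case S1 show ?case
        using X by (intro S1_exI S1_conj S1_disj s'; intro S1_D0 D0_intros D0_first_diff)
    next
      case zero then show ?case by (auto simp: not_less_zero)
    next
      case (succ n)
      consider "m < n" | "m = n" | "\<not> m < n + 1" by (metis raw_less_succ)
      then show ?case
      proof cases
        case 1
        with succ descending[of n] step show ?thesis by blast
      next
        case 2
        with descending[of n] show ?thesis by blast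
      qed blast
    qed
    with that show ?thesis by blast
  qed
  define D where "D m n j x \<longleftrightarrow> first_diff X (s m) (s n) j x" for m n j x
  have D_S1: "S1 (\<lambda>e. D (f e) (g e) (j e) (x e))" if "Tm f" "Tm g" "Tm j" "Tm x" for f g j x :: "(nat \<Rightarrow> 'a) \<Rightarrow> 'a"
  proof -
    have "D m n j x \<longleftrightarrow> (\<exists>t u. s m = t \<and> s n = u \<and> first_diff X t u j x)" for m n j x
      unfolding D_def by blast
    moreover have "S1 (\<lambda>e. \<exists>t u. s (f e) = t \<and> s (g e) = u \<and> first_diff X t u (j e) (x e))"
      using X Tm_subst[OF that(1), of "\<lambda>i e. e (Suc (Suc i))"] Tm_subst[OF that(2), of "\<lambda>i e. e (Suc (Suc i))"]
        Tm_subst[OF that(3), of "\<lambda>i e. e (Suc (Suc i))"] Tm_subst[OF that(4), of "\<lambda>i e. e (Suc (Suc i))"]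
      by (intro S1_exI S1_conj s' S1_D0[OF D0_first_diff]) (simp_all add: Tm.intros)
    ultimately show ?thesis by simp
  qed
  have D_ex: "\<exists>j x. D m n j x" if "m < n" for m n using diff[OF that] unfolding D_def .
  have D_unique: "j = j' \<and> x = x'" if "D m n j x" "D m n j' x'" for m n j x j' x'
    using functional that unfolding D_def by (rule first_diff_unique)
  \<comment> \<open>Colour 1 records a drop of the position, colour 0 is the case that yields the
    descent in \<open>X\<close>.\<close>
  define col where "col i j k c \<longleftrightarrow> (\<exists>d x d' x'. D i j d x \<and> D j k d' x' \<and> (c = 0 \<and> \<not> d' < d \<or> c = 1 \<and> d' < d))"
    for i j k c :: 'a
  define triple where "triple p i j k c \<longleftrightarrow> i < j \<and> j < k \<and> c < 1 + 1 \<and> p = code_pair (code_pair (code_pair i j) k) c"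
    for p i j k c :: 'a
  define C where "C = {p. \<exists>i j k c. triple p i j k c \<and> col i j k c}"
  have less_2: "c < 1 + 1 \<longleftrightarrow> c = 0 \<or> c = 1" for c :: 'a
    using raw_less_succ[of c "0 + 1"] raw_less_succ[of c 0] not_less_zero[of c] by auto
  have col_ex: "\<exists>c. c < 1 + 1 \<and> col i j k c" if "i < j" "j < k" for i j k
  proof -
    obtain d x d' x' where "D i j d x" "D j k d' x'" using D_ex[OF \<open>i < j\<close>] D_ex[OF \<open>j < k\<close>] by blast
    then have "col i j k (if d' < d then 1 else 0)" unfolding col_def by auto
    then show ?thesis unfolding less_2 by (intro exI[of _ "if d' < d then 1 else 0"]) simp
  qed
  have col_unique: "c = c'" if c: "col i j k c" and c': "col i j k c'" for i j k c c'
  proof -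
    obtain d x d' x' where 1: "D i j d x" "D j k d' x'" "c = 0 \<and> \<not> d' < d \<or> c = 1 \<and> d' < d"
      using c unfolding col_def by blast
    obtain e y e' y' where 2: "D i j e y" "D j k e' y'" "c' = 0 \<and> \<not> e' < e \<or> c' = 1 \<and> e' < e"
      using c' unfolding col_def by blast
    have "d = e" "d' = e'" using D_unique 1(1,2) 2(1,2) by blast+
    then show ?thesis using 1(3) 2(3) by auto
  qed
  have col_iff: "col i j k c \<longleftrightarrow> c = 0 \<and> \<not> d' < d \<or> c = 1 \<and> d' < d" if "D i j d x" "D j k d' x'" for i j k c d x d' x'
  proof -
    let ?v = "if d' < d then 1 else 0"
    have "col i j k ?v" using that unfolding col_def by auto
    then have "col i j k c \<longleftrightarrow> c = ?v" using col_unique by blast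
    then show ?thesis by auto
  qed
  have triple_D0: "D0 (\<lambda>e. triple (p e) (i e) (j e) (k e) (c e))" if "Tm p" "Tm i" "Tm j" "Tm k" "Tm c"
    for p i j k c :: "(nat \<Rightarrow> 'a) \<Rightarrow> 'a"
    unfolding triple_def using that by (intro D0_conj D0_less D0_eq Tm_code_pair Tm.intros)
  have triple_bound: "i < p + 1 \<and> j < p + 1 \<and> k < p + 1 \<and> c < p + 1" if "triple p i j k c" for p i j k c
    using that code_pair_ge[of i j] code_pair_ge[of j i] code_pair_ge[of "code_pair i j" k] code_pair_ge[of k "code_pair i j"]
      code_pair_ge[of "code_pair (code_pair i j) k" c] code_pair_ge[of c "code_pair (code_pair i j) k"]
    unfolding triple_def less_add_one_iff by (meson code_pair_ge order.trans)
  have C: "C \<in> Sets" unfolding C_def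
  proof (rule Delta1_comprehension)
    show "S1 (\<lambda>e. \<exists>i j k c. triple (e 0) i j k c \<and> col i j k c)"
      unfolding col_def by (intro S1_exI S1_conj D_S1 S1_D0[OF triple_D0]; intro Tm.intros S1_D0 D0_intros)
    \<comment> \<open>The complement of \<open>C\<close> in Sigma01 form: \<open>p\<close> codes no
      increasing triple with a colour, a bounded condition, or its triple receives a different
      colour. Existence and uniqueness of the colour give the equivalence.\<close>
    have "(\<not> (\<exists>i j k c. triple p i j k c \<and> col i j k c)) \<longleftrightarrow>
      (\<forall>i. i < p + 1 \<longrightarrow> (\<forall>j. j < p + 1 \<longrightarrow> (\<forall>k. k < p + 1 \<longrightarrow> (\<forall>c. c < p + 1 \<longrightarrow> \<not> triple p i j k c)))) \<or>
      (\<exists>i j k c c'. triple p i j k c \<and> col i j k c' \<and> c \<noteq> c')" (is "?L \<longleftrightarrow> ?A \<or> ?B") for p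
    proof
      assume L: ?L
      show "?A \<or> ?B"
      proof (rule disjCI)
        assume "\<not> ?B"
        have "\<not> triple p i j k c" for i j k c
        proof
          assume *: "triple p i j k c"
          then obtain c' where "col i j k c'" using col_ex unfolding triple_def by blast
          with * L \<open>\<not> ?B\<close> show False by blast
        qed
        then show ?A by blast
      qed
    next
      assume "?A \<or> ?B"
      then show ?L
      proof
        assume ?A then show ?L using triple_bound by blast
      next
        assume ?B
        then obtain i j k c c' where *: "triple p i j k c" "col i j k c'" "c \<noteq> c'" by blast
        have "i' = i \<and> j' = j \<and> k' = k \<and> c'' = c" if "triple p i' j' k' c''" for i' j' k' c''
          using that *(1) unfolding triple_def by (simp add: code_pair_inject)
        with * col_unique show ?L by blast
      qed
    qed
    moreover have "S1 (\<lambda>e. (\<forall>i. i < e 0 + 1 \<longrightarrow> (\<forall>j. j < e 0 + 1 \<longrightarrow> (\<forall>k. k < e 0 + 1 \<longrightarrow> (\<forall>c. c < e 0 + 1 \<longrightarrow> \<not> triple (e 0) i j k c)))) \<or>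
      (\<exists>i j k c c'. triple (e 0) i j k c \<and> col i j k c' \<and> c \<noteq> c'))"
      unfolding col_def
      by (intro S1_disj S1_exI S1_conj D_S1; (intro S1_D0)?; intro D0_intros triple_D0)
    ultimately show "S1 (\<lambda>e. \<not> (\<exists>i j k c. triple (e 0) i j k c \<and> col i j k c))" by simp
  qed
  have C_iff: "code_pair (code_pair (code_pair i j) k) c \<in> C \<longleftrightarrow> i < j \<and> j < k \<and> c < 1 + 1 \<and> col i j k c" for i j k c
    unfolding C_def triple_def by (auto simp: code_pair_inject)
  obtain H c where H: "H \<in> Sets" "\<forall>m. \<exists>n. m < n \<and> n \<in> H"
    and mono: "\<And>i j k. i \<in> H \<Longrightarrow> j \<in> H \<Longrightarrow> k \<in> H \<Longrightarrow> i < j \<Longrightarrow> j < k \<Longrightarrow> col i j k c \<and> c < 1 + 1"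
  proof -
    have "\<exists>H\<in>Sets. (\<forall>m. \<exists>n. m < n \<and> n \<in> H) \<and> (\<exists>c. \<forall>i j k. i \<in> H \<and> j \<in> H \<and> k \<in> H \<and> i < j \<and> j < k \<longrightarrow>
          code_pair (code_pair (code_pair i j) k) c \<in> C)"
    proof (rule RT[OF C])
      show "\<exists>i j k c. i < j \<and> j < k \<and> c < 1 + 1 \<and> p = code_pair (code_pair (code_pair i j) k) c" if "p \<in> C" for p
        using that unfolding C_def triple_def by blast
      show "\<exists>!c. code_pair (code_pair (code_pair i j) k) c \<in> C" if "i < j" "j < k" for i j k
        using that col_ex col_unique unfolding C_iff by metis
    qed
    then show thesis using that unfolding C_iff by blast
  qed
  have "c = 0"
  proof (rule ccontr)
    assume "c \<noteq> 0"
    have drop: "d' < d" if "i \<in> H" "j \<in> H" "k \<in> H" "i < j" "j < k" "D i j d x" "D j k d' x'" for i j k d x d' x'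
      using mono[OF that(1-5)] \<open>c \<noteq> 0\<close> col_iff[OF that(6,7)] by blast
    \<comment> \<open>A least position occurring on \<open>H\<close> exists because this predicate
      is Sigma01; the next element of \<open>H\<close> would produce a smaller one. No infinite
      sequence of positions has to be formed.\<close>
    let ?P = "\<lambda>d. \<exists>i j x. i \<in> H \<and> j \<in> H \<and> i < j \<and> D i j d x"
    obtain i where i: "i \<in> H" using H(2) by blast
    obtain j where j: "i < j" "j \<in> H" using H(2) by blast
    have "S1 (\<lambda>e. ?P (e 0))"
      using H(1) by (intro S1_exI S1_conj D_S1; intro S1_D0 D0_intros)
    moreover obtain d x where "D i j d x" using D_ex j by blast
    then have "?P d" using i j by blast
    ultimately obtain d where "?P d" and least: "\<And>d'. d' < d \<Longrightarrow> \<not> ?P d'"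
      using Sigma1_least[of ?P d] by blast
    then obtain i j x where ij: "i \<in> H" "j \<in> H" "i < j" "D i j d x" by blast
    obtain k where k: "j < k" "k \<in> H" using H(2) by blast
    obtain d' x' where d': "D j k d' x'" using D_ex k by blast
    then have "d' < d" using drop[of i j k d x d' x'] ij k by blast
    with least ij k d' show False by blast
  qed
  have rise: "\<not> d' < d" if "i \<in> H" "j \<in> H" "k \<in> H" "i < j" "j < k" "D i j d x" "D j k d' x'" for i j k d x d' x'
    using mono[OF that(1-5)] \<open>c = 0\<close> col_iff[OF that(6,7)] by auto
  have key: "code_pair x' x \<in> X \<and> x' \<noteq> x" if "i \<in> H" "j \<in> H" "k \<in> H" "i < j" "j < k" "D i j d x" "D j k d' x'" for i j k d x d' x'
  proof -
    have "d \<le> d'" using rise[OF that] by simp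
    have x': "elem_code (code_pair d' x') (s j)" using that(7) unfolding D_def first_diff_def by blast
    then obtain y where y: "elem_code (code_pair d y) (s j)"
      using closed[OF x', of d] \<open>d \<le> d'\<close> by (metis order.order_iff_strict)
    have "code_pair x' y \<in> X" using noninc'[OF y x' \<open>d \<le> d'\<close>] .
    moreover have "code_pair y x \<in> X" "y \<noteq> x" using that(6) y unfolding D_def first_diff_def by blast+
    ultimately show ?thesis using trans antisym by blast
  qed
  \<comment> \<open>The least element of \<open>H\<close> above \<open>m\<close>, written so that
    the graph is \<open>D0\<close>, as \<open>iteration\<close> demands.\<close>
  define next_in where "next_in m n \<longleftrightarrow> m < n \<and> n \<in> H \<and> (\<forall>k. k < n \<longrightarrow> m < k \<longrightarrow> k \<notin> H)" for m n
  have next_in_D0: "D0 (\<lambda>e. next_in (e 0) (e 1))"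
    unfolding next_in_def using H(1) by (intro D0_intros)
  have next_ex: "\<exists>n. next_in m n" for m
  proof -
    obtain n where "m < n \<and> n \<in> H" using H(2) by blast
    moreover have "S1 (\<lambda>e. m < e 0 \<and> e 0 \<in> H)" using H(1) by (intro S1_D0 D0_intros)
    ultimately show ?thesis using Sigma1_least[of "\<lambda>n. m < n \<and> n \<in> H" n] unfolding next_in_def by blast
  qed
  have next_unique: "n = n'" if "next_in m n" "next_in m n'" for m n n'
    using that unfolding next_in_def by (metis linorder_neqE)
  define g where "g m = (THE n. next_in m n)" for m
  have g: "g m = n \<longleftrightarrow> next_in m n" for m n
    unfolding g_def using next_ex next_unique by (metis the_equality)
  then have "D0 (\<lambda>e. g (e 0) = e 1)" using next_in_D0 by simp
  \<comment> \<open>Starting at \<open>g 0\<close> instead of 0 ensures that the first value is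
    already in \<open>H\<close>.\<close>
  from iteration[OF this, of "g 0"] obtain h where h: "h 0 = g 0" "\<And>n. h (n + 1) = g (h n)" "S1 (\<lambda>e. h (e 0) = e 1)"
    by blast
  have g_H: "m < g m" "g m \<in> H" for m using g[of m "g m"] unfolding next_in_def by auto
  have h_H: "h n \<in> H" for n
  proof (cases "n = 0")
    case False
    then obtain k where "n = k + 1"
      using raw_less_imp_add[of 0 n] zero_le add_one_le_iff[of 0 n] le_iff_add_rca0[of 1 n]
      by (metis add.commute add_0 order.order_iff_strict)
    then show ?thesis using h g_H by simp
  qed (simp add: h g_H)
  have h_less: "h n < h (n + 1)" for n using h g_H by simp
  define f where "f n = (THE x. \<exists>d. D (h n) (h (n + 1)) d x)" for n
  have f: "f n = x \<longleftrightarrow> (\<exists>d. D (h n) (h (n + 1)) d x)" for n x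
  proof -
    have "\<exists>!x. \<exists>d. D (h n) (h (n + 1)) d x" using D_ex[OF h_less] D_unique by blast
    then have "\<exists>d. D (h n) (h (n + 1)) d (f n)" unfolding f_def by (rule theI')
    then show ?thesis using D_unique by blast
  qed
  have h': "Tm t \<Longrightarrow> Tm u \<Longrightarrow> S1 (\<lambda>e. h (t e) = u e)" for t u :: "(nat \<Rightarrow> 'a) \<Rightarrow> 'a"
    using h(3) by (rule S1_comp2)
  have "S1 (\<lambda>e. \<exists>u v d. h (e 0) = u \<and> h (e 0 + 1) = v \<and> D u v d (e 1))"
    by (intro S1_exI S1_conj h' D_S1; intro Tm.intros)
  then have "S1 (\<lambda>e. f (e 0) = e 1)" unfolding f by simp
  moreover have "code_pair (f (n + 1)) (f n) \<in> X \<and> f (n + 1) \<noteq> f n" for n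
  proof -
    obtain d d' where "D (h n) (h (n + 1)) d (f n)" "D (h (n + 1)) (h (n + 1 + 1)) d' (f (n + 1))"
      using f by blast
    then show ?thesis by (rule key[OF h_H h_H h_H h_less h_less])
  qed
  ultimately show ?thesis by blast
qed

section \<open>Semantics of the coded notions\<close>

text \<open>An \<open>nterm\<close> is an arbitrary function of the binding depth. Stability says
  that below \<open>k\<close> binders a further binder does not change its value, which holds for
  the variables in scope. The type token fixes the model, which the first two arguments do not
  mention.\<close>

definition stable :: "nat \<Rightarrow> nterm \<Rightarrow> 'a::rca0 itself \<Rightarrow> bool" where
  "stable k t _ \<longleftrightarrow> (\<forall>k'\<ge>k. \<forall>(e :: nat \<Rightarrow> 'a) x. tm_val (case_nat x e) (t (Suc k')) = tm_val e (t k'))"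

lemma stable_var [simp]: "m < k \<Longrightarrow> stable k (\<lambda>k'. Var (k' - Suc m)) T"
  by (auto simp: stable_def Suc_diff_le split: nat.split intro: arg_cong)

lemma stable_Suc [simp]: "stable k t T \<Longrightarrow> stable (Suc k) t T"
  by (simp add: stable_def)

lemma stable_pair [simp]: "stable k s T \<Longrightarrow> stable k t T \<Longrightarrow> stable k \<^bold>\<langle>s, t\<^bold>\<rangle> T"
  by (simp add: stable_def pair_def Defs.add_def Defs.mul_def)

lemma stable_add_one [simp]: "stable k s T \<Longrightarrow> stable k (s \<^bold>+ \<^bold>1) T"
  by (simp add: stable_def Defs.add_def Defs.one_def)

lemma tm_val_stable [simp]:
  "stable k t TYPE('a::rca0) \<Longrightarrow> tm_val (case_nat x (e :: nat \<Rightarrow> 'a)) (t (Suc k)) = tm_val e (t k)"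
  by (simp add: stable_def)

lemma tm_val_pair [simp]: "tm_val (e :: nat \<Rightarrow> 'a::rca0) (\<^bold>\<langle>s, t\<^bold>\<rangle> k) = code_pair (tm_val e (s k)) (tm_val e (t k))"
  by (simp add: pair_def Defs.add_def Defs.mul_def code_pair_def)

lemma tm_val_nterm [simp]:
  "tm_val e ((s \<^bold>+ t) k) = tm_val e (s k) + tm_val e (t k)"
  "tm_val e ((s \<^bold>* t) k) = tm_val e (s k) * tm_val e (t k)"
  "tm_val e (\<^bold>1 k) = 1"
  by (simp_all add: Defs.add_def Defs.mul_def Defs.one_def)

lemma sat_form [simp]:
  "sat ((s \<^bold>= t) k l) e S \<longleftrightarrow> tm_val e (s k) = tm_val e (t k)"
  "sat ((s \<^bold>< t) k l) e S \<longleftrightarrow> tm_val e (s k) < tm_val e (t k)"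
  "sat ((t \<^bold>\<in> X) k l) e S \<longleftrightarrow> tm_val e (t k) \<in> S (X l)"
  "sat ((\<^bold>\<not> A) k l) e S \<longleftrightarrow> \<not> sat (A k l) e S"
  "sat ((A \<^bold>\<and> B) k l) e S \<longleftrightarrow> sat (A k l) e S \<and> sat (B k l) e S"
  "sat ((A \<^bold>\<or> B) k l) e S \<longleftrightarrow> sat (A k l) e S \<or> sat (B k l) e S"
  "sat ((A \<^bold>\<longrightarrow> B) k l) e S \<longleftrightarrow> (sat (A k l) e S \<longrightarrow> sat (B k l) e S)"
  "sat ((A \<^bold>\<longleftrightarrow> B) k l) e S \<longleftrightarrow> (sat (A k l) e S \<longleftrightarrow> sat (B k l) e S)"
  "sat ((\<^bold>\<forall>x. F x) k l) e S \<longleftrightarrow> (\<forall>v. sat (F (\<lambda>k'. Var (k' - Suc k)) (Suc k) l) (case_nat v e) S)"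
  "sat ((\<^bold>\<exists>x. F x) k l) e S \<longleftrightarrow> (\<exists>v. sat (F (\<lambda>k'. Var (k' - Suc k)) (Suc k) l) (case_nat v e) S)"
  "sat ((\<^bold>\<forall>\<^sub>SX. G X) k l) e S \<longleftrightarrow> (\<forall>Y\<in>Sets. sat (G (\<lambda>l'. l' - Suc l) k (Suc l)) e (case_nat Y S))"
  "sat ((\<^bold>\<exists>\<^sub>SX. G X) k l) e S \<longleftrightarrow> (\<exists>Y\<in>Sets. sat (G (\<lambda>l'. l' - Suc l) k (Suc l)) e (case_nat Y S))"
  by (auto simp: Defs.eq_def Defs.less_def Defs.mem_def Defs.neg_def Defs.conj_def Defs.disj_def Defs.imp_def Defs.iff_def
      all_num_def ex_num_def all_set_def ex_set_def)

lemma sat_bounded [simp]: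
  fixes e :: "nat \<Rightarrow> 'a::rca0"
  assumes "stable k t TYPE('a)"
  shows "sat ((\<^bold>\<forall>x\<^bold><t. F x) k l) e S \<longleftrightarrow>
      (\<forall>v. v < tm_val e (t k) \<longrightarrow> sat (F (\<lambda>k'. Var (k' - Suc k)) (Suc k) l) (case_nat v e) S)"
    and "sat ((\<^bold>\<exists>x\<^bold><t. F x) k l) e S \<longleftrightarrow>
      (\<exists>v. v < tm_val e (t k) \<and> sat (F (\<lambda>k'. Var (k' - Suc k)) (Suc k) l) (case_nat v e) S)"
  using assms by (auto simp: ball_num_def bex_num_def)

lemma sat_ex1 [simp]:
  "sat ((\<^bold>\<exists>!x. F x) k l) e S \<longleftrightarrow>
    (\<exists>v. sat (F (\<lambda>k'. Var (k' - Suc k)) (Suc k) l) (case_nat v e) S \<and>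
      (\<forall>w. sat (F (\<lambda>k'. Var (k' - Suc (Suc k))) (Suc (Suc k)) l) (case_nat w (case_nat v e)) S \<longrightarrow> w = v))"
  by (simp add: ex1_num_def Suc_diff_le)

lemma sat_elem [simp]:
  fixes e :: "nat \<Rightarrow> 'a::rca0"
  assumes "stable k i TYPE('a)" "stable k a TYPE('a)"
  shows "sat ((i \<^bold>\<epsilon> a) k l) e S \<longleftrightarrow> elem_code (tm_val e (i k)) (tm_val e (a k))"
  using assms by (simp add: elem_def elem_code_def Suc_diff_le)

definition is_seq :: "'a::rca0 \<Rightarrow> 'a \<Rightarrow> bool" where
  "is_seq s n \<longleftrightarrow> (\<forall>b. b < s \<longrightarrow> (\<exists>i. i < s \<and> (elem_code i s \<longleftrightarrow> \<not> elem_code i b))) \<and>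
     (\<forall>p. elem_code p s \<longrightarrow> (\<exists>i x. i < n \<and> p = code_pair i x)) \<and>
     (\<forall>i. i < n \<longrightarrow> (\<exists>!x. elem_code (code_pair i x) s))"

lemma sat_seq [simp]:
  fixes e :: "nat \<Rightarrow> 'a::rca0"
  assumes "stable k s TYPE('a)" "stable k n TYPE('a)"
  shows "sat (seq s n k l) e S \<longleftrightarrow> is_seq (tm_val e (s k)) (tm_val e (n k))"
  using assms by (simp add: seq_def is_seq_def finset_code_def Ex1_def Suc_diff_le)

definition is_omega_pow :: "'a::rca0 set \<Rightarrow> 'a \<Rightarrow> bool" where
  "is_omega_pow X s \<longleftrightarrow> (\<exists>n. is_seq s n) \<and>
     (\<forall>i x. elem_code (code_pair i x) s \<longrightarrow> code_pair x x \<in> X) \<and>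
     (\<forall>i x y. elem_code (code_pair i x) s \<and> elem_code (code_pair (i + 1) y) s \<longrightarrow> code_pair y x \<in> X)"

lemma sat_omega_pow [simp]:
  fixes e :: "nat \<Rightarrow> 'a::rca0"
  assumes "stable k s TYPE('a)"
  shows "sat (omega_pow X s k l) e S \<longleftrightarrow> is_omega_pow (S (X l)) (tm_val e (s k))"
  using assms by (simp add: omega_pow_def is_omega_pow_def Suc_diff_le)

definition is_lex_less :: "'a::rca0 set \<Rightarrow> 'a \<Rightarrow> 'a \<Rightarrow> bool" where
  "is_lex_less X s t \<longleftrightarrow> (\<exists>m n. is_seq s m \<and> is_seq t n \<and>
     (m < n \<and> (\<forall>i. i < m \<longrightarrow> (\<forall>x. elem_code (code_pair i x) s \<longleftrightarrow> elem_code (code_pair i x) t)) \<or>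
      (\<exists>j. j < m \<and> j < n \<and> (\<forall>i. i < j \<longrightarrow> (\<forall>x. elem_code (code_pair i x) s \<longleftrightarrow> elem_code (code_pair i x) t)) \<and>
        (\<exists>x y. elem_code (code_pair j x) s \<and> elem_code (code_pair j y) t \<and> code_pair x y \<in> X \<and> x \<noteq> y))))"

lemma sat_strict [simp]:
  "sat (strict X x y k l) (e :: nat \<Rightarrow> 'a::rca0) S \<longleftrightarrow>
    code_pair (tm_val e (x k)) (tm_val e (y k)) \<in> S (X l) \<and> tm_val e (x k) \<noteq> tm_val e (y k)"
  by (simp add: strict_def)

lemma sat_lex_less [simp]:
  fixes e :: "nat \<Rightarrow> 'a::rca0"
  assumes "stable k s TYPE('a)" "stable k t TYPE('a)"
  shows "sat (lex_less X s t k l) e S \<longleftrightarrow> is_lex_less (S (X l)) (tm_val e (s k)) (tm_val e (t k))"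
  using assms by (simp add: lex_less_def is_lex_less_def Suc_diff_le)

lemma sat_omega_pow_less [simp]:
  fixes e :: "nat \<Rightarrow> 'a::rca0"
  assumes "stable k s TYPE('a)" "stable k t TYPE('a)"
  shows "sat (omega_pow_less X s t k l) e S \<longleftrightarrow> is_omega_pow (S (X l)) (tm_val e (s k)) \<and>
    is_omega_pow (S (X l)) (tm_val e (t k)) \<and> is_lex_less (S (X l)) (tm_val e (s k)) (tm_val e (t k))"
  using assms by (simp add: omega_pow_less_def)

definition is_total_fun :: "'a::rca0 set \<Rightarrow> bool" where
  "is_total_fun F \<longleftrightarrow> (\<forall>p. p \<in> F \<longrightarrow> (\<exists>n x. p = code_pair n x)) \<and> (\<forall>n. \<exists>!x. code_pair n x \<in> F)"

lemma sat_total_fun [simp]: "sat (total_fun F k l) (e :: nat \<Rightarrow> 'a::rca0) S \<longleftrightarrow> is_total_fun (S (F l))"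
  by (simp add: total_fun_def is_total_fun_def Ex1_def Suc_diff_le)

text \<open>A proper initial segment first differs at its own length, where it has no entry. The
  larger code comes first in \<open>first_diff\<close>, so the arguments are swapped.\<close>

lemma first_diff_if_lex_less:
  fixes s t :: "'a::rca0"
  assumes "is_lex_less X s t" shows "\<exists>j x. first_diff X t s j x"
proof -
  obtain m n where s: "is_seq s m" and t: "is_seq t n" and
    *: "m < n \<and> (\<forall>i. i < m \<longrightarrow> (\<forall>x. elem_code (code_pair i x) s \<longleftrightarrow> elem_code (code_pair i x) t)) \<or>
      (\<exists>j. j < m \<and> j < n \<and> (\<forall>i. i < j \<longrightarrow> (\<forall>x. elem_code (code_pair i x) s \<longleftrightarrow> elem_code (code_pair i x) t)) \<and>
        (\<exists>x y. elem_code (code_pair j x) s \<and> elem_code (code_pair j y) t \<and> code_pair x y \<in> X \<and> x \<noteq> y))"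
    using assms unfolding is_lex_less_def by blast
  from * show ?thesis
  proof
    assume m: "m < n \<and> (\<forall>i. i < m \<longrightarrow> (\<forall>x. elem_code (code_pair i x) s \<longleftrightarrow> elem_code (code_pair i x) t))"
    then obtain x where x: "elem_code (code_pair m x) t" using t unfolding is_seq_def by blast
    have "\<not> elem_code (code_pair m y) s" for y
    proof
      assume "elem_code (code_pair m y) s"
      then obtain i z where "i < m" "code_pair m y = code_pair i z" using s unfolding is_seq_def by blast
      then show False by (simp add: code_pair_inject)
    qed
    then have "first_diff X t s m x" unfolding first_diff_def using x m by blast
    then show ?thesis by blast
  next
    assume "\<exists>j. j < m \<and> j < n \<and> (\<forall>i. i < j \<longrightarrow> (\<forall>x. elem_code (code_pair i x) s \<longleftrightarrow> elem_code (code_pair i x) t)) \<and>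
        (\<exists>x y. elem_code (code_pair j x) s \<and> elem_code (code_pair j y) t \<and> code_pair x y \<in> X \<and> x \<noteq> y)"
    then obtain j x y where j: "j < m" "\<forall>i. i < j \<longrightarrow> (\<forall>x. elem_code (code_pair i x) s \<longleftrightarrow> elem_code (code_pair i x) t)"
      "elem_code (code_pair j x) s" "elem_code (code_pair j y) t" "code_pair x y \<in> X" "x \<noteq> y" by blast
    have "z = x" if "elem_code (code_pair j z) s" for z
      using s j(1,3) that unfolding is_seq_def by blast
    then have "first_diff X t s j y" unfolding first_diff_def using j by blast
    then show ?thesis by blast
  qed
qed

lemma sat_target: "sat target (e :: nat \<Rightarrow> 'a::rca0) S"
proof -
  have "sat (WOP_omega 0 0) e S" if RT: "sat (RT32 0 0) e S"
  proof -
    \<comment> \<open>The principle in contrapositive form: a descending sequence \<open>F\<close>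
      in the power yields a descending sequence \<open>G\<close> in \<open>X\<close>.\<close>
    have "\<exists>G\<in>Sets. is_total_fun G \<and> (\<forall>n x y. code_pair n x \<in> G \<and> code_pair (n + 1) y \<in> G \<longrightarrow>
          code_pair y x \<in> X \<and> y \<noteq> x)"
      if X: "X \<in> Sets" and F: "F \<in> Sets" "is_total_fun F"
        and order: "\<forall>x y. code_pair x y \<in> X \<longrightarrow> code_pair x x \<in> X \<and> code_pair y y \<in> X"
          "\<forall>x y z. code_pair x y \<in> X \<and> code_pair y z \<in> X \<longrightarrow> code_pair x z \<in> X"
          "\<forall>x y. code_pair x y \<in> X \<and> code_pair y x \<in> X \<longrightarrow> x = y"
        and desc: "\<forall>n x y. code_pair n x \<in> F \<and> code_pair (n + 1) y \<in> F \<longrightarrow>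
          is_omega_pow X y \<and> is_omega_pow X x \<and> is_lex_less X y x"
      for X F :: "'a set"
    proof -
      define s where "s n = (THE x. code_pair n x \<in> F)" for n
      have F1: "\<exists>!x. code_pair n x \<in> F" for n using F(2) unfolding is_total_fun_def by simp
      have mem: "code_pair n (s n) \<in> F" for n unfolding s_def by (rule theI'[OF F1])
      have s: "s n = x \<longleftrightarrow> code_pair n x \<in> F" for n x
        using mem[of n] the1_equality[OF F1, of n x] unfolding s_def by auto
      have s_desc: "is_omega_pow X (s n)" "is_lex_less X (s (n + 1)) (s n)" for n
        using desc[rule_format, OF conjI[OF mem mem], of n] by simp_all
      have index: "i < n" if t: "is_seq t n" "elem_code (code_pair i x) t" for t n i x :: 'a
      proof -
        obtain j y where "j < n" "code_pair i x = code_pair j y" using t unfolding is_seq_def by blast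
        then show ?thesis by (simp add: code_pair_inject)
      qed
      have "\<exists>f. S1 (\<lambda>e. f (e 0) = e 1) \<and> (\<forall>n. code_pair (f (n + 1)) (f n) \<in> X \<and> f (n + 1) \<noteq> f n)"
      proof (rule descent[of s X])
        show "D0 (\<lambda>e. s (e 0) = e 1)" unfolding s using F(1) by (intro D0_mem Tm_code_pair Tm.intros)
        show "\<exists>j x. first_diff X (s n) (s (n + 1)) j x" for n
          using s_desc by (intro first_diff_if_lex_less)
        show "x = y" if "elem_code (code_pair i x) (s n)" "elem_code (code_pair i y) (s n)" for n i x y
        proof -
          obtain m where m: "is_seq (s n) m" using s_desc(1) unfolding is_omega_pow_def by blast
          with index that m show ?thesis unfolding is_seq_def by blast
        qed
        show "\<exists>y. elem_code (code_pair j y) (s n)" if "elem_code (code_pair i x) (s n)" "j < i" for n i j x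
        proof -
          obtain m where m: "is_seq (s n) m" using s_desc(1) unfolding is_omega_pow_def by blast
          with index[OF m that(1)] that(2) have "j < m" by simp
          then show ?thesis using m unfolding is_seq_def by blast
        qed
        show "code_pair x x \<in> X" if "elem_code (code_pair i x) (s n)" for n i x
          using s_desc(1) that unfolding is_omega_pow_def by blast
        show "code_pair y x \<in> X" if "elem_code (code_pair i x) (s n)" "elem_code (code_pair (i + 1) y) (s n)" for n i x y
          using s_desc(1) that unfolding is_omega_pow_def by blast
        show "\<exists>H\<in>Sets. (\<forall>m. \<exists>n. m < n \<and> n \<in> H) \<and> (\<exists>c. \<forall>i j k. i \<in> H \<and> j \<in> H \<and> k \<in> H \<and> i < j \<and> j < k \<longrightarrow>
          code_pair (code_pair (code_pair i j) k) c \<in> C)"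
          if "C \<in> Sets" "\<And>p. p \<in> C \<Longrightarrow> \<exists>i j k c. i < j \<and> j < k \<and> c < 1 + 1 \<and> p = code_pair (code_pair (code_pair i j) k) c"
            "\<And>i j k. i < j \<Longrightarrow> j < k \<Longrightarrow> \<exists>!c. code_pair (code_pair (code_pair i j) k) c \<in> C" for C :: "'a set"
        proof -
          have "\<forall>C\<in>(Sets :: 'a set set). (\<forall>p. p \<in> C \<longrightarrow> (\<exists>i j k c. i < j \<and> j < k \<and> c < 1 + 1 \<and> p = code_pair (code_pair (code_pair i j) k) c)) \<and>
            (\<forall>i j k. i < j \<and> j < k \<longrightarrow> (\<exists>c. code_pair (code_pair (code_pair i j) k) c \<in> C \<and>
              (\<forall>c'. code_pair (code_pair (code_pair i j) k) c' \<in> C \<longrightarrow> c' = c))) \<longrightarrow>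
            (\<exists>H\<in>Sets. (\<forall>m. \<exists>n. m < n \<and> n \<in> H) \<and> (\<exists>c. \<forall>i j k. i \<in> H \<and> j \<in> H \<and> k \<in> H \<and> i < j \<and> j < k \<longrightarrow>
              code_pair (code_pair (code_pair i j) k) c \<in> C))"
            using RT by (simp add: RT32_def colouring3_def infinite_set_def monochromatic3_def Suc_diff_le)
          with that show ?thesis by (simp add: Ex1_def)
        qed
      qed (use X order in blast)+
      then obtain f where f: "S1 (\<lambda>e. f (e 0) = e 1)" "\<And>n. code_pair (f (n + 1)) (f n) \<in> X \<and> f (n + 1) \<noteq> f n"
        by blast
      let ?G = "{code_pair n (f n) | n. True}"
      have "?G \<in> Sets" using f(1) by (rule function_graph_in_Sets)
      moreover have G: "code_pair n x \<in> ?G \<longleftrightarrow> x = f n" for n x by (auto simp: code_pair_inject)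
      have "is_total_fun ?G" unfolding is_total_fun_def G by auto
      moreover have "\<forall>n x y. code_pair n x \<in> ?G \<and> code_pair (n + 1) y \<in> ?G \<longrightarrow> code_pair y x \<in> X \<and> y \<noteq> x"
        unfolding G using f(2) by (intro allI impI) simp
      ultimately show ?thesis by blast
    qed
    note core = this
    show ?thesis
      unfolding WOP_omega_def
      apply (simp add: WO_def linear_order_def Suc_diff_le cong del: imp_cong)
      apply (intro ballI impI)
      subgoal premises prems for X F
      proof (rule ccontr)
        note X = prems(2)[THEN conjunct2]
        assume contra: "\<not> ?thesis"
        have "\<exists>G\<in>Sets. is_total_fun G \<and> (\<forall>n x y. code_pair n x \<in> G \<and> code_pair (n + 1) y \<in> G \<longrightarrow>
          code_pair y x \<in> X \<and> y \<noteq> x)"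
          using contra
          by (intro core[OF prems(1,4,5) X[THEN conjunct1] X[THEN conjunct2, THEN conjunct1]
                X[THEN conjunct2, THEN conjunct2, THEN conjunct1]]) blast
        then show False using prems(3) by blast
      qed
      done
  qed
  then show ?thesis by (simp add: target_def)
qed

lemma RCA0_proves: "proves RCA0 ((RT32 \<^bold>\<longrightarrow> WOP_omega) 0 0)"
  using provable_if_sat_henkin_model[OF sat_target] unfolding target_def .

section \<open>Uniformly computable functionals\<close>

text \<open>
  One program computes \<open>F X\<close> for all oracles \<open>X \<in> D\<close>, reading the environment \<open>e\<close> off its argument list,
  which may be longer than needed.
\<close>

definition computable :: "nat set set \<Rightarrow> (nat set \<Rightarrow> (nat \<Rightarrow> nat) \<Rightarrow> nat) \<Rightarrow> bool" where
  "computable D F \<longleftrightarrow> (\<exists>p k. \<forall>X\<in>D. \<forall>e xs. k \<le> length xs \<longrightarrow> (\<forall>i<k. xs ! i = e i) \<longrightarrow> evaluates X p xs (F X e))"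

lemma computable_cong: "computable D F \<Longrightarrow> (\<And>X e. X \<in> D \<Longrightarrow> F X e = G X e) \<Longrightarrow> computable D G"
  unfolding computable_def by simp

lemma computable_var: "computable D (\<lambda>X e. e i)"
proof -
  have "evaluates X (Proj i) xs (e i)" if "Suc i \<le> length xs" "\<forall>j<Suc i. xs ! j = e j" for X xs e
    using evaluates.intros(3)[of i xs X] that by simp
  then show ?thesis unfolding computable_def by blast
qed

text \<open>The program \<open>p\<close> reads only \<open>k\<close> arguments, so finitely many of
  the functionals \<open>\<sigma> i\<close> have to be evaluated; \<open>L\<close> bounds the number
  of arguments that their programs read.\<close>

lemma computable_subst:
  assumes F: "computable D F" and \<sigma>: "\<And>i. computable D (\<sigma> i)"
  shows "computable D (\<lambda>X e. F X (\<lambda>i. \<sigma> i X e))"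
proof -
  obtain p k where p: "\<And>X e xs. X \<in> D \<Longrightarrow> k \<le> length xs \<Longrightarrow> (\<forall>i<k. xs ! i = e i) \<Longrightarrow> evaluates X p xs (F X e)"
    using F unfolding computable_def by blast
  have "\<forall>i. \<exists>q k. \<forall>X\<in>D. \<forall>e xs. k \<le> length xs \<longrightarrow> (\<forall>j<k. xs ! j = e j) \<longrightarrow> evaluates X q xs (\<sigma> i X e)"
    using \<sigma> unfolding computable_def by blast
  then obtain q l where q: "\<And>i X e xs. X \<in> D \<Longrightarrow> l i \<le> length xs \<Longrightarrow> (\<forall>j<l i. xs ! j = e j) \<Longrightarrow> evaluates X (q i) xs (\<sigma> i X e)"
    by metis
  define L where "L = Max (insert 0 (l ` {..<k}))"
  have L: "l i \<le> L" if "i < k" for i unfolding L_def using that by (intro Max_ge) auto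
  have "evaluates X (Comp p (map q [0..<k])) xs (F X (\<lambda>i. \<sigma> i X e))"
    if "X \<in> D" "L \<le> length xs" "\<forall>i<L. xs ! i = e i" for X e xs
  proof (rule evaluates.intros(5))
    show "list_all2 (\<lambda>g y. evaluates X g xs y) (map q [0..<k]) (map (\<lambda>i. \<sigma> i X e) [0..<k])"
      unfolding list_all2_conv_all_nth
    proof (intro conjI allI impI)
      fix i assume "i < length (map q [0..<k])"
      then have "i < k" by simp
      then show "evaluates X (map q [0..<k] ! i) xs (map (\<lambda>i. \<sigma> i X e) [0..<k] ! i)"
        using q[OF \<open>X \<in> D\<close>, of i xs e] L[of i] that by simp
    qed simp
    show "evaluates X p (map (\<lambda>i. \<sigma> i X e) [0..<k]) (F X (\<lambda>i. \<sigma> i X e))"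
      by (rule p) (use that in auto)
  qed
  then show ?thesis unfolding computable_def by blast
qed

lemma computable_rename: "computable D F \<Longrightarrow> computable D (\<lambda>X e. F X (\<lambda>i. e (r i)))"
  using computable_subst[of D F "\<lambda>i X e. e (r i)"] computable_var by blast

lemma computable_comp1:
  assumes "computable D (\<lambda>X e. G X (e 0))" "computable D F"
  shows "computable D (\<lambda>X e. G X (F X e))"
  using computable_subst[OF assms(1), of "\<lambda>_. F"] assms(2) by blast

lemma computable_comp2:
  assumes "computable D (\<lambda>X e. G X (e 0) (e 1))" "computable D F" "computable D F'"
  shows "computable D (\<lambda>X e. G X (F X e) (F' X e))"
proof -
  have "computable D (case_nat F (\<lambda>_. F') i)" for i using assms by (cases i) auto
  from computable_subst[OF assms(1), of "case_nat F (\<lambda>_. F')", OF this] show ?thesis by simp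
qed

lemma computable_zero: "computable D (\<lambda>X e. 0)"
  unfolding computable_def using evaluates.intros(1) by blast

lemma computable_Suc: "computable D F \<Longrightarrow> computable D (\<lambda>X e. Suc (F X e))"
proof (rule computable_comp1[of D "\<lambda>X. Suc"])
  have "evaluates X (Comp Succ [Proj 0]) xs (Suc (e 0))" if "1 \<le> length xs" "\<forall>i<1. xs ! i = e i" for X xs e
  proof (rule evaluates.intros(5))
    show "list_all2 (\<lambda>g y. evaluates X g xs y) [Proj 0] [e 0]"
      using that evaluates.intros(3)[of 0 xs X] by (cases xs) auto
  qed (rule evaluates.intros(2))
  then show "computable D (\<lambda>X e. Suc (e 0))" unfolding computable_def by blast
qed

lemma computable_oracle: "computable D F \<Longrightarrow> computable D (\<lambda>X e. of_bool (F X e \<in> X))"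
proof (rule computable_comp1[of D "\<lambda>X n. of_bool (n \<in> X)"])
  have "evaluates X (Comp Oracle [Proj 0]) xs (of_bool (e 0 \<in> X))" if "1 \<le> length xs" "\<forall>i<1. xs ! i = e i" for X xs e
  proof (rule evaluates.intros(5))
    show "list_all2 (\<lambda>g y. evaluates X g xs y) [Proj 0] [e 0]"
      using that evaluates.intros(3)[of 0 xs X] by (cases xs) auto
  qed (rule evaluates.intros(4))
  then show "computable D (\<lambda>X e. of_bool (e 0 \<in> X))" unfolding computable_def by blast
qed

lemma computable_rec:
  assumes F: "computable D F" and G: "computable D (\<lambda>X e. G X (\<lambda>i. e (Suc (Suc i))) (e 0) (e (Suc 0)))"
    and N: "computable D N"
  shows "computable D (\<lambda>X e. rec_nat (F X e) (\<lambda>n r. G X e n r) (N X e))"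
proof -
  obtain p k where p: "\<And>X e xs. X \<in> D \<Longrightarrow> k \<le> length xs \<Longrightarrow> (\<forall>i<k. xs ! i = e i) \<Longrightarrow> evaluates X p xs (F X e)"
    using F unfolding computable_def by blast
  obtain q l where q: "\<And>X e xs. X \<in> D \<Longrightarrow> l \<le> length xs \<Longrightarrow> (\<forall>i<l. xs ! i = e i) \<Longrightarrow>
      evaluates X q xs (G X (\<lambda>i. e (Suc (Suc i))) (e 0) (e (Suc 0)))"
    using G unfolding computable_def by blast
  let ?m = "max k l"
  have rec: "evaluates X (PrimRec p q) (n # xs) (rec_nat (F X e) (\<lambda>n r. G X e n r) n)"
    if "X \<in> D" "?m \<le> length xs" "\<forall>i<?m. xs ! i = e i" for X e xs n
  proof (induction n)
    case 0
    show ?case using that by (auto intro!: evaluates.intros(6) p)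
  next
    case (Suc n)
    let ?r = "rec_nat (F X e) (\<lambda>n r. G X e n r) n"
    have "(n # ?r # xs) ! i = case_nat n (case_nat ?r e) i" if "i < l" for i
      using \<open>\<forall>i<?m. xs ! i = e i\<close> that by (auto split: nat.split)
    then have "evaluates X q (n # ?r # xs) (G X e n ?r)"
      using q[of X "n # ?r # xs" "case_nat n (case_nat ?r e)"] that by simp
    with Suc show ?case by (auto intro: evaluates.intros(7))
  qed
  have "computable D (\<lambda>X e. rec_nat (F X (\<lambda>i. e (Suc i))) (\<lambda>n r. G X (\<lambda>i. e (Suc i)) n r) (e 0))"
  proof -
    have "evaluates X (PrimRec p q) xs (rec_nat (F X (\<lambda>i. e (Suc i))) (\<lambda>n r. G X (\<lambda>i. e (Suc i)) n r) (e 0))"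
      if "X \<in> D" "Suc ?m \<le> length xs" "\<forall>i<Suc ?m. xs ! i = e i" for X e xs
    proof -
      obtain n ys where xs: "xs = n # ys" using \<open>Suc ?m \<le> length xs\<close> by (cases xs) auto
      have "n = e 0" "\<forall>i<?m. ys ! i = e (Suc i)" using that(3) unfolding xs by force+
      then show ?thesis using rec[of X ys "\<lambda>i. e (Suc i)" n] that unfolding xs by simp
    qed
    then show ?thesis unfolding computable_def by blast
  qed
  from computable_subst[OF this, of "case_nat N (\<lambda>i X e. e i)"] N computable_var show ?thesis
    by (auto split: nat.split)
qed

lemma computable_mu:
  assumes G: "computable D (\<lambda>X e. G X (\<lambda>i. e (Suc i)) (e 0))" and ex: "\<And>X e. X \<in> D \<Longrightarrow> \<exists>n. G X e n = 0"
  shows "computable D (\<lambda>X e. LEAST n. G X e n = 0)"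
proof -
  obtain q l where q: "\<And>X e xs. X \<in> D \<Longrightarrow> l \<le> length xs \<Longrightarrow> (\<forall>i<l. xs ! i = e i) \<Longrightarrow>
      evaluates X q xs (G X (\<lambda>i. e (Suc i)) (e 0))"
    using G unfolding computable_def by blast
  have "evaluates X (Mu q) xs (LEAST n. G X e n = 0)" if "X \<in> D" "l \<le> length xs" "\<forall>i<l. xs ! i = e i" for X e xs
  proof -
    have *: "evaluates X q (n # xs) (G X e n)" for n
    proof -
      have "(n # xs) ! i = case_nat n e i" if "i < l" for i
        using \<open>\<forall>i<l. xs ! i = e i\<close> that by (auto split: nat.split)
      then show ?thesis using q[of X "n # xs" "case_nat n e"] that by simp
    qed
    obtain n where "G X e n = 0" using ex[OF \<open>X \<in> D\<close>] by blast
    then have "G X e (LEAST n. G X e n = 0) = 0" by (rule LeastI)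
    moreover have "G X e m > 0" if "m < (LEAST n. G X e n = 0)" for m
      using not_less_Least[OF that] by simp
    ultimately show ?thesis using * by (metis evaluates.intros(8))
  qed
  then show ?thesis unfolding computable_def by blast
qed

abbreviation decidable :: "nat set set \<Rightarrow> (nat set \<Rightarrow> (nat \<Rightarrow> nat) \<Rightarrow> bool) \<Rightarrow> bool" where
  "decidable D P \<equiv> computable D (\<lambda>X e. of_bool (P X e))"

section \<open>Arithmetic, decidable predicates, search and pairing\<close>

lemma computable_const: "computable D (\<lambda>X e. n)"
  by (induction n) (auto intro: computable_zero computable_Suc)

lemma computable_add: "computable D F \<Longrightarrow> computable D G \<Longrightarrow> computable D (\<lambda>X e. F X e + G X e)"
proof (rule computable_comp2[of D "\<lambda>X. (+)"])
  have "rec_nat m (\<lambda>_ r. Suc r) n = m + n" for m n by (induction n) auto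
  moreover have "computable D (\<lambda>X e. rec_nat (e 0) (\<lambda>_ r. Suc r) (e 1))"
    by (intro computable_rec computable_Suc computable_var)
  ultimately show "computable D (\<lambda>X e. e 0 + e 1)" by simp
qed

lemma computable_mult: "computable D F \<Longrightarrow> computable D G \<Longrightarrow> computable D (\<lambda>X e. F X e * G X e)"
proof (rule computable_comp2[of D "\<lambda>X. (*)"])
  have "rec_nat 0 (\<lambda>_ r. r + m) n = m * n" for m n by (induction n) auto
  moreover have "computable D (\<lambda>X e. rec_nat 0 (\<lambda>_ r. r + e 0) (e 1))"
    by (intro computable_rec computable_add computable_zero computable_var)
  ultimately show "computable D (\<lambda>X e. e 0 * e 1)" by simp
qed

lemma computable_diff: "computable D F \<Longrightarrow> computable D G \<Longrightarrow> computable D (\<lambda>X e. F X e - G X e)"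
proof (rule computable_comp2[of D "\<lambda>X. (-)"])
  have pred: "rec_nat 0 (\<lambda>n _. n) n = n - 1" for n by (cases n) auto
  have "rec_nat m (\<lambda>_ r. rec_nat 0 (\<lambda>n _. n) r) n = m - n" for m n by (induction n) (auto simp: pred)
  moreover have "computable D (\<lambda>X e. rec_nat (e 0) (\<lambda>_ r. rec_nat 0 (\<lambda>n _. n) r) (e 1))"
    by (intro computable_rec computable_zero computable_var)
  ultimately show "computable D (\<lambda>X e. e 0 - e 1)" by simp
qed

lemma decidable_not: "decidable D P \<Longrightarrow> decidable D (\<lambda>X e. \<not> P X e)"
  by (rule computable_cong[of D "\<lambda>X e. 1 - of_bool (P X e)"]) (auto intro: computable_diff computable_const)

lemma decidable_conj: "decidable D P \<Longrightarrow> decidable D Q \<Longrightarrow> decidable D (\<lambda>X e. P X e \<and> Q X e)"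
  by (rule computable_cong[of D "\<lambda>X e. of_bool (P X e) * of_bool (Q X e)"]) (auto intro: computable_mult)

lemma decidable_disj: "decidable D P \<Longrightarrow> decidable D Q \<Longrightarrow> decidable D (\<lambda>X e. P X e \<or> Q X e)"
  using decidable_not[OF decidable_conj[OF decidable_not decidable_not], of D P Q] by simp

lemma decidable_less: "computable D F \<Longrightarrow> computable D G \<Longrightarrow> decidable D (\<lambda>X e. F X e < G X e)"
proof (rule computable_cong[of D "\<lambda>X e. rec_nat 0 (\<lambda>_ _. 1) (G X e - F X e)"])
  show "rec_nat 0 (\<lambda>_ _. 1) (G X e - F X e) = of_bool (F X e < G X e)" for X e
    by (cases "G X e - F X e") auto
qed (intro computable_rec computable_zero computable_const computable_diff)

lemma decidable_eq: "computable D F \<Longrightarrow> computable D G \<Longrightarrow> decidable D (\<lambda>X e. F X e = G X e)"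
  by (rule computable_cong[of D "\<lambda>X e. of_bool (\<not> F X e < G X e \<and> \<not> G X e < F X e)"])
    (auto intro!: decidable_conj decidable_not decidable_less)

lemma computable_least:
  assumes "decidable D (\<lambda>X e. P X (\<lambda>i. e (Suc i)) (e 0))" and "\<And>X e. X \<in> D \<Longrightarrow> \<exists>n. P X e n"
  shows "computable D (\<lambda>X e. LEAST n. P X e n)"
proof -
  have "computable D (\<lambda>X e. LEAST n. of_bool (\<not> P X e n) = (0 :: nat))"
    using assms by (intro computable_mu decidable_not) auto
  then show ?thesis by simp
qed

text \<open>The extra disjunct \<open>x = t X e\<close> makes the unbounded search total; a true
  witness exists exactly if the search stops before the bound.\<close>

lemma decidable_bex:
  assumes P: "decidable D (\<lambda>X e. P X (\<lambda>i. e (Suc i)) (e 0))" and t: "computable D t"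
  shows "decidable D (\<lambda>X e. \<exists>x<t X e. P X e x)"
proof (rule computable_cong[of D "\<lambda>X e. of_bool ((LEAST x. P X e x \<or> x = t X e) < t X e)"])
  show "of_bool ((LEAST x. P X e x \<or> x = t X e) < t X e) = of_bool (\<exists>x<t X e. P X e x)" for X e
  proof (cases "\<exists>x<t X e. P X e x")
    case True
    then obtain x where "x < t X e" "P X e x" by blast
    then have "(LEAST x. P X e x \<or> x = t X e) \<le> x" by (intro Least_le) blast
    with \<open>x < t X e\<close> True show ?thesis by simp
  next
    case False
    have "P X e (LEAST x. P X e x \<or> x = t X e) \<or> (LEAST x. P X e x \<or> x = t X e) = t X e"
      by (rule LeastI[of "\<lambda>x. P X e x \<or> x = t X e" "t X e"]) simp
    with False have "\<not> (LEAST x. P X e x \<or> x = t X e) < t X e" by auto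
    with False show ?thesis by simp
  qed
  show "decidable D (\<lambda>X e. (LEAST x. P X e x \<or> x = t X e) < t X e)"
    using computable_rename[OF t, of Suc] by (intro decidable_less computable_least decidable_disj decidable_eq P t computable_var) auto
qed

lemma computable_if:
  assumes "decidable D P" "computable D F" "computable D G"
  shows "computable D (\<lambda>X e. if P X e then F X e else G X e)"
proof (rule computable_cong[of D "\<lambda>X e. of_bool (P X e) * F X e + of_bool (\<not> P X e) * G X e"])
  show "computable D (\<lambda>X e. of_bool (P X e) * F X e + of_bool (\<not> P X e) * G X e)"
    using assms by (intro computable_add computable_mult decidable_not)
qed auto

lemma computable_prod_encode:
  "computable D F \<Longrightarrow> computable D G \<Longrightarrow> computable D (\<lambda>X e. prod_encode (F X e, G X e))"
proof (rule computable_comp2[of D "\<lambda>X m n. prod_encode (m, n)"])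
  have "rec_nat 0 (\<lambda>n r. r + Suc n) n = triangle n" for n by (induction n) auto
  moreover have "computable D (\<lambda>X e. rec_nat 0 (\<lambda>n r. r + Suc n) (e 0 + e 1) + e 0)"
    by (intro computable_add computable_rec computable_Suc computable_zero computable_var)
  ultimately show "computable D (\<lambda>X e. prod_encode (e 0, e 1))" by (simp add: prod_encode_def)
qed

lemma computable_fst_decode: "computable D F \<Longrightarrow> computable D (\<lambda>X e. fst (prod_decode (F X e)))"
proof (rule computable_comp1[of D "\<lambda>X n. fst (prod_decode n)"])
  have eq: "(LEAST a. \<exists>b<Suc n. prod_encode (a, b) = n) = fst (prod_decode n)" for n
  proof (rule Least_equality)
    obtain a b where "prod_decode n = (a, b)" by fastforce
    then have n: "n = prod_encode (a, b)" using prod_decode_inverse[of n] by simp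
    then show "\<exists>b<Suc n. prod_encode (fst (prod_decode n), b) = n"
      using le_prod_encode_2[of b a] by (intro exI[of _ b]) simp
  qed auto
  have ex: "\<exists>a. \<exists>b<Suc n. prod_encode (a, b) = n" for n
    using le_prod_encode_2[of "snd (prod_decode n)" "fst (prod_decode n)"]
    by (intro exI[of _ "fst (prod_decode n)"] exI[of _ "snd (prod_decode n)"]) simp
  have "computable D (\<lambda>X e. LEAST a. \<exists>b<Suc (e 0). prod_encode (a, b) = e 0)"
    using ex by (intro computable_least decidable_bex decidable_eq computable_prod_encode computable_Suc computable_var)
  then show "computable D (\<lambda>X e. fst (prod_decode (e 0)))" by (simp add: eq)
qed

lemma computable_snd_decode: "computable D F \<Longrightarrow> computable D (\<lambda>X e. snd (prod_decode (F X e)))"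
proof (rule computable_comp1[of D "\<lambda>X n. snd (prod_decode n)"])
  have eq: "(LEAST b. prod_encode (fst (prod_decode n), b) = n) = snd (prod_decode n)" for n
    by (rule Least_equality) (auto, metis order_refl prod_encode_inverse snd_conv)
  have ex: "\<exists>b. prod_encode (fst (prod_decode n), b) = n" for n
    by (intro exI[of _ "snd (prod_decode n)"]) simp
  have "computable D (\<lambda>X e. LEAST b. prod_encode (fst (prod_decode (e 0)), b) = e 0)"
    using ex by (intro computable_least decidable_eq computable_prod_encode computable_fst_decode computable_var)
  then show "computable D (\<lambda>X e. snd (prod_decode (e 0)))" by (simp add: eq)
qed

lemma computable_power2: "computable D F \<Longrightarrow> computable D (\<lambda>X e. 2 ^ F X e)"
proof (rule computable_cong[of D "\<lambda>X e. rec_nat 1 (\<lambda>_ r. 2 * r) (F X e)"])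
  have "rec_nat 1 (\<lambda>_ r. 2 * r) n = 2 ^ n" for n by (induction n) auto
  then show "rec_nat 1 (\<lambda>_ r. 2 * r) (F X e) = 2 ^ F X e" for X e by blast
qed (intro computable_rec computable_mult computable_const computable_var)

text \<open>\<open>computes\<close> passes a single argument, while \<open>p\<close> may expect a
  list of length \<open>k\<close>; the missing places are filled with zeros.\<close>

lemma computes_if_decidable:
  assumes "decidable D (\<lambda>X e. P X (e 0))"
  shows "\<exists>\<Phi>. \<forall>X\<in>D. computes \<Phi> X {n. P X n}"
proof -
  obtain p k where p: "\<And>X e xs. X \<in> D \<Longrightarrow> k \<le> length xs \<Longrightarrow> (\<forall>i<k. xs ! i = e i) \<Longrightarrow> evaluates X p xs (of_bool (P X (e 0)))"
    using assms unfolding computable_def by blast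
  let ?\<Phi> = "Comp p (map (\<lambda>i. if i = 0 then Proj 0 else Const0) [0..<k])"
  have "evaluates X ?\<Phi> [n] (of_bool (P X n))" if "X \<in> D" for X n
  proof (rule evaluates.intros(5))
    let ?e = "\<lambda>i. if i = 0 then n else 0"
    show "list_all2 (\<lambda>g y. evaluates X g [n] y) (map (\<lambda>i. if i = 0 then Proj 0 else Const0) [0..<k]) (map ?e [0..<k])"
      using evaluates.intros(3)[of 0 "[n]" X] by (auto simp: list_all2_conv_all_nth intro: evaluates.intros)
    show "evaluates X p (map ?e [0..<k]) (of_bool (P X n))"
      using p[OF that, of "map ?e [0..<k]" ?e] by simp
  qed
  then show ?thesis unfolding computes_def by (intro exI[of _ ?\<Phi>]) simp
qed

section \<open>The Weihrauch reduction\<close>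

text \<open>Entries are shifted by one, so that 0 stands for a position beyond the end of the list.\<close>

definition head_code :: "nat \<Rightarrow> nat" where
  "head_code u = (if u = 0 then 0 else Suc (fst (prod_decode (u - 1))))"

definition tail_code :: "nat \<Rightarrow> nat" where
  "tail_code u = (if u = 0 then 0 else snd (prod_decode (u - 1)))"

definition nth_code :: "nat \<Rightarrow> nat \<Rightarrow> nat" where
  "nth_code u d = head_code (rec_nat u (\<lambda>_. tail_code) d)"

lemma nth_code_list_encode: "nth_code (list_encode xs) d = (if d < length xs then Suc (xs ! d) else 0)"
proof -
  \<comment> \<open>Moves one tail step from the outside of the iteration to the inside, to fit the
    induction on the list.\<close>
  have shift: "rec_nat u (\<lambda>_. tail_code) (Suc d) = rec_nat (tail_code u) (\<lambda>_. tail_code) d" for u d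
    by (induction d) auto
  have zero: "rec_nat 0 (\<lambda>_. tail_code) d = 0" for d by (induction d) (auto simp: tail_code_def)
  show ?thesis
  proof (induction xs arbitrary: d)
    case Nil
    then show ?case by (simp add: nth_code_def zero head_code_def)
  next
    case (Cons x xs)
    show ?case
    proof (cases d)
      case 0
      then show ?thesis by (simp add: nth_code_def head_code_def)
    next
      case (Suc d')
      have "tail_code (list_encode (x # xs)) = list_encode xs" by (simp add: tail_code_def)
      then have "nth_code (list_encode (x # xs)) d = nth_code (list_encode xs) d'"
        unfolding nth_code_def Suc shift by simp
      with Cons Suc show ?thesis by simp
    qed
  qed
qed

text \<open>
  The oracle of the forward functional is an instance \<open>X\<close>, that of the backward functional is
  \<open>X \<oplus> H\<close>; the factor \<open>a\<close> is 1 and 2, respectively, since \<open>n \<in> X\<close> iff \<open>2 * n \<in> X \<oplus> H\<close>.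
\<close>

definition term_code :: "nat \<Rightarrow> nat set \<Rightarrow> nat \<Rightarrow> nat" where
  "term_code a Z i = (LEAST y. a * (2 * prod_encode (i, y) + 1) \<in> Z)"

text \<open>The second disjunct makes the search halt for equal strings too, as
  \<open>computable_least\<close> asks for totality. Strings of different length are told apart by
  the value 0 beyond the end.\<close>

definition diff_pos :: "nat \<Rightarrow> nat set \<Rightarrow> nat \<Rightarrow> nat \<Rightarrow> nat" where
  "diff_pos a Z i j = (LEAST d. nth_code (term_code a Z i) d \<noteq> nth_code (term_code a Z j) d \<or> term_code a Z i = term_code a Z j)"

text \<open>What the programs rely on when reading strings from the oracle, in a form that fits both
  functionals.\<close>

definition has_terms :: "nat \<Rightarrow> nat set \<Rightarrow> (nat \<Rightarrow> nat list) \<Rightarrow> bool" where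
  "has_terms a Z s \<longleftrightarrow> (\<forall>i y. a * (2 * prod_encode (i, y) + 1) \<in> Z \<longleftrightarrow> y = list_encode (s i))"

lemma term_code: "has_terms a Z s \<Longrightarrow> term_code a Z i = list_encode (s i)"
  unfolding has_terms_def term_code_def by (intro Least_equality) auto

lemma ex_diff_pos:
  assumes "has_terms a Z s"
  shows "\<exists>d. nth_code (term_code a Z i) d \<noteq> nth_code (term_code a Z j) d \<or> term_code a Z i = term_code a Z j"
proof (rule ccontr)
  assume "\<not> ?thesis"
  then have *: "\<And>d. nth_code (term_code a Z i) d = nth_code (term_code a Z j) d" "s i \<noteq> s j"
    by (auto simp: term_code[OF assms])
  have eq: "d < length (s i) \<longleftrightarrow> d < length (s j)" "d < length (s i) \<Longrightarrow> s i ! d = s j ! d" for d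
    using *(1)[of d] by (auto simp: term_code[OF assms] nth_code_list_encode split: if_splits)
  have "length (s i) = length (s j)" using eq(1) by (metis linorder_neqE_nat less_irrefl)
  then have "s i = s j" using eq(2) by (rule nth_equalityI)
  with *(2) show False by blast
qed

lemma computable_head_code: "computable D F \<Longrightarrow> computable D (\<lambda>X e. head_code (F X e))"
  unfolding head_code_def
  by (intro computable_if decidable_eq computable_Suc computable_fst_decode computable_diff computable_const)

lemma computable_tail_code: "computable D F \<Longrightarrow> computable D (\<lambda>X e. tail_code (F X e))"
  unfolding tail_code_def
  by (intro computable_if decidable_eq computable_snd_decode computable_diff computable_const)

lemma computable_nth_code: "computable D F \<Longrightarrow> computable D G \<Longrightarrow> computable D (\<lambda>X e. nth_code (F X e) (G X e))"
  unfolding nth_code_def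
  by (intro computable_head_code computable_rec computable_tail_code computable_var)

lemma computable_term_code:
  assumes D: "\<And>Z. Z \<in> D \<Longrightarrow> \<exists>s. has_terms a Z s" and F: "computable D F"
  shows "computable D (\<lambda>Z e. term_code a Z (F Z e))"
proof (rule computable_comp1[of D "term_code a", OF _ F])
  have "\<exists>y. a * (2 * prod_encode (i, y) + 1) \<in> Z" if "Z \<in> D" for Z i
    using D[OF that] unfolding has_terms_def by blast
  then show "computable D (\<lambda>Z e. term_code a Z (e 0))"
    unfolding term_code_def
    by (intro computable_least computable_oracle computable_mult computable_add computable_const
        computable_prod_encode computable_var)
qed

lemma computable_diff_pos:
  assumes D: "\<And>Z. Z \<in> D \<Longrightarrow> \<exists>s. has_terms a Z s" and F: "computable D F" "computable D G"
  shows "computable D (\<lambda>Z e. diff_pos a Z (F Z e) (G Z e))"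
proof (rule computable_comp2[of D "diff_pos a", OF _ F])
  show "computable D (\<lambda>Z e. diff_pos a Z (e 0) (e 1))"
    unfolding diff_pos_def using ex_diff_pos D
    by (intro computable_least decidable_disj decidable_not decidable_eq computable_nth_code
        computable_term_code computable_var) blast+
qed

section \<open>The colouring computed by the forward functional\<close>

definition triple_colour :: "nat \<Rightarrow> nat set \<Rightarrow> nat \<Rightarrow> nat \<Rightarrow> nat \<Rightarrow> nat" where
  "triple_colour a Z i j k = (if diff_pos a Z j k < diff_pos a Z i j then 1 else 0)"

lemma computable_triple_colour:
  assumes D: "\<And>Z. Z \<in> D \<Longrightarrow> \<exists>s. has_terms a Z s" and F: "computable D F" "computable D G" "computable D H"
  shows "computable D (\<lambda>Z e. triple_colour a Z (F Z e) (G Z e) (H Z e))"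
  unfolding triple_colour_def using D F
  by (intro computable_if decidable_less computable_diff_pos computable_const)

definition colouring :: "nat set \<Rightarrow> nat set \<Rightarrow> nat" where
  "colouring Z A = (let xs = sorted_list_of_set A in triple_colour 1 Z (xs ! 0) (xs ! 1) (xs ! 2))"

lemma colouring_triple: "i < j \<Longrightarrow> j < k \<Longrightarrow> colouring Z {i, j, k} = triple_colour 1 Z i j k"
proof -
  assume "i < j" "j < k"
  then have "sorted_list_of_set (set [i, j, k]) = [i, j, k]"
    by (intro sorted_list_of_set.idem_if_sorted_distinct) auto
  then show ?thesis by (simp add: colouring_def)
qed

lemma nsets_3_eq: "A \<in> [UNIV :: nat set]\<^bsup>3\<^esup> \<longleftrightarrow> (\<exists>i j k. i < j \<and> j < k \<and> A = {i, j, k})"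
proof
  assume "A \<in> [UNIV]\<^bsup>3\<^esup>"
  then have A: "finite A" "card A = 3" by (auto simp: nsets_def)
  define xs where "xs = sorted_list_of_set A"
  have "length xs = 3" "sorted_wrt (<) xs" "set xs = A" using A by (auto simp: xs_def)
  moreover from this obtain i j k where "xs = [i, j, k]"
    by (auto simp: numeral_3_eq_3 length_Suc_conv)
  ultimately show "\<exists>i j k. i < j \<and> j < k \<and> A = {i, j, k}" by auto
qed (auto simp: nsets_def)

lemma set_encode_triple: "i < j \<Longrightarrow> j < k \<Longrightarrow> set_encode {i, j, k} = 2 ^ i + 2 ^ j + 2 ^ k"
  by (simp add: set_encode_def)

text \<open>Each \<open>i\<close> of the triple satisfies \<open>i < 2 ^ i\<close>, and the pair
  code is at least this power, so membership is decided by a bounded search.\<close>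

lemma mem_colouring_code_iff:
  "n \<in> colouring_code (colouring Z) \<longleftrightarrow>
    (\<exists>i<Suc n. \<exists>j<Suc n. \<exists>k<Suc n. i < j \<and> j < k \<and> n = prod_encode (2 ^ i + 2 ^ j + 2 ^ k, triple_colour 1 Z i j k))"
proof -
  have "i < Suc n \<and> j < Suc n \<and> k < Suc n" if "n = prod_encode (2 ^ i + 2 ^ j + 2 ^ k, c)" for i j k c
  proof -
    have "i < 2 ^ i" "j < 2 ^ j" "k < 2 ^ k" by (rule less_exp)+
    then show ?thesis using le_prod_encode_1[of "2 ^ i + 2 ^ j + 2 ^ k" c] that by linarith
  qed
  moreover have "n \<in> colouring_code (colouring Z) \<longleftrightarrow>
    (\<exists>i j k. i < j \<and> j < k \<and> n = prod_encode (2 ^ i + 2 ^ j + 2 ^ k, triple_colour 1 Z i j k))"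
  proof -
    have "n \<in> colouring_code (colouring Z) \<longleftrightarrow>
      (\<exists>i j k. i < j \<and> j < k \<and> n = prod_encode (set_encode {i, j, k}, colouring Z {i, j, k}))"
      unfolding colouring_code_def nsets_3_eq by blast
    also have "\<dots> \<longleftrightarrow> (\<exists>i j k. i < j \<and> j < k \<and> n = prod_encode (2 ^ i + 2 ^ j + 2 ^ k, triple_colour 1 Z i j k))"
      by (metis colouring_triple set_encode_triple)
    finally show ?thesis .
  qed
  ultimately show ?thesis by blast
qed

lemma mem_join_iff: "2 * n \<in> A \<oplus> B \<longleftrightarrow> n \<in> A" "2 * n + 1 \<in> A \<oplus> B \<longleftrightarrow> n \<in> B" "Suc (2 * n) \<in> A \<oplus> B \<longleftrightarrow> n \<in> B"
  by (auto simp: join_def) presburger+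

lemma has_terms_instance: "has_terms 1 (WOP_instance_code r s) s"
  by (auto simp: has_terms_def WOP_instance_code_def graph_code_def mem_join_iff)

lemma has_terms_join: "has_terms 1 X s \<Longrightarrow> has_terms 2 (X \<oplus> H) s"
  unfolding has_terms_def by (simp only: mult_1 mem_join_iff(1) simp_thms)

text \<open>The backward functional reads its positions from \<open>X \<oplus> H\<close>, while
  \<open>H\<close> is homogeneous for positions read from \<open>X\<close>; the two agree.\<close>

lemma diff_pos_eq:
  assumes "has_terms a Z s" "has_terms b Z' s" shows "diff_pos a Z i j = diff_pos b Z' i j"
  unfolding diff_pos_def term_code[OF assms(1)] term_code[OF assms(2)] ..

lemma descending_less:
  assumes "Linear_order r" "descending_in_omega_power r s" "i < j"
  shows "(s j, s i) \<in> lexord (r - Id)"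
proof -
  have "trans (r - Id)" using assms(1)
    by (simp add: linear_order_on_def partial_order_on_def preorder_on_def trans_diff_Id)
  then have "trans (lexord (r - Id))" by (rule lexord_transI)
  show ?thesis using \<open>i < j\<close>
  proof (induction j)
    case (Suc j)
    have step: "(s (Suc j), s j) \<in> lexord (r - Id)" using assms(2) by (simp add: descending_in_omega_power_def)
    show ?case
    proof (cases "i = j")
      case False
      then have "(s j, s i) \<in> lexord (r - Id)" using Suc by simp
      with step show ?thesis using \<open>trans (lexord (r - Id))\<close> by (blast dest: transD)
    qed (use step in simp)
  qed simp
qed

text \<open>The two clauses of \<open>lexord\<close>: either \<open>s j\<close> is a proper initial
  segment of \<open>s i\<close>, and the position is its length, or the entry of \<open>s j\<close>
  right after the common part \<open>us\<close> is smaller.\<close>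

lemma diff_pos_descending:
  assumes r: "Linear_order r" "descending_in_omega_power r s" and Z: "has_terms a Z s" and "i < j"
  defines "d \<equiv> diff_pos a Z i j"
  shows "d < length (s i)" "d < length (s j) \<Longrightarrow> (s j ! d, s i ! d) \<in> r - Id"
proof -
  let ?P = "\<lambda>d. nth_code (term_code a Z i) d \<noteq> nth_code (term_code a Z j) d \<or> term_code a Z i = term_code a Z j"
  have nth: "nth_code (term_code a Z i) d = (if d < length (s i) then Suc (s i ! d) else 0)" for i d
    by (simp add: term_code[OF Z] nth_code_list_encode)
  have ne: "term_code a Z i \<noteq> term_code a Z j" if "s i \<noteq> s j"
    using that unfolding term_code[OF Z] by (metis list_encode_inverse)
  have lex: "(s j, s i) \<in> lexord (r - Id)" by (rule descending_less[OF r \<open>i < j\<close>])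
  then consider x xs where "s i = s j @ x # xs"
    | us x y vs ws where "(x, y) \<in> r - Id" "s j = us @ x # vs" "s i = us @ y # ws"
    unfolding lexord_def by blast
  then have "d < length (s i) \<and> (d < length (s j) \<longrightarrow> (s j ! d, s i ! d) \<in> r - Id)"
  proof cases
    case 1
    have "d = length (s j)" unfolding d_def diff_pos_def
    proof (rule Least_equality)
      show "?P (length (s j))" using 1 by (simp add: nth)
    next
      fix e assume "?P e"
      then show "length (s j) \<le> e"
        using 1 ne by (auto simp: nth nth_append split: if_splits)
    qed
    with 1 show ?thesis by simp
  next
    case 2
    have "d = length us" unfolding d_def diff_pos_def
    proof (rule Least_equality)
      show "?P (length us)" using 2 by (simp add: nth)
    next
      fix e assume "?P e"
      then show "length us \<le> e"
        using 2 ne by (auto simp: nth nth_append split: if_splits)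
    qed
    with 2 show ?thesis by simp
  qed
  then show "d < length (s i)" "d < length (s j) \<Longrightarrow> (s j ! d, s i ! d) \<in> r - Id" by auto
qed

lemma descending_entries:
  assumes r: "Linear_order r" "descending_in_omega_power r s" and Z: "has_terms a Z s" and "i < j" "j < k"
    and le: "diff_pos a Z i j \<le> diff_pos a Z j k"
  shows "(s j ! diff_pos a Z j k, s i ! diff_pos a Z i j) \<in> r - Id"
proof -
  let ?d = "diff_pos a Z i j" and ?d' = "diff_pos a Z j k"
  have d': "?d' < length (s j)" using diff_pos_descending(1)[OF r Z \<open>j < k\<close>] .
  \<comment> \<open>From \<open>?d \<le> ?d'\<close> and \<open>?d'\<close> below the length,
    \<open>s j\<close> has an entry at \<open>?d\<close>; so it does not end there as an initial
    segment of \<open>s i\<close>.\<close>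
  have lt: "(s j ! ?d, s i ! ?d) \<in> r - Id"
    using diff_pos_descending(2)[OF r Z \<open>i < j\<close>] d' le by simp
  show ?thesis
  proof (cases "?d = ?d'")
    case False
    have "sorted_wrt (\<lambda>x y. (y, x) \<in> r) (s j)"
      using r(2) by (simp add: descending_in_omega_power_def omega_power_def)
    then have "(s j ! ?d', s j ! ?d) \<in> r" using False le d' by (auto simp: sorted_wrt_iff_nth_less)
    then show ?thesis using lt r(1)
      by (auto simp: linear_order_on_def partial_order_on_def preorder_on_def dest: transD antisymD)
  qed (use lt in simp)
qed

section \<open>The descending sequence computed by the backward functional\<close>

definition enum :: "nat set \<Rightarrow> nat \<Rightarrow> nat" where
  "enum Z n = rec_nat (LEAST y. 2 * y + 1 \<in> Z) (\<lambda>_ r. LEAST y. r < y \<and> 2 * y + 1 \<in> Z) n"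

lemma enum_join:
  assumes "infinite H" shows "enum (X \<oplus> H) n \<in> H" "enum (X \<oplus> H) n < enum (X \<oplus> H) (Suc n)"
proof -
  have ex: "\<exists>y. m < y \<and> y \<in> H" for m using assms by (meson infinite_nat_iff_unbounded)
  have step: "enum (X \<oplus> H) n < enum (X \<oplus> H) (Suc n) \<and> enum (X \<oplus> H) (Suc n) \<in> H" for n
    using LeastI_ex[OF ex[of "enum (X \<oplus> H) n"]] by (simp add: enum_def mem_join_iff)
  have "\<exists>y. y \<in> H" using ex by blast
  from LeastI_ex[OF this] have "enum (X \<oplus> H) 0 \<in> H" by (simp add: enum_def mem_join_iff)
  with step show "enum (X \<oplus> H) n \<in> H" "enum (X \<oplus> H) n < enum (X \<oplus> H) (Suc n)" by (cases n; simp)+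
qed

lemma computable_enum:
  assumes D: "\<And>Z m. Z \<in> D \<Longrightarrow> \<exists>y. m < y \<and> 2 * y + 1 \<in> Z" and F: "computable D F"
  shows "computable D (\<lambda>Z e. enum Z (F Z e))"
  unfolding enum_def
proof (intro computable_rec computable_least decidable_conj decidable_less computable_oracle computable_add computable_mult
      computable_const computable_var F)
  show "\<exists>y. 2 * y + 1 \<in> Z" if "Z \<in> D" for Z using D[OF that] by blast
qed (use D in auto)

text \<open>Subtracting 1 undoes the shift of entries in \<open>nth_code\<close>.\<close>

definition descent_value :: "nat set \<Rightarrow> nat \<Rightarrow> nat" where
  "descent_value Z n = nth_code (term_code 2 Z (enum Z n)) (diff_pos 2 Z (enum Z n) (enum Z (Suc n))) - 1"

lemma mem_graph_code_iff: "m \<in> graph_code f \<longleftrightarrow> snd (prod_decode m) = f (fst (prod_decode m))"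
  unfolding graph_code_def by (auto simp: prod_encode_inverse) (metis prod.collapse prod_decode_inverse)

lemma homogeneous_descent:
  assumes r: "Linear_order r" "descending_in_omega_power r s" and X: "has_terms 1 X s"
    and H: "infinite H" "\<And>A. A \<in> [H]\<^bsup>3\<^esup> \<Longrightarrow> colouring X A = b"
  shows "descending_in r (descent_value (X \<oplus> H))"
proof -
  have mono: "triple_colour 1 X i j k = b" if "i \<in> H" "j \<in> H" "k \<in> H" "i < j" "j < k" for i j k
  proof -
    have "{i, j, k} \<in> [H]\<^bsup>3\<^esup>" using that by (auto simp: nsets_def)
    then show ?thesis using H(2) colouring_triple that by metis
  qed
  have ex_next: "\<exists>j\<in>H. i < j" for i using H(1) by (meson infinite_nat_iff_unbounded)
  have le: "diff_pos 1 X i j \<le> diff_pos 1 X j k" if "i \<in> H" "j \<in> H" "k \<in> H" "i < j" "j < k" for i j k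
  proof (rule ccontr)
    assume "\<not> ?thesis"
    then have b: "b = 1" using mono[OF that] by (simp add: triple_colour_def)
    \<comment> \<open>One drop on \<open>H\<close> fixes the homogeneous colour as 1, so the least
      position taken on \<open>H\<close> would drop once more.\<close>
    let ?P = "\<lambda>d. \<exists>i\<in>H. \<exists>j\<in>H. i < j \<and> d = diff_pos 1 X i j"
    have "?P (diff_pos 1 X i j)" using that by blast
    then have "?P (LEAST d. ?P d)" by (rule LeastI)
    then obtain i j where ij: "i \<in> H" "j \<in> H" "i < j" "(LEAST d. ?P d) = diff_pos 1 X i j" by blast
    obtain k where k: "k \<in> H" "j < k" using ex_next by blast
    have "triple_colour 1 X i j k = 1" using mono[OF ij(1,2) k(1) ij(3) k(2)] b by simp
    then have "diff_pos 1 X j k < diff_pos 1 X i j" unfolding triple_colour_def by (metis zero_neq_one)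
    moreover have "diff_pos 1 X i j \<le> diff_pos 1 X j k"
      unfolding ij(4)[symmetric] by (rule Least_le) (use ij(2) k in blast)
    ultimately show False by simp
  qed
  let ?Z = "X \<oplus> H"
  have Z: "has_terms 2 ?Z s" using X by (rule has_terms_join)
  let ?h = "enum ?Z"
  have value_eq: "descent_value ?Z n = s (?h n) ! diff_pos 1 X (?h n) (?h (Suc n))" for n
    using diff_pos_descending(1)[OF r X enum_join(2)[OF H(1)]]
    unfolding descent_value_def diff_pos_eq[OF Z X] term_code[OF Z] nth_code_list_encode by simp
  show ?thesis unfolding descending_in_def value_eq
    by (intro allI descending_entries[OF r X] le enum_join[OF H(1)])
qed

lemma WOP_omega_reducible: "WOP_omega_problem \<le>\<^sub>W RT32_problem"
proof -
  let ?D = "instances WOP_omega_problem"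
  have inst: "\<exists>r s. Linear_order r \<and> descending_in_omega_power r s \<and> X = WOP_instance_code r s" if "X \<in> ?D" for X
    using that by (auto simp: WOP_omega_problem_def)
  then have terms: "\<exists>s. has_terms 1 X s" if "X \<in> ?D" for X
    using that has_terms_instance by blast
  \<comment> \<open>For the searches of the backward functional to halt it suffices that
    \<open>H\<close> is infinite; homogeneity matters only for the correctness of the
    output.\<close>
  let ?E = "{X \<oplus> H | X H. X \<in> ?D \<and> infinite H}"
  have terms': "\<exists>s. has_terms 2 Z s" if "Z \<in> ?E" for Z
    using that terms has_terms_join by blast
  have unbounded: "\<exists>y. m < y \<and> 2 * y + 1 \<in> Z" if "Z \<in> ?E" for Z m
  proof -
    obtain X H where Z: "Z = X \<oplus> H" "infinite H" using \<open>Z \<in> ?E\<close> by blast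
    then obtain y where "m < y" "y \<in> H" by (meson infinite_nat_iff_unbounded)
    then show ?thesis unfolding Z mem_join_iff by blast
  qed
  have "decidable ?D (\<lambda>X e. \<exists>i<Suc (e 0). \<exists>j<Suc (e 0). \<exists>k<Suc (e 0). i < j \<and> j < k \<and>
      e 0 = prod_encode (2 ^ i + 2 ^ j + 2 ^ k, triple_colour 1 X i j k))"
    using terms by (intro decidable_bex decidable_conj decidable_less decidable_eq computable_Suc computable_prod_encode
        computable_add computable_power2 computable_triple_colour computable_var)
  from computes_if_decidable[OF this] obtain \<Phi> where \<Phi>: "\<And>X. X \<in> ?D \<Longrightarrow> computes \<Phi> X (colouring_code (colouring X))"
    unfolding mem_colouring_code_iff[symmetric] by auto
  have "decidable ?E (\<lambda>Z e. snd (prod_decode (e 0)) = descent_value Z (fst (prod_decode (e 0))))"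
    unfolding descent_value_def using terms' unbounded
    by (intro decidable_eq computable_snd_decode computable_diff computable_nth_code computable_term_code computable_diff_pos
        computable_enum computable_Suc computable_fst_decode computable_const computable_var)
  from computes_if_decidable[OF this] obtain \<Psi> where \<Psi>: "\<And>Z. Z \<in> ?E \<Longrightarrow> computes \<Psi> Z (graph_code (descent_value Z))"
    unfolding mem_graph_code_iff[symmetric] by auto
  show ?thesis unfolding weihrauch_reducible_def
  proof (rule exI[of _ \<Phi>], rule exI[of _ \<Psi>], rule ballI)
    fix X assume X: "X \<in> ?D"
    then obtain r s where rs: "Linear_order r" "descending_in_omega_power r s" "X = WOP_instance_code r s" using inst by blast
    show "\<exists>Y. computes \<Phi> X Y \<and> Y \<in> instances RT32_problem \<and>
      (\<forall>Y'\<in>solutions RT32_problem Y. \<exists>Z. computes \<Psi> (X \<oplus> Y') Z \<and> Z \<in> solutions WOP_omega_problem X)"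
    proof (rule exI[of _ "colouring_code (colouring X)"], intro conjI ballI)
      show "computes \<Phi> X (colouring_code (colouring X))" using \<Phi> X .
      have "colouring X \<in> [UNIV]\<^bsup>3\<^esup> \<rightarrow> {0, 1}" by (auto simp: colouring_def triple_colour_def Let_def)
      then show "colouring_code (colouring X) \<in> instances RT32_problem" by (auto simp: RT32_problem_def)
      fix H assume "H \<in> solutions RT32_problem (colouring_code (colouring X))"
      then obtain c b where H: "infinite H" "colouring_code (colouring X) = colouring_code c" "\<forall>A\<in>[H]\<^bsup>3\<^esup>. c A = b"
        by (auto simp: RT32_problem_def)
      \<comment> \<open>A solution refers to some colouring \<open>c\<close> with the given code.
        The code determines the values on triples, so \<open>c\<close> agrees there with
        \<open>colouring X\<close>.\<close>
      have "colouring X A = b" if "A \<in> [H]\<^bsup>3\<^esup>" for A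
      proof -
        have A: "A \<in> [UNIV]\<^bsup>3\<^esup>" using that by (auto simp: nsets_def)
        then have "prod_encode (set_encode A, colouring X A) \<in> colouring_code (colouring X)"
          unfolding colouring_code_def by blast
        then have "prod_encode (set_encode A, colouring X A) \<in> colouring_code c" unfolding H(2) .
        then obtain B where B: "B \<in> [UNIV]\<^bsup>3\<^esup>" "set_encode A = set_encode B" "colouring X A = c B"
          unfolding colouring_code_def by auto
        then have "A = B" using A by (auto simp: nsets_def set_encode_eq)
        with B H(3) that show ?thesis by simp
      qed
      then have "descending_in r (descent_value (X \<oplus> H))"
        using homogeneous_descent[OF rs(1,2), of X H b] H(1) has_terms_instance unfolding rs(3) by blast
      then have "graph_code (descent_value (X \<oplus> H)) \<in> solutions WOP_omega_problem X"
        using rs by (auto simp: WOP_omega_problem_def)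
      moreover have "computes \<Psi> (X \<oplus> H) (graph_code (descent_value (X \<oplus> H)))"
        using \<Psi> X H(1) by blast
      ultimately show "\<exists>Z. computes \<Psi> (X \<oplus> H) Z \<and> Z \<in> solutions WOP_omega_problem X" by blast
    qed
  qed
qed

theorem theorem1:
  "proves RCA0 ((RT32 \<^bold>\<longrightarrow> WOP_omega) 0 0) \<and> WOP_omega_problem \<le>\<^sub>W RT32_problem"
  using RCA0_proves WOP_omega_reducible by blast

end
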